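(* Let $S:H\to H$ be $A$-linear and $T$-strongly bounded, i.e. $S\in\mathcal B_T(H)$. Then there exists a unique operator $S^*\in\mathcal B_T(H)$ such that $$\langle Sx,y\rangle_T=\langle x,S^*y\rangle_T\qquad\text{for all }x,y\in H.$$ Moreover, if $k\in A_+$ satisfies $\|Sx\|_{T,2}\le k\|x\|_{T,2}$ for all $x\in H$, then the same $k$ satisfies $\|S^*y\|_{T,2}\le k\|y\|_{T,2}$ for all $y\in H$.
   Context: Setting. All spaces are real. $E$ is a Dedekind complete Riesz space with weak order unit $e$. $T:E\to E$ is a conditional expectation operator, i.e. a positive order-continuous linear projection whose range is a Dedekind complete Riesz subspace and which maps weak order units to weak order units; it satisfies $Te=e$ and is strictly positive ($x\ge 0$ and $Tx=0$ imply $x=0$). $E^u$ is the universal completion of $E$, with its $f$-algebra multiplication having unit $e$. $L^1(T)\subseteq E^u$ is the natural domain of $T$: the set of differences $f_1-f_2$ with $f_i\in E^u_+$ such that there is a net $(f_\alpha)$ in $E_+$ with $f_\alpha\uparrow f_i$ in $E^u$ and $(Tf_\alpha)$ bounded above in $E^u$; $T$ is extended to $L^1(T)$ by $Tf_i=\sup_\alpha Tf_\alpha$, and the extension, still denoted $T$, is again a strictly positive conditional expectation on $L^1(T)$ with $Te=e$. $A:=R(T)$ is the range of the (extended) $T$; it is a Dedekind complete unital Archimedean $f$-algebra with unit $e$, and $T(az)=aT(z)$ for $a\in A$ whenever the products are defined. $H:=L^2(T)=\{x\in L^1(T):x^2\in L^1(T)\}$ with the inherited order is a Dedekind complete Riesz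 space and an $A$-module. For $x,y\in H$, $\langle x,y\rangle_T:=T(xy)\in A$ and $\|x\|_{T,2}:=(T(x^2))^{1/2}\in A_+$ (the positive square root in $A$). Definitions. $\mathcal B_T(H)$ is the set of $A$-linear (additive and $A$-homogeneous) maps $S:H\to H$ that are $T$-strongly bounded: there is $k\in A_+$ with $\|Sx\|_{T,2}\le k\|x\|_{T,2}$ for all $x\in H$. *)

theory Defs
  imports Complex_Main "HOL-Library.FuncSet" "HOL-Library.Lattice_Algebras"
begin

text \<open>
  The universal completion \<open>E\<^sup>u\<close> is the ambient type, and \<open>E\<close> is a subset of it.  The multiplication
  is the one of the type; its unit is an explicit element \<open>e\<close> rather than a class constant \<open>1\<close>, since
  the unital classes of the library impose \<open>0 \<noteq> 1\<close> and would exclude the zero space.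
\<close>

class f_algebra = real_algebra + ordered_real_vector + lattice_ring +
  assumes inf_mult_left_eq_0: "inf a b = 0 \<Longrightarrow> 0 \<le> c \<Longrightarrow> inf (c * a) b = 0"
    and inf_mult_right_eq_0: "inf a b = 0 \<Longrightarrow> 0 \<le> c \<Longrightarrow> inf (a * c) b = 0"


subsection \<open>Riesz spaces as subsets of the ambient type\<close>

text \<open>Suprema and infima are relative to a Riesz subspace \<open>L\<close>: bounds are only taken from \<open>L\<close>.\<close>

definition is_sup_in :: "'u::order set \<Rightarrow> 'u set \<Rightarrow> 'u \<Rightarrow> bool" where
  "is_sup_in L D s \<longleftrightarrow> s \<in> L \<and> (\<forall>x\<in>D. x \<le> s) \<and> (\<forall>u\<in>L. (\<forall>x\<in>D. x \<le> u) \<longrightarrow> s \<le> u)"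

definition is_inf_in :: "'u::order set \<Rightarrow> 'u set \<Rightarrow> 'u \<Rightarrow> bool" where
  "is_inf_in L D s \<longleftrightarrow> s \<in> L \<and> (\<forall>x\<in>D. s \<le> x) \<and> (\<forall>u\<in>L. (\<forall>x\<in>D. u \<le> x) \<longrightarrow> u \<le> s)"

definition riesz_subspace :: "'u::f_algebra set \<Rightarrow> bool" where
  "riesz_subspace L \<longleftrightarrow> subspace L \<and> (\<forall>x\<in>L. \<forall>y\<in>L. sup x y \<in> L \<and> inf x y \<in> L)"

definition dedekind_complete :: "'u::f_algebra set \<Rightarrow> bool" where
  "dedekind_complete L \<longleftrightarrow>
     (\<forall>D\<subseteq>L. D \<noteq> {} \<and> (\<exists>u\<in>L. \<forall>x\<in>D. x \<le> u) \<longrightarrow> (\<exists>s. is_sup_in L D s))"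

definition laterally_complete :: "'u::f_algebra set \<Rightarrow> bool" where
  "laterally_complete L \<longleftrightarrow>
     (\<forall>D\<subseteq>L. D \<noteq> {} \<and> (\<forall>x\<in>D. 0 \<le> x) \<and> (\<forall>x\<in>D. \<forall>y\<in>D. x \<noteq> y \<longrightarrow> inf x y = 0)
        \<longrightarrow> (\<exists>s. is_sup_in L D s))"

definition order_dense :: "'u::f_algebra set \<Rightarrow> 'u set \<Rightarrow> bool" where
  "order_dense L M \<longleftrightarrow> L \<subseteq> M \<and> (\<forall>u\<in>M. 0 < u \<longrightarrow> (\<exists>x\<in>L. 0 < x \<and> x \<le> u))"

definition universal_completion :: "'u::f_algebra set \<Rightarrow> 'u set \<Rightarrow> bool" where
  "universal_completion L M \<longleftrightarrow>
     riesz_subspace L \<and> riesz_subspace M \<and> dedekind_complete M \<and> laterally_complete M \<and>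
     order_dense L M"

definition weak_order_unit :: "'u::f_algebra set \<Rightarrow> 'u \<Rightarrow> bool" where
  "weak_order_unit L w \<longleftrightarrow> w \<in> L \<and> 0 \<le> w \<and> (\<forall>x\<in>L. inf w \<bar>x\<bar> = 0 \<longrightarrow> x = 0)"

text \<open>
  Monotone nets are represented by directed sets: the values of an increasing net form an upward
  directed set with the same upper bounds, and a directed set is a net indexed by itself.
\<close>

definition up_directed :: "'u::order set \<Rightarrow> bool" where
  "up_directed D \<longleftrightarrow> D \<noteq> {} \<and> (\<forall>x\<in>D. \<forall>y\<in>D. \<exists>z\<in>D. x \<le> z \<and> y \<le> z)"

definition down_directed :: "'u::order set \<Rightarrow> bool" where
  "down_directed D \<longleftrightarrow> D \<noteq> {} \<and> (\<forall>x\<in>D. \<forall>y\<in>D. \<exists>z\<in>D. z \<le> x \<and> z \<le> y)"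


subsection \<open>Conditional expectation operators\<close>

definition linear_into :: "'u::f_algebra set \<Rightarrow> ('u \<Rightarrow> 'u) \<Rightarrow> bool" where
  "linear_into L T \<longleftrightarrow> T ` L \<subseteq> L \<and> (\<forall>x\<in>L. \<forall>y\<in>L. T (x + y) = T x + T y) \<and>
     (\<forall>c. \<forall>x\<in>L. T (c *\<^sub>R x) = c *\<^sub>R T x)"

definition positive_on :: "'u::f_algebra set \<Rightarrow> ('u \<Rightarrow> 'u) \<Rightarrow> bool" where
  "positive_on L T \<longleftrightarrow> (\<forall>x\<in>L. 0 \<le> x \<longrightarrow> 0 \<le> T x)"

definition strictly_positive_on :: "'u::f_algebra set \<Rightarrow> ('u \<Rightarrow> 'u) \<Rightarrow> bool" where
  "strictly_positive_on L T \<longleftrightarrow> (\<forall>x\<in>L. 0 \<le> x \<and> T x = 0 \<longrightarrow> x = 0)"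

text \<open>\<open>x\<^sub>\<alpha> \<down> 0\<close> in \<open>L\<close> implies \<open>inf \<bar>T x\<^sub>\<alpha>\<bar> = 0\<close> in \<open>L\<close>; the modulus is redundant for positive \<open>T\<close>.\<close>

definition order_continuous_on :: "'u::f_algebra set \<Rightarrow> ('u \<Rightarrow> 'u) \<Rightarrow> bool" where
  "order_continuous_on L T \<longleftrightarrow>
     (\<forall>D\<subseteq>L. down_directed D \<and> is_inf_in L D 0 \<longrightarrow> is_inf_in L ((\<lambda>x. \<bar>T x\<bar>) ` D) 0)"

definition conditional_expectation :: "'u::f_algebra set \<Rightarrow> ('u \<Rightarrow> 'u) \<Rightarrow> bool" where
  "conditional_expectation L T \<longleftrightarrow>
     linear_into L T \<and> positive_on L T \<and> order_continuous_on L T \<and>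
     (\<forall>x\<in>L. T (T x) = T x) \<and>
     riesz_subspace (T ` L) \<and> dedekind_complete (T ` L) \<and>
     (\<forall>w. weak_order_unit L w \<longrightarrow> weak_order_unit L (T w))"


subsection \<open>The natural domain and the extension of \<open>T\<close>\<close>

text \<open>\<open>approximating_net E T D f\<close>: \<open>D\<close> is a net in \<open>E\<^sub>+\<close> with \<open>D \<up> f\<close> in \<open>E\<^sup>u\<close> and \<open>T D\<close> bounded above in \<open>E\<^sup>u\<close>.\<close>

definition approximating_net :: "'u::f_algebra set \<Rightarrow> ('u \<Rightarrow> 'u) \<Rightarrow> 'u set \<Rightarrow> 'u \<Rightarrow> bool" where
  "approximating_net E T D f \<longleftrightarrow>
     D \<subseteq> {x \<in> E. 0 \<le> x} \<and> up_directed D \<and> is_sup_in UNIV D f \<and> (\<exists>u. \<forall>x\<in>D. T x \<le> u)"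

definition L1_cone :: "'u::f_algebra set \<Rightarrow> ('u \<Rightarrow> 'u) \<Rightarrow> 'u set" where
  "L1_cone E T = {f. 0 \<le> f \<and> (\<exists>D. approximating_net E T D f)}"

definition L1 :: "'u::f_algebra set \<Rightarrow> ('u \<Rightarrow> 'u) \<Rightarrow> 'u set" where
  "L1 E T = {f1 - f2 | f1 f2. f1 \<in> L1_cone E T \<and> f2 \<in> L1_cone E T}"

definition ext_cone :: "'u::f_algebra set \<Rightarrow> ('u \<Rightarrow> 'u) \<Rightarrow> 'u \<Rightarrow> 'u" where
  "ext_cone E T f = (THE g. \<exists>D. approximating_net E T D f \<and> is_sup_in UNIV (T ` D) g)"

definition ext :: "'u::f_algebra set \<Rightarrow> ('u \<Rightarrow> 'u) \<Rightarrow> 'u \<Rightarrow> 'u" where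
  "ext E T f = (THE g. \<exists>f1\<in>L1_cone E T. \<exists>f2\<in>L1_cone E T.
      f = f1 - f2 \<and> g = ext_cone E T f1 - ext_cone E T f2)"

definition range_alg :: "'u::f_algebra set \<Rightarrow> ('u \<Rightarrow> 'u) \<Rightarrow> 'u set" where
  "range_alg E T = ext E T ` L1 E T"


subsection \<open>The module \<open>L\<^sup>2(T)\<close> and its operators\<close>

definition L2 :: "'u::f_algebra set \<Rightarrow> ('u \<Rightarrow> 'u) \<Rightarrow> 'u set" where
  "L2 E T = {x \<in> L1 E T. x * x \<in> L1 E T}"

definition T_inner :: "'u::f_algebra set \<Rightarrow> ('u \<Rightarrow> 'u) \<Rightarrow> 'u \<Rightarrow> 'u \<Rightarrow> 'u" where
  "T_inner E T x y = ext E T (x * y)"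

definition T_norm :: "'u::f_algebra set \<Rightarrow> ('u \<Rightarrow> 'u) \<Rightarrow> 'u \<Rightarrow> 'u" where
  "T_norm E T x = (THE r. r \<in> range_alg E T \<and> 0 \<le> r \<and> r * r = ext E T (x * x))"

definition T_strong_bound :: "'u::f_algebra set \<Rightarrow> ('u \<Rightarrow> 'u) \<Rightarrow> ('u \<Rightarrow> 'u) \<Rightarrow> 'u \<Rightarrow> bool" where
  "T_strong_bound E T S k \<longleftrightarrow> k \<in> range_alg E T \<and> 0 \<le> k \<and>
     (\<forall>x\<in>L2 E T. T_norm E T (S x) \<le> k * T_norm E T x)"

text \<open>
  Operators are extensional functions (\<open>undefined\<close> outside \<open>L\<^sup>2(T)\<close>), so that equality of operators is
  equality on \<open>L\<^sup>2(T)\<close>.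
\<close>

definition BT :: "'u::f_algebra set \<Rightarrow> ('u \<Rightarrow> 'u) \<Rightarrow> ('u \<Rightarrow> 'u) set" where
  "BT E T = {S \<in> L2 E T \<rightarrow>\<^sub>E L2 E T.
     (\<forall>x\<in>L2 E T. \<forall>y\<in>L2 E T. S (x + y) = S x + S y) \<and>
     (\<forall>a\<in>range_alg E T. \<forall>x\<in>L2 E T. S (a * x) = a * S x) \<and>
     (\<exists>k. T_strong_bound E T S k)}"

definition is_T_adjoint :: "'u::f_algebra set \<Rightarrow> ('u \<Rightarrow> 'u) \<Rightarrow> ('u \<Rightarrow> 'u) \<Rightarrow> ('u \<Rightarrow> 'u) \<Rightarrow> bool" where
  "is_T_adjoint E T S S' \<longleftrightarrow>
     (\<forall>x\<in>L2 E T. \<forall>y\<in>L2 E T. T_inner E T (S x) y = T_inner E T x (S' y))"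

end

theory Submission
  imports Defs
begin

text \<open>
  The adjoint comes from a Riesz representation theorem for \<open>A\<close>-valued functionals on \<open>H = L\<^sup>2(T)\<close>,
  applied to \<open>x \<mapsto> T (S x * y)\<close>.  A bounded functional is a difference of positive ones.  For positive
  \<open>\<psi>\<close> the elements \<open>z \<ge> 0\<close> with \<open>T (x * z) \<le> \<psi> x\<close> for all \<open>x \<ge> 0\<close> are upward directed and bounded in
  norm, so they have a supremum, which lies in \<open>H\<close>; an exhaustion argument as in the Radon-Nikodym
  theorem shows that it represents \<open>\<psi>\<close>.  The existence of the supremum is a monotone completeness
  property of \<open>L\<^sup>1(T)\<close>, and this is where lateral completeness of \<open>E\<^sup>u\<close> enters.

  The averaging property \<open>T (a * x) = a * T x\<close>, like the commutativity of the multiplication, holds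
  because both sides are dominated by a multiple of \<open>\<bar>a\<bar>\<close> for bounded \<open>x\<close> and agree at \<open>a = e\<close>.
\<close>

subsection \<open>Unital \<open>f\<close>-algebras\<close>

text \<open>Elements of the ambient space behave like functions, but they may vanish in places, so
  nothing can be divided. Three devices replace division. A claim is tested on the regions where an
  element \<open>a\<close> stays below \<open>n\<close>, represented by
  \<open>pprt (real n *\<^sub>R e - a)\<close>. A factor is cancelled by showing that the positive
  part of the excess has square zero. Supports, the indicators of the regions where an element is
  positive, cut such regions out. The class provides neither commutativity nor the Archimedean
  property; both are derived from Dedekind completeness and the unit.

  A second obstacle is that the hypotheses on \<open>T\<close> speak of suprema and infima in
  \<open>E\<close>, while its extension is defined by suprema in the ambient space. Order density
  and Dedekind completeness make \<open>E\<close> an ideal, and this lets the two be exchanged.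
  Finally, the functional to be represented comes without order continuity; its quadratic bound
  supplies it, and this is what permits the exhaustion.\<close>

abbreviation lub :: "'u::order set \<Rightarrow> 'u \<Rightarrow> bool" where
  "lub \<equiv> is_sup_in UNIV"

lemma lubI: "(\<And>x. x \<in> D \<Longrightarrow> x \<le> s) \<Longrightarrow> (\<And>u. (\<And>x. x \<in> D \<Longrightarrow> x \<le> u) \<Longrightarrow> s \<le> u) \<Longrightarrow> lub D s"
  by (simp add: is_sup_in_def)

lemma lub_upper: "lub D s \<Longrightarrow> x \<in> D \<Longrightarrow> x \<le> s"
  by (simp add: is_sup_in_def)

lemma lub_least: "lub D s \<Longrightarrow> (\<And>x. x \<in> D \<Longrightarrow> x \<le> u) \<Longrightarrow> s \<le> u"
  by (simp add: is_sup_in_def)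

lemma lub_unique: "lub D s \<Longrightarrow> lub D t \<Longrightarrow> s = t"
  by (meson lub_least lub_upper order.antisym)

lemma up_directed_image:
  assumes "up_directed D" and "\<And>x y. x \<in> D \<Longrightarrow> y \<in> D \<Longrightarrow> x \<le> y \<Longrightarrow> f x \<le> f y"
  shows "up_directed (f ` D)"
  unfolding up_directed_def
proof (intro conjI ballI)
  show "f ` D \<noteq> {}" using assms(1) by (simp add: up_directed_def)
  fix u v assume "u \<in> f ` D" "v \<in> f ` D"
  then obtain x y where xy: "x \<in> D" "u = f x" "y \<in> D" "v = f y" by blast
  then obtain z where "z \<in> D" "x \<le> z" "y \<le> z"
    using assms(1) unfolding up_directed_def by blast
  then show "\<exists>z\<in>f ` D. u \<le> z \<and> v \<le> z" using xy assms(2) by blast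
qed

section \<open>Positive parts, disjointness and products\<close>

lemma diff_pprts: "x = pprt x - pprt (- x)" for x :: "'u::lattice_ab_group_add"
  by (metis diff_minus_eq_add pprt_neg prts)

lemma abs_pprts: "\<bar>x\<bar> = pprt x + pprt (- x)" for x :: "'u::lattice_ab_group_add_abs"
  by (simp add: abs_prts pprt_neg)

lemma pprt_le_abs: "pprt x \<le> \<bar>x\<bar>" for x :: "'u::lattice_ab_group_add_abs"
  by (simp add: abs_pprts)

lemma le_pprt: "x \<le> pprt x" for x :: "'u::lattice_ab_group_add"
  by (simp add: pprt_def)

lemma pprt_le: "x \<le> y \<Longrightarrow> 0 \<le> y \<Longrightarrow> pprt x \<le> y" for x :: "'u::lattice_ab_group_add"
  by (simp add: pprt_def)

lemma inf_pprts: "inf (pprt x) (pprt (- x)) = 0" for x :: "'u::lattice_ab_group_add"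
proof -
  have "pprt x = x + pprt (- x)" using diff_pprts[of x] by (simp add: eq_diff_eq)
  then have "inf (pprt x) (pprt (- x)) = inf (x + pprt (- x)) (0 + pprt (- x))" by simp
  also have "\<dots> = inf x 0 + pprt (- x)"
    by (simp only: add_inf_distrib_right)
  finally show ?thesis by (simp only: pprt_neg nprt_def add.right_inverse)
qed

lemma pprt_diff_disjoint:
  fixes u v :: "'u::lattice_ab_group_add"
  assumes "inf u v = 0"
  shows "pprt (u - v) = u"
proof -
  have "pprt (u - v) = u + sup (- v) (- u)"
    by (simp add: pprt_def add_sup_distrib_left)
  then show ?thesis using assms by (simp add: neg_inf_eq_sup[symmetric] inf_commute)
qed

lemma inf_eq_diff_pprt: "inf x y = x - pprt (x - y)" for x :: "'u::lattice_ab_group_add"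
proof -
  have "x - pprt (x - y) = x + inf (y - x) 0"
    by (simp add: pprt_def diff_sup_eq_inf)
  also have "\<dots> = inf y x" by (simp add: add_inf_distrib_left)
  finally show ?thesis by (simp add: inf_commute)
qed

lemma sup_eq_add_pprt: "sup x y = y + pprt (x - y)" for x :: "'u::lattice_ab_group_add"
  by (simp add: pprt_def add_sup_distrib_left)

text \<open>The two f-algebra axioms are applied in turn: \<open>a * b\<close> is disjoint from
  \<open>b\<close>, hence from itself.\<close>

lemma mult_eq_0_of_inf: "inf a b = 0 \<Longrightarrow> a * b = 0" for a :: "'u::f_algebra"
proof -
  assume *: "inf a b = 0"
  then have "0 \<le> a" "0 \<le> b" by (metis inf_le1, metis inf_le2)
  then have "inf (a * b) b = 0" using * by (simp add: inf_mult_right_eq_0)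
  then have "inf (a * b) (a * b) = 0" using \<open>0 \<le> a\<close>
    by (metis inf_mult_left_eq_0 inf_commute)
  then show ?thesis by simp
qed

lemma pprt_mult_pprt_neg: "pprt x * pprt (- x) = 0" for x :: "'u::f_algebra"
  by (rule mult_eq_0_of_inf[OF inf_pprts])

lemma pprt_neg_mult_pprt: "pprt (- x) * pprt x = 0" for x :: "'u::f_algebra"
  using pprt_mult_pprt_neg[of "- x"] by simp

lemma square_pprts: "x * x = pprt x * pprt x + pprt (- x) * pprt (- x)" for x :: "'u::f_algebra"
proof -
  have "x * x = (pprt x - pprt (- x)) * (pprt x - pprt (- x))" using diff_pprts[of x] by simp
  then show ?thesis by (simp add: algebra_simps pprt_mult_pprt_neg pprt_neg_mult_pprt)
qed

lemma square_nonneg [simp]: "0 \<le> x * x" for x :: "'u::f_algebra"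
  by (subst square_pprts) simp

lemma abs_square: "\<bar>x\<bar> * \<bar>x\<bar> = x * x" for x :: "'u::f_algebra"
  by (simp add: abs_pprts square_pprts[of x] algebra_simps pprt_mult_pprt_neg pprt_neg_mult_pprt)

text \<open>Multiplication by \<open>a\<close> keeps the two parts of \<open>x\<close> disjoint, and
  a decomposition into disjoint parts is unique.\<close>

lemma mult_pprt: "0 \<le> a \<Longrightarrow> a * pprt x = pprt (a * x)" for a :: "'u::f_algebra"
proof -
  assume a: "0 \<le> a"
  have "inf (a * pprt x) (a * pprt (- x)) = 0"
    by (metis a inf_commute inf_mult_left_eq_0 inf_pprts)
  then have "pprt (a * pprt x - a * pprt (- x)) = a * pprt x" by (rule pprt_diff_disjoint)
  then show ?thesis by (metis diff_pprts right_diff_distrib)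
qed

lemma square_mono_abs: "\<bar>x\<bar> \<le> \<bar>y\<bar> \<Longrightarrow> x * x \<le> y * y" for x :: "'u::f_algebra"
  by (metis abs_ge_zero abs_square mult_mono)

lemma scaleR_le_scaleR_iff: "0 < r \<Longrightarrow> r *\<^sub>R x \<le> r *\<^sub>R y \<longleftrightarrow> x \<le> y" for x :: "'u::ordered_real_vector"
proof
  assume r: "0 < r" and "r *\<^sub>R x \<le> r *\<^sub>R y"
  then have "inverse r *\<^sub>R r *\<^sub>R x \<le> inverse r *\<^sub>R r *\<^sub>R y" using r by (intro scaleR_left_mono[of "r *\<^sub>R x" "r *\<^sub>R y"]) auto
  then show "x \<le> y" using r unfolding scaleR_scaleR by simp
qed (simp add: scaleR_left_mono)

declare scaleR_nonneg_nonneg [simp]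

lemma riesz_subspaceD:
  assumes "riesz_subspace L"
  shows riesz_subspace_0: "0 \<in> L"
    and riesz_subspace_add: "x \<in> L \<Longrightarrow> y \<in> L \<Longrightarrow> x + y \<in> L"
    and riesz_subspace_diff: "x \<in> L \<Longrightarrow> y \<in> L \<Longrightarrow> x - y \<in> L"
    and riesz_subspace_minus: "x \<in> L \<Longrightarrow> - x \<in> L"
    and riesz_subspace_scaleR: "x \<in> L \<Longrightarrow> r *\<^sub>R x \<in> L"
    and riesz_subspace_sup: "x \<in> L \<Longrightarrow> y \<in> L \<Longrightarrow> sup x y \<in> L"
    and riesz_subspace_inf: "x \<in> L \<Longrightarrow> y \<in> L \<Longrightarrow> inf x y \<in> L"
    and riesz_subspace_pprt: "x \<in> L \<Longrightarrow> pprt x \<in> L"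
  using assms unfolding riesz_subspace_def pprt_def
  by (auto intro: real_vector.subspace_add real_vector.subspace_diff real_vector.subspace_neg
      real_vector.subspace_scale real_vector.subspace_0)

section \<open>Archimedean property, nilpotents and localisation to bounded regions\<close>

locale unital_f_algebra =
  fixes e :: "'u::f_algebra"
  assumes unit_left [simp]: "e * x = x" and unit_right [simp]: "x * e = x"
    and complete: "dedekind_complete (UNIV :: 'u set)"
begin

lemma lub_exists:
  fixes D :: "'u set"
  assumes "D \<noteq> {}" "\<And>x. x \<in> D \<Longrightarrow> x \<le> u"
  obtains s where "lub D s"
  using complete assms unfolding dedekind_complete_def by blast

text \<open>The supremum of all multiples of \<open>x\<close> absorbs one more
  \<open>x\<close>.\<close>

lemma arch_nat:
  fixes x y :: 'u
  assumes "\<And>n::nat. real n *\<^sub>R x \<le> y"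
  shows "x \<le> 0"
proof -
  obtain s where s: "lub (range (\<lambda>n::nat. real n *\<^sub>R x)) s"
    using assms lub_exists[of "range (\<lambda>n::nat. real n *\<^sub>R x)" y] by blast
  have "s \<le> s - x"
  proof (rule lub_least[OF s])
    fix z assume "z \<in> range (\<lambda>n::nat. real n *\<^sub>R x)"
    then obtain n :: nat where "z = real n *\<^sub>R x" by blast
    moreover have "real (Suc n) *\<^sub>R x \<le> s" by (rule lub_upper[OF s]) blast
    ultimately show "z \<le> s - x" by (simp add: algebra_simps)
  qed
  then show ?thesis by (simp add: algebra_simps)
qed

lemma arch:
  fixes x y :: 'u
  assumes "\<And>r::real. 0 < r \<Longrightarrow> x \<le> r *\<^sub>R y"
  shows "x \<le> 0"
proof (rule arch_nat[of _ "\<bar>y\<bar>"])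
  fix n :: nat
  show "real n *\<^sub>R x \<le> \<bar>y\<bar>"
  proof (cases "n = 0")
    case False
    then have "real n *\<^sub>R x \<le> real n *\<^sub>R (1 / real n) *\<^sub>R y"
      using assms[of "1 / real n"] by (intro scaleR_left_mono) auto
    then show ?thesis using False by (simp add: order.trans[OF _ abs_ge_self])
  qed simp
qed

lemma unit_nonneg [simp]: "0 \<le> e"
  using square_nonneg[of e] by simp

text \<open>Expanding the nonnegative square of \<open>e - real n *\<^sub>R a\<close> bounds all
  multiples of \<open>a\<close> by the unit.\<close>

lemma square_eq_0:
  fixes x :: 'u
  assumes "x * x = 0"
  shows "x = 0"
proof -
  define a where "a = \<bar>x\<bar>"
  have a: "a * a = 0" using assms by (simp add: a_def abs_square)
  have "2 *\<^sub>R a \<le> 0"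
  proof (rule arch_nat[of _ e])
    fix n :: nat
    have "0 \<le> (e - real n *\<^sub>R a) * (e - real n *\<^sub>R a)" by simp
    also have "\<dots> = e - real n *\<^sub>R 2 *\<^sub>R a"
      using a by (simp add: algebra_simps scaleR_2)
    finally show "real n *\<^sub>R 2 *\<^sub>R a \<le> e" by (simp add: algebra_simps)
  qed
  then show ?thesis by (simp add: a_def scaleR_2)
qed

lemma inf_eq_0_iff:
  fixes a b :: 'u
  assumes "0 \<le> a" "0 \<le> b"
  shows "inf a b = 0 \<longleftrightarrow> a * b = 0"
proof
  assume ab: "a * b = 0"
  have "inf a b * inf a b \<le> a * b" using assms by (intro mult_mono) auto
  then have "inf a b * inf a b = 0" using ab by (simp add: order.antisym)
  then show "inf a b = 0" by (rule square_eq_0)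
qed (rule mult_eq_0_of_inf)

text \<open>The factors live on the regions where \<open>a\<close> is below \<open>n\<close>, and
  these exhaust the space: vanishing on all of them gives
  \<open>real n *\<^sub>R c \<le> c * a\<close> for every \<open>n\<close>.\<close>

lemma zero_if_mult_truncations:
  fixes a c :: 'u
  assumes "0 \<le> c" "\<And>n::nat. c * pprt (real n *\<^sub>R e - a) = 0"
  shows "c = 0"
proof -
  have "real n *\<^sub>R c \<le> c * a" for n :: nat
  proof -
    have "c * (real n *\<^sub>R e - a) \<le> c * pprt (real n *\<^sub>R e - a)"
      using assms(1) by (intro mult_left_mono le_pprt)
    then show ?thesis by (simp add: assms(2) right_diff_distrib)
  qed
  then have "c \<le> 0" by (rule arch_nat)
  then show ?thesis using assms(1) by simp
qed

text \<open>The distances of \<open>x\<close> from the multiples of the unit have infimum zero: on a grid of mesh \<open>d\<close>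
  reaching up to \<open>N * d\<close> their infimum is at most \<open>d\<close>, except where \<open>x\<close> exceeds \<open>N * d\<close>.\<close>

lemma grid_bound:
  fixes x c :: 'u
  assumes "0 \<le> x" "0 < d" "\<And>r::real. 0 \<le> r \<Longrightarrow> c \<le> \<bar>x - r *\<^sub>R e\<bar>"
  shows "c \<le> sup (d *\<^sub>R e) (x - (real N * d) *\<^sub>R e)"
proof (induction N)
  case 0
  have "c \<le> x" using assms(3)[of 0] assms(1) by simp
  then show ?case by (simp add: le_supI2)
next
  case (Suc N)
  define t where "t = x - (real (Suc N) * d) *\<^sub>R e"
  have eq: "x - (real N * d) *\<^sub>R e = t + d *\<^sub>R e" by (simp add: t_def algebra_simps)
  have de: "0 \<le> d *\<^sub>R e" using assms(2) by simp
  have "c \<le> inf (sup (d *\<^sub>R e) (t + d *\<^sub>R e)) (sup t (- t))"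
    unfolding abs_lattice[symmetric]
  proof (rule le_infI)
    show "c \<le> sup (d *\<^sub>R e) (t + d *\<^sub>R e)" using Suc eq by simp
    show "c \<le> \<bar>t\<bar>" unfolding t_def using assms(2) by (intro assms(3)) simp
  qed
  also have "sup (d *\<^sub>R e) (t + d *\<^sub>R e) = d *\<^sub>R e + pprt t"
    using add_sup_distrib_left[of "d *\<^sub>R e" t 0] by (simp add: pprt_def sup_commute add.commute)
  also have "sup t (- t) = pprt t + pprt (- t)" by (metis abs_lattice abs_pprts)
  also have "inf (d *\<^sub>R e + pprt t) (pprt t + pprt (- t)) = pprt t + inf (d *\<^sub>R e) (pprt (- t))"
    by (simp add: add_inf_distrib_left add.commute)
  \<comment> \<open>The infimum on the left is disjoint from \<open>pprt t\<close>, so it is the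
    positive part of its difference with \<open>pprt t\<close>. In this form the sum can be read as
    a supremum.\<close>
  also have "\<dots> \<le> pprt t + pprt (d *\<^sub>R e - pprt t)"
  proof (rule add_left_mono)
    have "inf (inf (d *\<^sub>R e) (pprt (- t))) (pprt t) \<le> inf (pprt (- t)) (pprt t)"
      by (intro inf_mono) auto
    also have "\<dots> = 0" using inf_pprts[of t] by (simp only: inf_commute)
    finally have "inf (inf (d *\<^sub>R e) (pprt (- t))) (pprt t) = 0"
      by (rule order.antisym) (simp add: de)
    then have "inf (d *\<^sub>R e) (pprt (- t)) = pprt (inf (d *\<^sub>R e) (pprt (- t)) - pprt t)"
      by (simp only: pprt_diff_disjoint)
    also have "\<dots> \<le> pprt (d *\<^sub>R e - pprt t)" by (intro pprt_mono diff_right_mono) simp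
    finally show "inf (d *\<^sub>R e) (pprt (- t)) \<le> pprt (d *\<^sub>R e - pprt t)" .
  qed
  also have "\<dots> = sup (d *\<^sub>R e) (pprt t)" by (simp add: sup_eq_add_pprt)
  also have "\<dots> \<le> sup (d *\<^sub>R e) t" unfolding pprt_def using de by (auto intro: le_supI1)
  finally show ?case by (simp add: t_def)
qed

lemma zero_if_le_distances:
  fixes x c :: 'u
  assumes x: "0 \<le> x" and c: "0 \<le> c" "\<And>r::real. 0 \<le> r \<Longrightarrow> c \<le> \<bar>x - r *\<^sub>R e\<bar>"
  shows "c = 0"
proof (rule zero_if_mult_truncations[OF c(1)])
  fix n :: nat
  define y where "y = pprt (real n *\<^sub>R e - x)"
  have y: "0 \<le> y" by (simp add: y_def)
  have "real m *\<^sub>R (c * y) \<le> y" for m :: nat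
  proof (cases "m = 0")
    case False
    \<comment> \<open>With mesh \<open>1 / m\<close> and \<open>n * m\<close> steps the grid reaches
      exactly \<open>n\<close>, so the excess term is annihilated by \<open>y\<close>.\<close>
    have "c \<le> sup ((1 / m) *\<^sub>R e) (x - (real (n * m) * (1 / m)) *\<^sub>R e)"
      using False by (intro grid_bound x c) auto
    also have "real (n * m) * (1 / m) = real n" using False by simp
    also have "sup ((1 / m) *\<^sub>R e) (x - real n *\<^sub>R e) \<le> (1 / m) *\<^sub>R e + pprt (x - real n *\<^sub>R e)"
      by (auto intro!: add_increasing le_pprt)
    finally have "c * y \<le> ((1 / m) *\<^sub>R e + pprt (x - real n *\<^sub>R e)) * y"
      by (intro mult_right_mono y)
    also have "\<dots> = (1 / m) *\<^sub>R y"
      using pprt_mult_pprt_neg[of "x - real n *\<^sub>R e"] by (simp add: distrib_right y_def)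
    finally have "real m *\<^sub>R (c * y) \<le> real m *\<^sub>R (1 / m) *\<^sub>R y" by (intro scaleR_left_mono) auto
    then show ?thesis using False by simp
  qed (use y in simp)
  then have "c * y \<le> 0" by (rule arch_nat)
  then show "c * y = 0" using c(1) y by (simp add: order.antisym)
qed

text \<open>A band preserving operator is determined by its value at the unit; here in the form needed
  both for commutativity and for the averaging property.\<close>

lemma zero_if_dominated:
  fixes \<rho> :: "'u \<Rightarrow> 'u"
  assumes L: "riesz_subspace L" "e \<in> L"
    and add: "\<And>x y. x \<in> L \<Longrightarrow> y \<in> L \<Longrightarrow> \<rho> (x + y) = \<rho> x + \<rho> y"
    and scale: "\<And>r x. x \<in> L \<Longrightarrow> \<rho> (r *\<^sub>R x) = r *\<^sub>R \<rho> x"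
    and bound: "0 < C" "\<And>x. x \<in> L \<Longrightarrow> \<bar>\<rho> x\<bar> \<le> C *\<^sub>R \<bar>x\<bar>"
    and unit: "\<rho> e = 0" and x: "x \<in> L"
  shows "\<rho> x = 0"
proof -
  have nonneg: "\<rho> y = 0" if y: "y \<in> L" "0 \<le> y" for y
  proof -
    have "(1 / C) *\<^sub>R \<bar>\<rho> y\<bar> = 0"
    proof (rule zero_if_le_distances[OF y(2)])
      fix r :: real
      \<comment> \<open>Vanishing at the unit makes \<open>\<rho>\<close> invariant under shifts by
        multiples of \<open>e\<close>, so its bound holds for every distance of \<open>y\<close>
        from such a multiple.\<close>
      have "\<rho> (y + (- r) *\<^sub>R e) = \<rho> y + (- r) *\<^sub>R \<rho> e"
        using y L by (subst add) (simp_all only: scale riesz_subspace_scaleR)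
      then have "\<rho> (y - r *\<^sub>R e) = \<rho> y" by (simp add: unit)
      then have "\<bar>\<rho> y\<bar> \<le> C *\<^sub>R \<bar>y - r *\<^sub>R e\<bar>"
        using bound(2)[of "y - r *\<^sub>R e"] y L
        by (simp add: riesz_subspace_diff riesz_subspace_scaleR)
      then have "(1 / C) *\<^sub>R \<bar>\<rho> y\<bar> \<le> (1 / C) *\<^sub>R C *\<^sub>R \<bar>y - r *\<^sub>R e\<bar>"
        using bound(1) by (intro scaleR_left_mono) auto
      then show "(1 / C) *\<^sub>R \<bar>\<rho> y\<bar> \<le> \<bar>y - r *\<^sub>R e\<bar>" using bound(1) by simp
    qed (use bound(1) in simp)
    then show ?thesis using bound(1) by simp
  qed
  have "\<rho> (pprt x + (-1) *\<^sub>R pprt (- x)) = \<rho> (pprt x) + (-1) *\<^sub>R \<rho> (pprt (- x))"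
    using x L by (subst add) (simp_all only: scale riesz_subspace_scaleR riesz_subspace_pprt riesz_subspace_minus)
  then have "\<rho> (pprt x - pprt (- x)) = 0"
    using x L by (simp add: nonneg riesz_subspace_pprt riesz_subspace_minus)
  then show ?thesis using diff_pprts[of x] by simp
qed

lemma riesz_subspace_UNIV: "riesz_subspace (UNIV :: 'u set)"
  by (simp add: riesz_subspace_def)

lemma trunc_diff: "x - inf x y = pprt (x - y)" for x y :: 'u
  by (simp add: inf_eq_diff_pprt)

text \<open>A tail lives where \<open>a\<close> exceeds \<open>n\<close>, off the region where
  \<open>a\<close> is below \<open>n\<close>; an element under all tails therefore vanishes on all
  these regions.\<close>

lemma zero_if_le_tails:
  fixes a c :: 'u
  assumes "0 \<le> c" "\<And>n::nat. c \<le> pprt (a - real n *\<^sub>R e) * b"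
    and comm: "\<And>n::nat. inf (pprt (a - real n *\<^sub>R e) * b) (pprt (real n *\<^sub>R e - a)) = 0"
  shows "c = 0"
proof (rule zero_if_mult_truncations[OF assms(1)])
  fix n :: nat
  have "inf c (pprt (real n *\<^sub>R e - a)) \<le> inf (pprt (a - real n *\<^sub>R e) * b) (pprt (real n *\<^sub>R e - a))"
    by (intro inf_mono assms(2)) simp
  then have "inf c (pprt (real n *\<^sub>R e - a)) = 0"
    using assms(1) by (simp add: comm order.antisym)
  then show "c * pprt (real n *\<^sub>R e - a) = 0" by (rule mult_eq_0_of_inf)
qed

lemma inf_tails_0:
  fixes a b :: 'u
  assumes "0 \<le> b"
  shows "inf (pprt (a - y) * b) (pprt (y - a)) = 0"
    and "inf (b * pprt (a - y)) (pprt (y - a)) = 0"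
  using inf_pprts[of "a - y"] assms by (simp_all add: inf_mult_right_eq_0 inf_mult_left_eq_0)

section \<open>Commutativity of the multiplication\<close>

lemma commute_bounded:
  fixes x z :: 'u
  assumes z: "0 \<le> z" "z \<le> C *\<^sub>R e" "0 < C"
  shows "x * z = z * x"
proof -
  have "x * z - z * x = 0"
  proof (rule zero_if_dominated[where \<rho> = "\<lambda>x. x * z - z * x" and L = UNIV and C = "2 * C"])
    fix x :: 'u
    have "\<bar>x * z - z * x\<bar> \<le> \<bar>x\<bar> * \<bar>z\<bar> + \<bar>z\<bar> * \<bar>x\<bar>"
      by (meson abs_le_mult abs_triangle_ineq4 add_mono order.trans)
    also have "\<dots> \<le> \<bar>x\<bar> * (C *\<^sub>R e) + (C *\<^sub>R e) * \<bar>x\<bar>"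
      using z by (intro add_mono mult_left_mono mult_right_mono) auto
    also have "\<dots> = (2 * C) *\<^sub>R \<bar>x\<bar>" by (simp add: scaleR_2[symmetric])
    finally show "\<bar>x * z - z * x\<bar> \<le> (2 * C) *\<^sub>R \<bar>x\<bar>" .
  qed (use z in \<open>auto simp: riesz_subspace_UNIV algebra_simps\<close>)
  then show ?thesis by simp
qed

text \<open>Cutting \<open>x\<close> at \<open>n\<close> leaves a bounded part, which commutes with
  \<open>z\<close>; the commutator then comes from the tail alone and vanishes where
  \<open>x\<close> is below \<open>n\<close>.\<close>

lemma commute_nonneg:
  fixes x z :: 'u
  assumes x: "0 \<le> x" and z: "0 \<le> z"
  shows "x * z = z * x"
proof -
  have "\<bar>x * z - z * x\<bar> = 0"
  proof (rule zero_if_mult_truncations)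
    fix n :: nat
    define t where "t = pprt (x - real n *\<^sub>R e)"
    define y where "y = pprt (real n *\<^sub>R e - x)"
    define w where "w = inf x (real n *\<^sub>R e)"
    have "w \<le> real n *\<^sub>R e" by (simp add: w_def)
    \<comment> \<open>The bound in \<open>commute_bounded\<close> must be positive, also for
      \<open>n = 0\<close>.\<close>
    also have "\<dots> \<le> (real n + 1) *\<^sub>R e" by (intro scaleR_right_mono) auto
    finally have wz: "z * w = w * z"
      using x by (intro commute_bounded[of _ "real n + 1"]) (simp_all add: w_def)
    have "x = w + t" by (simp add: w_def t_def inf_eq_diff_pprt)
    then have "x * z - z * x = (w + t) * z - z * (w + t)" by simp
    also have "\<dots> = t * z - z * t" by (simp add: distrib_left distrib_right wz)
    finally have "x * z - z * x = t * z - z * t" .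
    then have "\<bar>x * z - z * x\<bar> \<le> \<bar>t * z\<bar> + \<bar>z * t\<bar>"
      by (simp only: abs_triangle_ineq4)
    also have "\<dots> \<le> \<bar>t\<bar> * \<bar>z\<bar> + \<bar>z\<bar> * \<bar>t\<bar>"
      by (intro add_mono abs_le_mult)
    finally have 3: "\<bar>x * z - z * x\<bar> \<le> t * z + z * t" using z by (simp add: t_def)
    have y: "0 \<le> y" by (simp add: y_def)
    have "t * z * y = 0" "z * t * y = 0"
      unfolding t_def y_def by (intro mult_eq_0_of_inf inf_tails_0 z)+
    then have "\<bar>x * z - z * x\<bar> * y \<le> 0"
      using mult_right_mono[OF 3 y] by (simp add: distrib_right)
    then show "\<bar>x * z - z * x\<bar> * y = 0" using y by (simp add: order.antisym)
  qed simp
  then show ?thesis by simp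
qed

lemma commute: "x * z = z * x" for x z :: 'u
proof -
  have "x * z = (pprt x - pprt (- x)) * (pprt z - pprt (- z))" using diff_pprts by metis
  also have "\<dots> = (pprt z - pprt (- z)) * (pprt x - pprt (- x))"
    by (simp add: algebra_simps commute_nonneg[of "pprt x"] commute_nonneg[of "pprt (- x)"])
  finally show ?thesis using diff_pprts by metis
qed

lemma left_commute: "x * (z * w) = z * (x * w)" for x z w :: 'u
  by (metis commute mult.assoc)

lemmas mult_acs = mult.assoc commute left_commute

text \<open>This is how inequalities between unbounded elements are proved below: the excess only
  has to be bounded by every tail of some element.\<close>

lemma le_tails_zero:
  fixes a b c :: 'u
  assumes "0 \<le> b" "\<And>n::nat. c \<le> pprt (a - real n *\<^sub>R e) * b"
  shows "c \<le> 0"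
proof -
  have "pprt c = 0"
    by (rule zero_if_le_tails[of _ a b]) (use assms in \<open>auto intro: pprt_le inf_tails_0\<close>)
  then show ?thesis by (simp add: le_zero_iff_zero_pprt)
qed

section \<open>Suprema under infima, products and squares\<close>

text \<open>Infinite distributivity follows from \<open>x + d = sup x d + inf x d\<close>, where the
  two summands are bounded separately.\<close>

lemma lub_inf:
  fixes D :: "'u set"
  assumes "lub D s"
  shows "lub ((\<lambda>d. inf x d) ` D) (inf x s)"
proof (rule lubI)
  fix z assume "z \<in> inf x ` D"
  then show "z \<le> inf x s" using lub_upper[OF assms] by (auto intro: inf_mono le_infI2)
next
  fix u assume u: "\<And>z. z \<in> inf x ` D \<Longrightarrow> z \<le> u"
  have "s \<le> u - x + sup x s"
  proof (rule lub_least[OF assms])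
    fix d assume d: "d \<in> D"
    have "x + d = sup x d + inf x d" by (rule add_eq_inf_sup)
    also have "\<dots> \<le> sup x s + u"
      using d u lub_upper[OF assms] by (intro add_mono sup_mono) auto
    finally show "d \<le> u - x + sup x s" by (simp add: algebra_simps)
  qed
  then have "x + s \<le> u + sup x s" by (simp add: algebra_simps)
  also have "x + s = inf x s + sup x s" by (metis add.commute add_eq_inf_sup)
  finally show "inf x s \<le> u" by simp
qed

text \<open>The bounded part of \<open>a\<close> is dominated by a real multiple of the unit and
  gives a real multiple of \<open>s - d\<close>; the rest contributes at most the tail
  \<open>t * (s - d0)\<close>. Fixing one \<open>d0\<close> makes this tail independent of
  \<open>d\<close>, as \<open>le_tails_zero\<close> requires.\<close>

lemma lub_mult:
  fixes D :: "'u set"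
  assumes D: "up_directed D" "lub D s" and a: "0 \<le> a"
  shows "lub ((\<lambda>d. a * d) ` D) (a * s)"
proof (rule lubI)
  fix z assume "z \<in> (*) a ` D"
  then show "z \<le> a * s" using lub_upper[OF D(2)] a by (auto intro: mult_left_mono)
next
  fix u assume u: "\<And>z. z \<in> (*) a ` D \<Longrightarrow> z \<le> u"
  obtain d0 where d0: "d0 \<in> D" using D(1) by (auto simp: up_directed_def)
  have "a * s - u \<le> 0"
  proof (rule le_tails_zero[of "s - d0" _ a])
    show "0 \<le> s - d0" using lub_upper[OF D(2) d0] by simp
    fix n :: nat
    define t where "t = pprt (a - real n *\<^sub>R e)"
    have aeq: "a = inf a (real n *\<^sub>R e) + t" by (simp add: t_def inf_eq_diff_pprt)
    have "real (Suc n) *\<^sub>R s \<le> real (Suc n) *\<^sub>R s - (a * s - u - t * (s - d0))"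
    proof -
      \<comment> \<open>Lowering \<open>s\<close> by this share of the excess still leaves an upper
        bound of \<open>D\<close>, so the excess cannot be positive. \<open>Suc n\<close> avoids a
        division by zero.\<close>
      have "s \<le> s - (1 / real (Suc n)) *\<^sub>R (a * s - u - t * (s - d0))"
      proof (rule lub_least[OF D(2)])
        fix d' assume "d' \<in> D"
        then obtain d where d: "d \<in> D" "d' \<le> d" "d0 \<le> d"
          using D(1) d0 unfolding up_directed_def by blast
        have sd: "0 \<le> s - d" using lub_upper[OF D(2) d(1)] by simp
        have "a * s - u \<le> a * (s - d)" using u d(1) by (simp add: right_diff_distrib)
        also have "\<dots> = inf a (real n *\<^sub>R e) * (s - d) + t * (s - d)"
          by (subst aeq) (simp add: distrib_right)
        also have "\<dots> \<le> (real (Suc n) *\<^sub>R e) * (s - d) + t * (s - d0)"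
          using sd d by (intro add_mono mult_right_mono mult_left_mono)
            (auto simp: t_def intro!: le_infI2 scaleR_right_mono)
        finally have "a * s - u - t * (s - d0) \<le> real (Suc n) *\<^sub>R (s - d)"
          by (simp add: algebra_simps)
        then have "(1 / real (Suc n)) *\<^sub>R (a * s - u - t * (s - d0)) \<le> (1 / real (Suc n)) *\<^sub>R real (Suc n) *\<^sub>R (s - d)"
          by (intro scaleR_left_mono) auto
        then have "(1 / real (Suc n)) *\<^sub>R (a * s - u - t * (s - d0)) \<le> s - d" by simp
        also have "\<dots> \<le> s - d'" using d by simp
        finally show "d' \<le> s - (1 / real (Suc n)) *\<^sub>R (a * s - u - t * (s - d0))"
          by (simp only: le_diff_eq add.commute)
      qed
      then have "(1 / real (Suc n)) *\<^sub>R (a * s - u - t * (s - d0)) \<le> (1 / real (Suc n)) *\<^sub>R 0"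
        by (simp add: algebra_simps)
      then have "a * s - u - t * (s - d0) \<le> 0"
        by (subst (asm) scaleR_le_scaleR_iff) auto
      then show ?thesis by (simp add: algebra_simps)
    qed
    then show "a * s - u \<le> t * (s - d0)" by (simp add: algebra_simps)
  qed
  then show "a * s \<le> u" by simp
qed

lemma up_directed_truncations: "up_directed (range (\<lambda>n::nat. inf f (real n *\<^sub>R e)))"
  unfolding up_directed_def
proof (intro conjI ballI)
  fix x y assume "x \<in> range (\<lambda>n::nat. inf f (real n *\<^sub>R e))" "y \<in> range (\<lambda>n::nat. inf f (real n *\<^sub>R e))"
  then obtain m n :: nat where "x = inf f (real m *\<^sub>R e)" "y = inf f (real n *\<^sub>R e)" by blast
  then have "x \<le> inf f (real (max m n) *\<^sub>R e)" "y \<le> inf f (real (max m n) *\<^sub>R e)"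
    by (auto intro!: le_infI2 scaleR_right_mono)
  then show "\<exists>z\<in>range (\<lambda>n::nat. inf f (real n *\<^sub>R e)). x \<le> z \<and> y \<le> z" by blast
qed simp

lemma lub_truncations:
  fixes f :: 'u
  shows "lub (range (\<lambda>n::nat. inf f (real n *\<^sub>R e))) f"
proof (rule lubI)
  fix u assume u: "\<And>z. z \<in> range (\<lambda>n::nat. inf f (real n *\<^sub>R e)) \<Longrightarrow> z \<le> u"
  have "f - u \<le> 0"
  proof (rule le_tails_zero[of e _ f])
    fix n :: nat
    have "f - u \<le> f - inf f (real n *\<^sub>R e)" using u by (intro diff_left_mono) blast
    then show "f - u \<le> pprt (f - real n *\<^sub>R e) * e" by (simp only: trunc_diff unit_right)
  qed simp
  then show "f \<le> u" by simp
qed auto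

text \<open>Taking the supremum in each factor separately produces mixed products
  \<open>d * d'\<close>; directedness bounds each of them by a square.\<close>

lemma lub_squares:
  fixes D :: "'u set"
  assumes D: "up_directed D" "lub D s" and nonneg: "\<And>d. d \<in> D \<Longrightarrow> 0 \<le> d"
  shows "lub ((\<lambda>d. d * d) ` D) (s * s)"
proof (rule lubI)
  fix z assume "z \<in> (\<lambda>d. d * d) ` D"
  then obtain d where d: "d \<in> D" "z = d * d" by blast
  have "d \<le> s" "0 \<le> d" using lub_upper[OF D(2)] nonneg d by auto
  then show "z \<le> s * s" unfolding d(2) by (intro mult_mono) (auto intro: order.trans)
next
  fix u assume u: "\<And>z. z \<in> (\<lambda>d. d * d) ` D \<Longrightarrow> z \<le> u"
  have s: "0 \<le> s" using D nonneg by (metis all_not_in_conv lub_upper order.trans up_directed_def)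
  show "s * s \<le> u"
  proof (rule lub_least[OF lub_mult[OF D s]])
    fix z assume "z \<in> (*) s ` D"
    then obtain d where d: "d \<in> D" "z = d * s" by (auto simp: commute)
    have "d * s \<le> u"
    proof (rule lub_least[OF lub_mult[OF D nonneg[OF d(1)]]])
      fix w assume "w \<in> (*) d ` D"
      then obtain d' where d': "d' \<in> D" "w = d * d'" by blast
      obtain d'' where d'': "d'' \<in> D" "d \<le> d''" "d' \<le> d''"
        using D(1) d d' unfolding up_directed_def by blast
      have "w \<le> d'' * d''" unfolding d' using d d' d'' nonneg by (intro mult_mono) auto
      then show "w \<le> u" using u d'' by (meson image_eqI order.trans)
    qed
    then show "z \<le> u" using d by simp
  qed
qed

section \<open>Cancellation and supports\<close>

text \<open>In place of dividing the difference of squares by \<open>q + s\<close>, the positive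
  part of \<open>q - s\<close> is shown to have square at most \<open>pprt (q * q - s * s)\<close>,
  which is zero.\<close>

lemma square_le_imp_le:
  fixes r s :: 'u
  assumes s: "0 \<le> s" and rs: "r * r \<le> s * s"
  shows "r \<le> s"
proof -
  define q where "q = \<bar>r\<bar>"
  have q: "0 \<le> q" "q * q \<le> s * s" using rs by (simp_all add: q_def abs_square)
  have "q - s \<le> q" using s by simp
  also have "q \<le> q + s" using s by simp
  finally have "pprt (q - s) \<le> q + s" using q s by (intro pprt_le) simp_all
  then have "pprt (q - s) * pprt (q - s) \<le> (q + s) * pprt (q - s)"
    by (rule mult_right_mono) simp
  also have "\<dots> = pprt ((q + s) * (q - s))" using q s by (simp only: mult_pprt add_nonneg_nonneg)
  also have "(q + s) * (q - s) = q * q - s * s"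
    by (simp add: distrib_right right_diff_distrib commute[of s q])
  also have "pprt (q * q - s * s) = 0" using q by simp
  finally have "pprt (q - s) * pprt (q - s) = 0" by (intro order.antisym square_nonneg)
  then have "pprt (q - s) = 0" by (rule square_eq_0)
  then have "q \<le> s" using le_zero_iff_zero_pprt[of "q - s"] by simp
  then show ?thesis unfolding q_def by (meson abs_ge_self order.trans)
qed

text \<open>The factor \<open>q\<close> is cancelled although it may vanish in places: the square of
  \<open>pprt (q - K)\<close> is at most \<open>q * pprt (q - K)\<close>, which is the positive part
  of \<open>q * q - K * q\<close>.\<close>

lemma le_if_square_le:
  fixes q K :: 'u
  assumes q: "0 \<le> q" and K: "0 \<le> K" and qK: "q * q \<le> K * q"
  shows "q \<le> K"
proof -
  have "pprt (q - K) \<le> q" using q K by (intro pprt_le) simp_all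
  then have "pprt (q - K) * pprt (q - K) \<le> q * pprt (q - K)"
    by (rule mult_right_mono) simp
  also have "\<dots> = pprt (q * q - K * q)"
    using q by (simp only: mult_pprt right_diff_distrib commute[of q K])
  also have "\<dots> = 0" using qK by simp
  finally have "pprt (q - K) * pprt (q - K) = 0" by (intro order.antisym square_nonneg)
  then have "pprt (q - K) = 0" by (rule square_eq_0)
  then show ?thesis using le_zero_iff_zero_pprt[of "q - K"] by simp
qed

text \<open>In a function space \<open>p\<close> is the indicator of the set where \<open>u\<close>
  is positive. Its description as a supremum is part of the conclusion because it shows that
  \<open>p\<close> lies in \<open>A\<close> whenever \<open>u\<close> does.\<close>

lemma support_exists:
  fixes u :: 'u
  assumes u: "0 \<le> u"
  obtains p where "lub (range (\<lambda>n::nat. inf (real n *\<^sub>R u) e)) p" "0 \<le> p" "p \<le> e" "p * u = u"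
    "p * p = p" "\<And>v. 0 \<le> v \<Longrightarrow> u * v = 0 \<Longrightarrow> p * v = 0"
proof -
  let ?D = "range (\<lambda>n::nat. inf (real n *\<^sub>R u) e)"
  have "\<And>z. z \<in> ?D \<Longrightarrow> z \<le> e" by auto
  then obtain p where p: "lub ?D p" using lub_exists[of ?D e] by blast
  have "inf (real 0 *\<^sub>R u) e \<in> ?D" by (rule rangeI)
  then have p0: "0 \<le> p" using lub_upper[OF p] by (metis inf_absorb1 scaleR_zero_left of_nat_0 unit_nonneg)
  have pe: "p \<le> e" by (rule lub_least[OF p]) auto
  define t where "t = inf (e - p) u"
  have t0: "0 \<le> t" using pe u by (simp add: t_def)
  \<comment> \<open>\<open>t\<close> is the part of \<open>u\<close> not covered by
    \<open>p\<close>. Adding it to a member of the net stays below the next member, so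
    \<open>p - t\<close> is still an upper bound.\<close>
  have "p \<le> p - t"
  proof (rule lub_least[OF p])
    fix z assume "z \<in> ?D"
    then obtain n :: nat where z: "z = inf (real n *\<^sub>R u) e" by blast
    have "z + t \<le> real n *\<^sub>R u + u" unfolding z t_def by (intro add_mono) auto
    moreover have "z \<le> p" using lub_upper[OF p] z by blast
    then have "z + t \<le> p + (e - p)" unfolding t_def by (intro add_mono) auto
    ultimately have "z + t \<le> inf (real (Suc n) *\<^sub>R u) e" by (simp add: algebra_simps)
    also have "\<dots> \<le> p" using lub_upper[OF p] by blast
    finally show "z \<le> p - t" by (simp add: algebra_simps)
  qed
  then have "t = 0" using t0 by (simp add: order.antisym)
  then have "(e - p) * u = 0" unfolding t_def by (rule mult_eq_0_of_inf)
  then have pu: "p * u = u" by (simp add: left_diff_distrib)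
  have disj: "p * v = 0" if v: "0 \<le> v" "u * v = 0" for v
  proof -
    have "lub ((\<lambda>d. inf v d) ` ?D) (inf v p)" by (rule lub_inf[OF p])
    moreover have "inf v (inf (real n *\<^sub>R u) e) \<le> 0" for n :: nat
    proof -
      have "inf (real n *\<^sub>R u) v = 0"
        using u v by (subst inf_eq_0_iff) auto
      then show ?thesis by (metis inf.cobounded1 inf.assoc inf_commute)
    qed
    ultimately have "inf v p \<le> 0" by (auto elim!: lub_least)
    then have "inf p v = 0" using v p0 by (simp add: order.antisym inf_commute)
    then show ?thesis by (rule mult_eq_0_of_inf)
  qed
  have "u * (e - p) = 0" using pu by (simp add: right_diff_distrib commute)
  then have "p * (e - p) = 0" using pe by (intro disj) auto
  then have "p * p = p" by (simp add: right_diff_distrib)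
  then show ?thesis using that p p0 pe pu disj by blast
qed

end

subsection \<open>The extended conditional expectation\<close>

locale conditional_expectation_space = unital_f_algebra e
  for e :: "'u::f_algebra" +
  fixes E :: "'u set" and T :: "'u \<Rightarrow> 'u"
  assumes E_riesz: "riesz_subspace E" and E_complete: "dedekind_complete E" and unit_in_E: "e \<in> E"
    and E_dense: "order_dense E UNIV" and lateral: "laterally_complete (UNIV :: 'u set)"
    and T_cond: "conditional_expectation E T" and T_unit: "T e = e"
    and T_strict: "strictly_positive_on E T"
begin

abbreviation Te :: "'u \<Rightarrow> 'u" where "Te \<equiv> ext E T"
abbreviation Tcone :: "'u \<Rightarrow> 'u" where "Tcone \<equiv> ext_cone E T"
abbreviation cone :: "'u set" where "cone \<equiv> L1_cone E T"
abbreviation dom :: "'u set" where "dom \<equiv> L1 E T"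
abbreviation A :: "'u set" where "A \<equiv> range_alg E T"

text \<open>The largest net in \<open>E\<close> increasing to \<open>f\<close>. It serves as the
  canonical choice with which all other approximating nets are compared.\<close>

definition below :: "'u \<Rightarrow> 'u set" where
  "below f = {x \<in> E. 0 \<le> x \<and> x \<le> f}"

lemma T_in_E: "x \<in> E \<Longrightarrow> T x \<in> E"
  and T_add: "x \<in> E \<Longrightarrow> y \<in> E \<Longrightarrow> T (x + y) = T x + T y"
  and T_scaleR: "x \<in> E \<Longrightarrow> T (r *\<^sub>R x) = r *\<^sub>R T x"
  and T_nonneg: "x \<in> E \<Longrightarrow> 0 \<le> x \<Longrightarrow> 0 \<le> T x"
  and T_idem: "x \<in> E \<Longrightarrow> T (T x) = T x"
  using T_cond unfolding conditional_expectation_def linear_into_def positive_on_def by auto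

lemma T_diff: "x \<in> E \<Longrightarrow> y \<in> E \<Longrightarrow> T (x - y) = T x - T y"
  using T_add[of x "(-1) *\<^sub>R y"] T_scaleR[of y "-1"] E_riesz
  by (simp add: riesz_subspace_minus)

lemma T_mono: "x \<in> E \<Longrightarrow> y \<in> E \<Longrightarrow> x \<le> y \<Longrightarrow> T x \<le> T y"
  using T_nonneg[of "y - x"] T_diff[of y x] E_riesz by (simp add: riesz_subspace_diff)

section \<open>Order density of \<open>E\<close> and suprema in the ambient space\<close>

text \<open>If the supremum fell short of \<open>y\<close>, order density would give a positive
  \<open>w\<close> in \<open>E\<close> inside the gap, and \<open>w\<close> could be added to every
  member of the net.\<close>

lemma lub_below:
  assumes "0 \<le> y"
  shows "lub (below y) y"
proof -
  have "0 \<in> below y" using assms E_riesz by (simp add: below_def riesz_subspace_0)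
  then have "below y \<noteq> {}" by blast
  then obtain s where s: "lub (below y) s"
    by (rule lub_exists[of _ y]) (auto simp: below_def)
  have sy: "s \<le> y" by (rule lub_least[OF s]) (simp add: below_def)
  have "s = y"
  proof (rule ccontr)
    assume "s \<noteq> y"
    then have "0 < y - s" using sy by (simp add: order.not_eq_order_implies_strict)
    then obtain w where w: "w \<in> E" "0 < w" "w \<le> y - s"
      using E_dense unfolding order_dense_def by blast
    have "s \<le> s - w"
    proof (rule lub_least[OF s])
      fix z assume z: "z \<in> below y"
      have "z + w \<le> s + (y - s)" using lub_upper[OF s z] w by (intro add_mono) auto
      then have "z + w \<in> below y"
        using z w E_riesz by (auto simp: below_def riesz_subspace_add)
      then have "z + w \<le> s" by (rule lub_upper[OF s])
      then show "z \<le> s - w" by (simp add: le_diff_eq)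
    qed
    then show False using w by (auto simp: algebra_simps)
  qed
  then show ?thesis using s by simp
qed

text \<open>The supremum of \<open>below y\<close> taken in \<open>E\<close> cannot exceed
  \<open>y\<close>: a positive element of \<open>E\<close> in the gap could be subtracted to give a
  smaller upper bound in \<open>E\<close>.\<close>

lemma E_ideal:
  assumes x: "x \<in> E" and y: "0 \<le> y" "y \<le> x"
  shows "y \<in> E"
proof -
  have "0 \<in> below y" using y E_riesz by (simp add: below_def riesz_subspace_0)
  then have "below y \<noteq> {}" by blast
  moreover have "\<forall>z\<in>below y. z \<le> x" using y by (auto simp: below_def intro: order.trans)
  moreover have "below y \<subseteq> E" by (auto simp: below_def)
  ultimately obtain t where t: "is_sup_in E (below y) t"
    using E_complete x unfolding dedekind_complete_def by blast
  have yt: "y \<le> t" by (rule lub_least[OF lub_below[OF y(1)]]) (use t in \<open>auto simp: is_sup_in_def\<close>)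
  have "t = y"
  proof (rule ccontr)
    assume "t \<noteq> y"
    then have "0 < t - y" using yt by (simp add: order.not_eq_order_implies_strict)
    then obtain w where w: "w \<in> E" "0 < w" "w \<le> t - y"
      using E_dense unfolding order_dense_def by blast
    have "t - w \<in> E" using t w E_riesz by (auto simp: is_sup_in_def riesz_subspace_diff)
    moreover have "z \<le> t - w" if "z \<in> below y" for z
    proof -
      have "z \<le> y" using that by (simp add: below_def)
      also have "y \<le> t - w" using w(3) by (simp add: algebra_simps)
      finally show ?thesis .
    qed
    ultimately have "t \<le> t - w" using t unfolding is_sup_in_def by blast
    then show False using w by (auto simp: algebra_simps)
  qed
  then show ?thesis using t by (simp add: is_sup_in_def)
qed

text \<open>Order continuity is assumed for infima in \<open>E\<close>, whereas \<open>u\<close> is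
  any ambient bound. The excess \<open>pprt (T s - u)\<close> lies below each
  \<open>T (s - d)\<close>, hence in \<open>E\<close> by the ideal property, and there the infimum
  of these elements is zero.\<close>

lemma T_order_continuous:
  assumes D: "D \<subseteq> E" "up_directed D" "lub D s" and s: "s \<in> E" and u: "\<And>d. d \<in> D \<Longrightarrow> T d \<le> u"
  shows "T s \<le> u"
proof -
  let ?D = "(\<lambda>d. s - d) ` D"
  have sub: "?D \<subseteq> E" using D s E_riesz by (auto intro: riesz_subspace_diff)
  have "down_directed ?D"
    unfolding down_directed_def
  proof (intro conjI ballI)
    show "?D \<noteq> {}" using D(2) by (simp add: up_directed_def)
    fix x y assume "x \<in> ?D" "y \<in> ?D"
    then obtain c d where cd: "c \<in> D" "d \<in> D" "x = s - c" "y = s - d" by blast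
    then obtain z where "z \<in> D" "c \<le> z" "d \<le> z" using D(2) unfolding up_directed_def by blast
    then show "\<exists>z\<in>?D. z \<le> x \<and> z \<le> y" using cd by (auto intro!: bexI[of _ z])
  qed
  moreover have "is_inf_in E ?D 0"
    unfolding is_inf_in_def
  proof (intro conjI ballI impI)
    show "0 \<in> E" using E_riesz by (rule riesz_subspace_0)
    show "0 \<le> x" if "x \<in> ?D" for x using that lub_upper[OF D(3)] by auto
    fix v assume v: "\<forall>x\<in>?D. v \<le> x"
    have "s \<le> s - v"
    proof (rule lub_least[OF D(3)])
      fix d assume "d \<in> D"
      then have "v \<le> s - d" using v by blast
      then show "d \<le> s - v" by (simp add: algebra_simps)
    qed
    then show "v \<le> 0" by (simp add: algebra_simps)
  qed
  ultimately have inf: "is_inf_in E ((\<lambda>x. \<bar>T x\<bar>) ` ?D) 0"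
    using T_cond sub unfolding conditional_expectation_def order_continuous_on_def by blast
  have le: "pprt (T s - u) \<le> T (s - d)" if d: "d \<in> D" for d
  proof (rule pprt_le)
    have dE: "d \<in> E" using D d by blast
    show "T s - u \<le> T (s - d)" using u[OF d] s dE by (simp add: T_diff)
    show "0 \<le> T (s - d)"
      using s dE E_riesz lub_upper[OF D(3) d] by (intro T_nonneg) (auto intro: riesz_subspace_diff)
  qed
  obtain d0 where d0: "d0 \<in> D" using D(2) by (auto simp: up_directed_def)
  have "pprt (T s - u) \<in> E"
    by (rule E_ideal[OF _ _ le[OF d0]]) (use d0 sub in \<open>auto intro: T_in_E\<close>)
  moreover have "\<forall>x\<in>(\<lambda>x. \<bar>T x\<bar>) ` ?D. pprt (T s - u) \<le> x"
    using le by (auto intro: order.trans[OF _ abs_ge_self])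
  ultimately have "pprt (T s - u) \<le> 0" using inf unfolding is_inf_in_def by blast
  then have "pprt (T s - u) = 0" by (rule order.antisym) simp
  then show ?thesis using le_zero_iff_zero_pprt[of "T s - u"] by simp
qed

section \<open>The cone of the natural domain\<close>

text \<open>Each \<open>x\<close> in \<open>below f\<close> is the supremum of the elements
  \<open>inf x d\<close>. Equal upper bounds mean equal suprema of the values of \<open>T\<close>,
  so the extension does not depend on the net.\<close>

lemma net_bound_iff:
  assumes "approximating_net E T D f"
  shows "(\<forall>x\<in>D. T x \<le> u) \<longleftrightarrow> (\<forall>x\<in>below f. T x \<le> u)"
proof -
  have D: "D \<subseteq> E" "\<And>d. d \<in> D \<Longrightarrow> 0 \<le> d" "up_directed D" "lub D f"
    using assms by (auto simp: approximating_net_def)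
  show ?thesis
  proof
    assume u: "\<forall>x\<in>D. T x \<le> u"
    show "\<forall>x\<in>below f. T x \<le> u"
    proof
      fix x assume x: "x \<in> below f"
      have "lub ((\<lambda>d. inf x d) ` D) (inf x f)" by (rule lub_inf[OF D(4)])
      moreover have "inf x f = x" using x by (simp add: below_def inf_absorb1)
      ultimately have l: "lub ((\<lambda>d. inf x d) ` D) x" by simp
      have inE: "inf x d \<in> E" if "d \<in> D" for d
        using that x D(1) E_riesz by (auto simp: below_def intro: riesz_subspace_inf)
      show "T x \<le> u"
      proof (rule T_order_continuous[OF _ _ l])
        show "up_directed (inf x ` D)" by (rule up_directed_image[OF D(3)]) (auto intro: le_infI2)
        show "T d \<le> u" if "d \<in> inf x ` D" for d
        proof -
          obtain c where c: "c \<in> D" "d = inf x c" using \<open>d \<in> inf x ` D\<close> by blast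
          have "T d \<le> T c" using c inE D(1) by (intro T_mono) auto
          then show ?thesis using u c(1) by (meson order.trans)
        qed
      qed (use inE x in \<open>auto simp: below_def\<close>)
    qed
  next
    assume "\<forall>x\<in>below f. T x \<le> u"
    then show "\<forall>x\<in>D. T x \<le> u" using D lub_upper[OF D(4)] by (auto simp: below_def)
  qed
qed

lemma net_below:
  assumes "0 \<le> f" "\<forall>x\<in>below f. T x \<le> u"
  shows "approximating_net E T (below f) f"
  unfolding approximating_net_def
proof (intro conjI)
  show "up_directed (below f)"
    unfolding up_directed_def
  proof (intro conjI ballI)
    show "below f \<noteq> {}" using assms(1) E_riesz by (auto simp: below_def intro: riesz_subspace_0)
    fix x y assume "x \<in> below f" "y \<in> below f"
    then have "sup x y \<in> below f"
      using E_riesz by (auto simp: below_def intro: riesz_subspace_sup le_supI1)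
    then show "\<exists>z\<in>below f. x \<le> z \<and> y \<le> z" by (intro bexI[of _ "sup x y"]) auto
  qed
qed (use assms lub_below in \<open>auto simp: below_def\<close>)

lemma cone_iff: "f \<in> cone \<longleftrightarrow> 0 \<le> f \<and> (\<exists>u. \<forall>x\<in>below f. T x \<le> u)"
proof
  assume "f \<in> cone"
  then obtain D where D: "0 \<le> f" "approximating_net E T D f" by (auto simp: L1_cone_def)
  moreover obtain u where "\<forall>x\<in>D. T x \<le> u" using D(2) by (auto simp: approximating_net_def)
  ultimately show "0 \<le> f \<and> (\<exists>u. \<forall>x\<in>below f. T x \<le> u)" using net_bound_iff by blast
next
  assume "0 \<le> f \<and> (\<exists>u. \<forall>x\<in>below f. T x \<le> u)"
  then show "f \<in> cone" using net_below by (auto simp: L1_cone_def)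
qed

lemma Tcone_lub:
  assumes f: "f \<in> cone"
  shows "lub (T ` below f) (Tcone f)"
proof -
  obtain u where f0: "0 \<le> f" and u: "\<forall>x\<in>below f. T x \<le> u" using f by (auto simp: cone_iff)
  note net = net_below[OF f0 u]
  have "below f \<noteq> {}" using net by (simp add: approximating_net_def up_directed_def)
  then obtain g where g: "lub (T ` below f) g" using u lub_exists[of "T ` below f" u] by blast
  have "Tcone f = g"
    unfolding ext_cone_def
  proof (rule the_equality)
    show "\<exists>D. approximating_net E T D f \<and> lub (T ` D) g" using net g by blast
    fix h assume "\<exists>D. approximating_net E T D f \<and> lub (T ` D) h"
    then obtain D where D: "approximating_net E T D f" "lub (T ` D) h" by blast
    have "lub (T ` below f) h" using D(2) net_bound_iff[OF D(1)] by (simp add: is_sup_in_def)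
    then show "h = g" using g by (rule lub_unique)
  qed
  then show ?thesis using g by simp
qed

lemma Tcone_upper: "f \<in> cone \<Longrightarrow> x \<in> below f \<Longrightarrow> T x \<le> Tcone f"
  by (rule lub_upper[OF Tcone_lub]) auto

lemma Tcone_least: "f \<in> cone \<Longrightarrow> (\<And>x. x \<in> below f \<Longrightarrow> T x \<le> u) \<Longrightarrow> Tcone f \<le> u"
  by (erule lub_least[OF Tcone_lub]) auto

lemma cone_nonneg: "f \<in> cone \<Longrightarrow> 0 \<le> f"
  by (simp add: cone_iff)

lemma zero_below: "f \<in> cone \<Longrightarrow> 0 \<in> below f"
  using E_riesz by (auto simp: below_def cone_nonneg intro: riesz_subspace_0)

lemma T_0: "T 0 = 0"
  using T_scaleR[of 0 0] E_riesz by (simp add: riesz_subspace_0)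

lemma Tcone_nonneg: "f \<in> cone \<Longrightarrow> 0 \<le> Tcone f"
  by (subst T_0[symmetric]) (rule Tcone_upper[OF _ zero_below])

lemma cone_ideal: "f \<in> cone \<Longrightarrow> 0 \<le> g \<Longrightarrow> g \<le> f \<Longrightarrow> g \<in> cone"
  unfolding cone_iff below_def by (metis (no_types, lifting) mem_Collect_eq order.trans)

lemma cone_add:
  assumes f: "f \<in> cone" and g: "g \<in> cone"
  shows "f + g \<in> cone" and "Tcone (f + g) = Tcone f + Tcone g"
proof -
  have le: "T x \<le> Tcone f + Tcone g" if x: "x \<in> below (f + g)" for x
  proof -
    \<comment> \<open>Riesz decomposition of \<open>x\<close> into a part below \<open>f\<close> and
      a part below \<open>g\<close>.\<close>
    have i: "inf x f \<in> below f" using x f E_ideal[of x "inf x f"]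
      by (simp add: below_def cone_nonneg)
    have "x - f \<le> g" using x by (simp add: below_def algebra_simps)
    then have "x - inf x f \<le> g" unfolding trunc_diff by (rule pprt_le) (rule cone_nonneg[OF g])
    moreover have "x - inf x f \<in> E"
      using x i by (intro riesz_subspace_diff[OF E_riesz]) (auto simp: below_def)
    moreover have "0 \<le> x - inf x f" unfolding trunc_diff by (rule zero_le_pprt)
    ultimately have d: "x - inf x f \<in> below g" unfolding below_def by blast
    have "T x = T (inf x f + (x - inf x f))"
      by (simp only: add.commute[of "inf x f"] diff_add_cancel)
    also have "\<dots> = T (inf x f) + T (x - inf x f)"
      using i d unfolding below_def by (intro T_add) blast+
    also have "\<dots> \<le> Tcone f + Tcone g" using i d f g by (intro add_mono Tcone_upper)
    finally show ?thesis .
  qed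
  show c: "f + g \<in> cone" using le f g by (auto simp: cone_iff)
  have "Tcone f \<le> Tcone (f + g) - Tcone g"
  proof (rule Tcone_least[OF f])
    fix x assume x: "x \<in> below f"
    have "Tcone g \<le> Tcone (f + g) - T x"
    proof (rule Tcone_least[OF g])
      fix y assume y: "y \<in> below g"
      have "x + y \<in> below (f + g)"
        using x y E_riesz by (auto simp: below_def intro: riesz_subspace_add add_mono)
      then have "T (x + y) \<le> Tcone (f + g)" by (rule Tcone_upper[OF c])
      then show "T y \<le> Tcone (f + g) - T x" using x y by (simp add: T_add below_def algebra_simps)
    qed
    then show "T x \<le> Tcone (f + g) - Tcone g" by (simp add: algebra_simps)
  qed
  then show "Tcone (f + g) = Tcone f + Tcone g"
    using Tcone_least[OF c le] by (simp add: algebra_simps order.antisym)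
qed

lemma cone_0: "0 \<in> cone" and Tcone_0: "Tcone 0 = 0"
proof -
  have b: "below 0 = {0}" using E_riesz by (auto simp: below_def intro: riesz_subspace_0)
  show "0 \<in> cone" by (auto simp: cone_iff b)
  from Tcone_lub[OF this] have "lub {0} (Tcone 0)" by (simp add: b T_0)
  then show "Tcone 0 = 0" by (rule lub_unique) (auto intro: lubI)
qed

lemma cone_scaleR:
  assumes f: "f \<in> cone" and r: "0 \<le> r"
  shows "r *\<^sub>R f \<in> cone" and "Tcone (r *\<^sub>R f) = r *\<^sub>R Tcone f"
proof -
  \<comment> \<open>One inequality suffices: applied to the factor \<open>1 / r\<close> it yields
    the converse one.\<close>
  have *: "s *\<^sub>R g \<in> cone \<and> Tcone (s *\<^sub>R g) \<le> s *\<^sub>R Tcone g" if g: "g \<in> cone" and s: "0 < s" for s g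
  proof -
    have le: "T x \<le> s *\<^sub>R Tcone g" if x: "x \<in> below (s *\<^sub>R g)" for x
    proof -
      have "(1 / s) *\<^sub>R x \<le> (1 / s) *\<^sub>R s *\<^sub>R g" using x s by (intro scaleR_left_mono) (auto simp: below_def)
      then have "(1 / s) *\<^sub>R x \<in> below g"
        using x s E_riesz by (auto simp: below_def intro: riesz_subspace_scaleR)
      then have "s *\<^sub>R T ((1 / s) *\<^sub>R x) \<le> s *\<^sub>R Tcone g"
        using s by (intro scaleR_left_mono Tcone_upper[OF g]) auto
      then show ?thesis using x s by (simp add: T_scaleR below_def)
    qed
    have c: "s *\<^sub>R g \<in> cone" using le g s by (auto simp: cone_iff)
    then show ?thesis using Tcone_least[OF c le] by blast
  qed
  show "r *\<^sub>R f \<in> cone" using *[OF f, of r] r cone_0 by (cases "r = 0") auto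
  show "Tcone (r *\<^sub>R f) = r *\<^sub>R Tcone f"
  proof (cases "r = 0")
    case False
    then have r: "0 < r" using r by simp
    have "Tcone ((1 / r) *\<^sub>R r *\<^sub>R f) \<le> (1 / r) *\<^sub>R Tcone (r *\<^sub>R f)"
      using *[of "r *\<^sub>R f" "1 / r"] *[OF f r] r by simp
    then have "r *\<^sub>R Tcone ((1 / r) *\<^sub>R r *\<^sub>R f) \<le> r *\<^sub>R (1 / r) *\<^sub>R Tcone (r *\<^sub>R f)"
      using r by (intro scaleR_left_mono) auto
    then have "r *\<^sub>R Tcone f \<le> Tcone (r *\<^sub>R f)" using r by simp
    then show ?thesis using *[OF f r] by (simp add: order.antisym)
  qed (simp add: Tcone_0)
qed

section \<open>The extension on differences of cone elements\<close>

lemma Te_diff_cone: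
  assumes "f1 \<in> cone" "f2 \<in> cone"
  shows "Te (f1 - f2) = Tcone f1 - Tcone f2"
  unfolding ext_def
proof (rule the_equality)
  show "\<exists>g1\<in>cone. \<exists>g2\<in>cone. f1 - f2 = g1 - g2 \<and> Tcone f1 - Tcone f2 = Tcone g1 - Tcone g2"
    using assms by blast
  fix h assume "\<exists>g1\<in>cone. \<exists>g2\<in>cone. f1 - f2 = g1 - g2 \<and> h = Tcone g1 - Tcone g2"
  then obtain g1 g2 where g: "g1 \<in> cone" "g2 \<in> cone" "f1 - f2 = g1 - g2" "h = Tcone g1 - Tcone g2"
    by blast
  have "f1 + g2 = g1 + f2" using g(3) by (simp add: algebra_simps)
  then have "Tcone f1 + Tcone g2 = Tcone g1 + Tcone f2"
    using assms g by (metis cone_add(2))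
  then have "Tcone g1 = Tcone f1 + Tcone g2 - Tcone f2" by (simp only: eq_diff_eq)
  then show "h = Tcone f1 - Tcone f2" unfolding g(4) by simp
qed

lemma domE:
  assumes "f \<in> dom"
  obtains f1 f2 where "f1 \<in> cone" "f2 \<in> cone" "f = f1 - f2"
  using assms by (auto simp: L1_def)

lemma domI: "f1 \<in> cone \<Longrightarrow> f2 \<in> cone \<Longrightarrow> f1 - f2 \<in> dom"
  by (auto simp: L1_def)

lemma cone_dom: "f \<in> cone \<Longrightarrow> f \<in> dom" and Te_cone: "f \<in> cone \<Longrightarrow> Te f = Tcone f"
  using domI[OF _ cone_0, of f] Te_diff_cone[OF _ cone_0, of f] by (simp_all add: Tcone_0)

text \<open>Reduces membership in the natural domain to the cone, which is closed under passing to
  smaller nonnegative elements; this makes the domain an ideal.\<close>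

lemma dom_iff_abs: "f \<in> dom \<longleftrightarrow> \<bar>f\<bar> \<in> cone"
proof
  assume "f \<in> dom"
  then obtain f1 f2 where f: "f1 \<in> cone" "f2 \<in> cone" "f = f1 - f2" by (rule domE)
  have "\<bar>f\<bar> \<le> \<bar>f1\<bar> + \<bar>f2\<bar>" unfolding f(3) by (rule abs_triangle_ineq4)
  then show "\<bar>f\<bar> \<in> cone"
    using f by (intro cone_ideal[OF cone_add(1)[OF f(1,2)]]) (auto simp: cone_nonneg)
next
  assume f: "\<bar>f\<bar> \<in> cone"
  have "pprt f \<in> cone" by (rule cone_ideal[OF f]) (auto simp: pprt_le_abs)
  moreover have "pprt (- f) \<in> cone"
    by (rule cone_ideal[OF f]) (use pprt_le_abs[of "- f"] in auto)
  ultimately show "f \<in> dom" using domI diff_pprts[of f] by metis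
qed

lemma dom_nonneg_iff: "0 \<le> f \<Longrightarrow> f \<in> dom \<longleftrightarrow> f \<in> cone"
  by (simp add: dom_iff_abs)

lemma dom_ideal: "g \<in> dom \<Longrightarrow> \<bar>f\<bar> \<le> g \<Longrightarrow> f \<in> dom"
  by (metis abs_ge_self abs_ge_zero cone_ideal dom_iff_abs order.trans)

lemma dom_add: "f \<in> dom \<Longrightarrow> g \<in> dom \<Longrightarrow> f + g \<in> dom"
  and Te_add: "f \<in> dom \<Longrightarrow> g \<in> dom \<Longrightarrow> Te (f + g) = Te f + Te g"
proof -
  assume "f \<in> dom" "g \<in> dom"
  then obtain f1 f2 g1 g2 where fg: "f1 \<in> cone" "f2 \<in> cone" "f = f1 - f2"
    "g1 \<in> cone" "g2 \<in> cone" "g = g1 - g2" by (metis domE)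
  have eq: "f + g = (f1 + g1) - (f2 + g2)" by (simp add: fg)
  show "f + g \<in> dom" unfolding eq using fg by (intro domI cone_add)
  show "Te (f + g) = Te f + Te g"
    unfolding eq using fg by (simp add: Te_diff_cone cone_add)
qed

lemma dom_minus: "f \<in> dom \<Longrightarrow> - f \<in> dom"
  by (simp add: dom_iff_abs)

lemma Te_minus: "f \<in> dom \<Longrightarrow> Te (- f) = - Te f"
  by (metis Te_diff_cone domE minus_diff_eq)

lemma dom_diff: "f \<in> dom \<Longrightarrow> g \<in> dom \<Longrightarrow> f - g \<in> dom"
  using dom_add[of f "- g"] dom_minus by simp

lemma Te_diff: "f \<in> dom \<Longrightarrow> g \<in> dom \<Longrightarrow> Te (f - g) = Te f - Te g"
  using Te_add[of f "- g"] dom_minus Te_minus by simp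

lemma dom_scaleR: "f \<in> dom \<Longrightarrow> r *\<^sub>R f \<in> dom"
  and Te_scaleR: "f \<in> dom \<Longrightarrow> Te (r *\<^sub>R f) = r *\<^sub>R Te f"
proof -
  assume f: "f \<in> dom"
  have *: "s *\<^sub>R g \<in> dom \<and> Te (s *\<^sub>R g) = s *\<^sub>R Te g" if g: "g \<in> dom" and s: "0 \<le> s" for s g
  proof -
    obtain f1 f2 where f: "f1 \<in> cone" "f2 \<in> cone" "g = f1 - f2" by (rule domE[OF g])
    have "s *\<^sub>R g = s *\<^sub>R f1 - s *\<^sub>R f2" by (simp add: f scaleR_diff_right)
    then show ?thesis
      using f s by (simp add: domI cone_scaleR Te_diff_cone scaleR_diff_right)
  qed
  have "r *\<^sub>R f \<in> dom \<and> Te (r *\<^sub>R f) = r *\<^sub>R Te f"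
    using *[OF f, of r] *[OF dom_minus[OF f], of "- r"] f by (cases "0 \<le> r") (auto simp: Te_minus)
  then show "r *\<^sub>R f \<in> dom" "Te (r *\<^sub>R f) = r *\<^sub>R Te f" by auto
qed

lemma dom_0: "0 \<in> dom" and Te_0: "Te 0 = 0"
  using cone_0 by (simp_all add: cone_dom Te_cone Tcone_0)

lemma Te_nonneg: "f \<in> dom \<Longrightarrow> 0 \<le> f \<Longrightarrow> 0 \<le> Te f"
  by (simp add: dom_nonneg_iff Te_cone Tcone_nonneg)

lemma Te_mono: "f \<in> dom \<Longrightarrow> g \<in> dom \<Longrightarrow> f \<le> g \<Longrightarrow> Te f \<le> Te g"
  using Te_nonneg[of "g - f"] by (simp add: dom_diff Te_diff)

lemma dom_abs: "f \<in> dom \<Longrightarrow> \<bar>f\<bar> \<in> dom"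
  by (simp add: dom_iff_abs)

lemma dom_pprt: "f \<in> dom \<Longrightarrow> pprt f \<in> dom"
  by (rule dom_ideal[OF dom_abs]) (auto simp: pprt_le_abs)

lemma abs_Te_le: "f \<in> dom \<Longrightarrow> \<bar>Te f\<bar> \<le> Te \<bar>f\<bar>"
  using Te_mono[of f "\<bar>f\<bar>"] Te_mono[of "- f" "\<bar>f\<bar>"]
  by (auto simp: abs_lattice[of "Te f"] dom_abs dom_minus Te_minus abs_ge_self abs_ge_minus_self)

lemma E_dom: "x \<in> E \<Longrightarrow> x \<in> dom" and Te_E: "x \<in> E \<Longrightarrow> Te x = T x"
proof -
  have *: "x \<in> cone \<and> Tcone x = T x" if x: "x \<in> E" "0 \<le> x" for x
  proof -
    have xb: "x \<in> below x" using x by (simp add: below_def)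
    have b: "\<forall>y\<in>below x. T y \<le> T x" using x by (auto simp: below_def intro: T_mono)
    then have c: "x \<in> cone" using x by (auto simp: cone_iff)
    then show ?thesis using b Tcone_upper[OF c xb] Tcone_least[OF c] by (auto intro: order.antisym)
  qed
  assume x: "x \<in> E"
  have p: "pprt x \<in> E" "pprt (- x) \<in> E"
    using x E_riesz by (auto intro: riesz_subspace_pprt riesz_subspace_minus)
  have "pprt x - pprt (- x) \<in> dom" "Te (pprt x - pprt (- x)) = T (pprt x - pprt (- x))"
    using *[OF p(1)] *[OF p(2)] p by (auto simp: T_diff Te_diff_cone intro: domI)
  then show "x \<in> dom" "Te x = T x" using diff_pprts[of x] by auto
qed

lemma Te_strict:
  assumes f: "f \<in> dom" "0 \<le> f" "Te f \<le> 0"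
  shows "f = 0"
proof -
  have c: "f \<in> cone" using f by (simp add: dom_nonneg_iff)
  have "f \<le> 0"
  proof (rule lub_least[OF lub_below[OF f(2)]])
    fix x assume x: "x \<in> below f"
    have "T x \<le> 0" using Tcone_upper[OF c x] f(3) Te_cone[OF c] by (simp add: order.trans)
    moreover have "0 \<le> T x" using x by (auto simp: below_def intro: T_nonneg)
    ultimately have "x = 0" using T_strict x
      by (auto simp: strictly_positive_on_def below_def order.antisym)
    then show "x \<le> 0" by simp
  qed
  then show ?thesis using f(2) by simp
qed

text \<open>A Fatou property: given a supremum \<open>s\<close> in the ambient space, a bound on the
  expectations puts it in the domain. Elements of \<open>below s\<close> are suprema of the elements
  \<open>inf x d\<close> of \<open>E\<close>, where the order continuity of \<open>T\<close>
  applies.\<close>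

lemma Te_order_continuous:
  assumes D: "up_directed D" "lub D s" "D \<subseteq> dom" "\<And>d. d \<in> D \<Longrightarrow> 0 \<le> d" and u: "\<And>d. d \<in> D \<Longrightarrow> Te d \<le> u"
  shows "s \<in> dom" and "Te s \<le> u"
proof -
  have s: "0 \<le> s" using D by (metis all_not_in_conv lub_upper order.trans up_directed_def)
  have le: "T x \<le> u" if x: "x \<in> below s" for x
  proof -
    have "lub ((\<lambda>d. inf x d) ` D) (inf x s)" by (rule lub_inf[OF D(2)])
    moreover have "inf x s = x" using x by (simp add: below_def inf_absorb1)
    ultimately have l: "lub ((\<lambda>d. inf x d) ` D) x" by simp
    have inE: "inf x d \<in> E" if "d \<in> D" for d
      using that x D(4) E_ideal[of x "inf x d"] by (simp add: below_def)
    show "T x \<le> u"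
    proof (rule T_order_continuous[OF _ _ l])
      show "up_directed (inf x ` D)" by (rule up_directed_image[OF D(1)]) (auto intro: le_infI2)
      show "T d \<le> u" if "d \<in> inf x ` D" for d
      proof -
        obtain c where c: "c \<in> D" "d = inf x c" using \<open>d \<in> inf x ` D\<close> by blast
        have "Te d \<le> Te c" using c inE D(3) E_dom by (intro Te_mono) auto
        then have "Te d \<le> u" using u c(1) by (meson order.trans)
        then show ?thesis using inE c Te_E by simp
      qed
    qed (use inE x in \<open>auto simp: below_def\<close>)
  qed
  then have c: "s \<in> cone" using s by (auto simp: cone_iff)
  then show "s \<in> dom" by (rule cone_dom)
  show "Te s \<le> u" unfolding Te_cone[OF c] by (rule Tcone_least[OF c le])
qed

subsection \<open>Monotone completeness and the range algebra\<close>

lemma bounded_in_E: "0 \<le> x \<Longrightarrow> x \<le> r *\<^sub>R e \<Longrightarrow> x \<in> E"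
  by (rule E_ideal[of "r *\<^sub>R e"]) (simp_all add: riesz_subspace_scaleR[OF E_riesz unit_in_E])

text \<open>The truncations \<open>g n\<close> of the net by multiples of the unit have suprema in \<open>U\<close>.  The set where they
  are no longer cut off increases with \<open>n\<close>, and it exhausts the unit because \<open>Te\<close> of the net is bounded; by
  lateral completeness the values of \<open>g n\<close> on the successive differences can be glued together.\<close>

lemma levi:
  assumes D: "up_directed D" "D \<subseteq> dom" "\<And>d. d \<in> D \<Longrightarrow> 0 \<le> d" and u: "\<And>d. d \<in> D \<Longrightarrow> Te d \<le> u"
  obtains s where "lub D s"
proof -
  have Dne: "D \<noteq> {}" using D(1) by (simp add: up_directed_def)
  have "\<exists>s. lub ((\<lambda>d. inf (real n *\<^sub>R e) d) ` D) s" for n :: nat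
  proof -
    have "inf (real n *\<^sub>R e) ` D \<noteq> {}" using Dne by blast
    then obtain s where "lub ((\<lambda>d. inf (real n *\<^sub>R e) d) ` D) s"
      by (rule lub_exists[of _ "real n *\<^sub>R e"]) auto
    then show ?thesis by blast
  qed
  then obtain g where g: "\<And>n::nat. lub ((\<lambda>d. inf (real n *\<^sub>R e) d) ` D) (g n)" by metis
  have g_le: "g n \<le> real n *\<^sub>R e" for n by (rule lub_least[OF g]) auto
  have g_nonneg: "0 \<le> g n" for n
  proof -
    obtain d where d: "d \<in> D" using Dne by blast
    have "0 \<le> inf (real n *\<^sub>R e) d" using D(3)[OF d] by simp
    also have "\<dots> \<le> g n" by (rule lub_upper[OF g]) (use d in blast)
    finally show ?thesis .
  qed
  have gE: "g n \<in> E" for n using g_nonneg g_le by (rule bounded_in_E)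
  have trunc_dom: "inf (real n *\<^sub>R e) d \<in> dom" if "d \<in> D" for n d
    by (rule E_dom, rule bounded_in_E[of _ "real n"]) (use D(3)[OF that] in simp_all)
  have Tg: "Te (g n) \<le> u" for n
  proof (rule Te_order_continuous(2)[OF _ g])
    show "up_directed (inf (real n *\<^sub>R e) ` D)"
      by (rule up_directed_image[OF D(1)]) (auto intro: le_infI2)
    show "inf (real n *\<^sub>R e) ` D \<subseteq> dom" using trunc_dom by blast
    fix x assume "x \<in> inf (real n *\<^sub>R e) ` D"
    then obtain d where d: "d \<in> D" "x = inf (real n *\<^sub>R e) d" by blast
    show "0 \<le> x" using d D(3) by simp
    have "Te x \<le> Te d" unfolding d(2) using d(1) D(2) trunc_dom by (intro Te_mono) auto
    then show "Te x \<le> u" using u[OF d(1)] by (rule order.trans)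
  qed
  have g_trunc: "g n = inf (real n *\<^sub>R e) (g m)" if "n \<le> m" for n m
  proof (rule lub_unique[OF g])
    have "lub ((\<lambda>d. inf (real n *\<^sub>R e) d) ` ((\<lambda>d. inf (real m *\<^sub>R e) d) ` D)) (inf (real n *\<^sub>R e) (g m))"
      by (rule lub_inf[OF g])
    moreover have "real n *\<^sub>R e \<le> real m *\<^sub>R e" using that by (intro scaleR_right_mono) auto
    then have "inf (real n *\<^sub>R e) (inf (real m *\<^sub>R e) d) = inf (real n *\<^sub>R e) d" for d
      by (simp add: inf.assoc[symmetric] inf_absorb1)
    ultimately show "lub (inf (real n *\<^sub>R e) ` D) (inf (real n *\<^sub>R e) (g m))"
      by (simp add: image_image)
  qed
  have g_mono: "g n \<le> g m" if "n \<le> m" for n m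
    using g_trunc[OF that] by (metis inf_le2)
  \<comment> \<open>In a function space \<open>p n\<close> is the indicator of the set where
    \<open>g n\<close> stays below \<open>n\<close>.\<close>
  have "\<exists>p. 0 \<le> p \<and> p \<le> e \<and> p * (real n *\<^sub>R e - g n) = real n *\<^sub>R e - g n \<and> p * p = p \<and>
      (\<forall>v. 0 \<le> v \<longrightarrow> (real n *\<^sub>R e - g n) * v = 0 \<longrightarrow> p * v = 0)" for n
    by (rule support_exists[of "real n *\<^sub>R e - g n"]) (use g_le in auto)
  then obtain p where p: "\<And>n. 0 \<le> p n" "\<And>n. p n \<le> e"
      "\<And>n. p n * (real n *\<^sub>R e - g n) = real n *\<^sub>R e - g n" "\<And>n. p n * p n = p n"
      "\<And>n v. 0 \<le> v \<Longrightarrow> (real n *\<^sub>R e - g n) * v = 0 \<Longrightarrow> p n * v = 0"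
    by metis
  have gap: "real n *\<^sub>R e - g n = pprt (real n *\<^sub>R e - g m)" if "n \<le> m" for n m
    unfolding g_trunc[OF that] by (rule trunc_diff)
  have p_g: "p n * g m = p n * g n" if "n \<le> m" for n m
  proof -
    have "g m - g n = pprt (g m - real n *\<^sub>R e)"
      unfolding g_trunc[OF that] by (metis inf_commute trunc_diff)
    then have "(real n *\<^sub>R e - g n) * (g m - g n) = 0"
      unfolding gap[OF that] using pprt_mult_pprt_neg[of "real n *\<^sub>R e - g m"] by simp
    then have "p n * (g m - g n) = 0" using g_mono[OF that] by (intro p(5)) auto
    then show ?thesis by (simp add: right_diff_distrib)
  qed
  have p_p: "p n * p m = p n" if "n \<le> m" for n m
  proof -
    have em: "0 \<le> e - p m" using p(2) by simp
    have "real n *\<^sub>R e - g n \<le> real m *\<^sub>R e - g m"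
    proof -
      have "real n *\<^sub>R e - g m \<le> real m *\<^sub>R e - g m"
        using that by (intro diff_right_mono scaleR_right_mono) auto
      then show ?thesis unfolding gap[OF that] using g_le[of m] by (intro pprt_le) simp_all
    qed
    then have "(real n *\<^sub>R e - g n) * (e - p m) \<le> (real m *\<^sub>R e - g m) * (e - p m)"
      using em by (rule mult_right_mono)
    also have "\<dots> = (real m *\<^sub>R e - g m) - p m * (real m *\<^sub>R e - g m)"
      by (simp only: right_diff_distrib unit_right commute[of "real m *\<^sub>R e - g m" "p m"])
    also have "\<dots> = 0" by (simp only: p(3) diff_self)
    finally have "(real n *\<^sub>R e - g n) * (e - p m) \<le> 0" .
    moreover have "0 \<le> (real n *\<^sub>R e - g n) * (e - p m)"
      using em g_le by (intro mult_nonneg_nonneg) simp_all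
    ultimately have "p n * (e - p m) = 0" using em by (intro p(5) order.antisym)
    then show ?thesis by (simp add: right_diff_distrib)
  qed
  have p_mono: "p n \<le> p m" if "n \<le> m" for n m
  proof -
    have "p n * p m \<le> e * p m" using p by (intro mult_right_mono) auto
    then show ?thesis using p_p[OF that] by simp
  qed
  have p0: "p 0 = 0"
    using p(5)[of e 0] g_le[of 0] g_nonneg[of 0] by (simp add: order.antisym)
  \<comment> \<open>The layer on which truncation at \<open>n + 1\<close> no longer cuts off but
    truncation at \<open>n\<close> does. The layers are disjoint, so lateral completeness applies to
    the pieces supported on them.\<close>
  define q where "q n = p (Suc n) - p n" for n
  have q_nonneg: "0 \<le> q n" for n using p_mono[of n "Suc n"] by (simp add: q_def)
  have q_p: "q n * p m = q n" if "n < m" for n m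
    using p_p[of "Suc n" m] p_p[of n m] that by (simp add: q_def left_diff_distrib)
  have q_q: "q n * q m = 0" if "n < m" for n m
    using q_p[of n "Suc m"] q_p[of n m] that unfolding q_def[of m] by (simp only: right_diff_distrib) simp
  have q_idem: "q n * q n = q n"
    for n using p_p[of n "Suc n"] p(4)[of n] p(4)[of "Suc n"]
    by (simp add: q_def algebra_simps commute[of "p (Suc n)" "p n"])
  let ?H = "range (\<lambda>n. q n * g (Suc n))"
  have "\<exists>h. lub ?H h"
  proof -
    have "\<forall>x\<in>?H. \<forall>y\<in>?H. x \<noteq> y \<longrightarrow> inf x y = 0"
    proof (intro ballI impI)
      fix x y assume "x \<in> ?H" "y \<in> ?H" "x \<noteq> y"
      then obtain n m where nm: "x = q n * g (Suc n)" "y = q m * g (Suc m)" "n \<noteq> m" by blast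
      have "q n * q m = 0" using nm(3) q_q[of n m] q_q[of m n] by (metis commute nat_neq_iff)
      then have "x * y = 0" unfolding nm
        by (metis commute left_commute mult_zero_right)
      then show "inf x y = 0" using nm q_nonneg g_nonneg by (subst inf_eq_0_iff) auto
    qed
    moreover have "\<forall>x\<in>?H. 0 \<le> x" using q_nonneg g_nonneg by auto
    ultimately show ?thesis using lateral unfolding laterally_complete_def by blast
  qed
  then obtain h where h: "lub ?H h" by blast
  have h_upper: "q n * g (Suc n) \<le> h" for n by (rule lub_upper[OF h]) blast
  have h_nonneg: "0 \<le> h" using h_upper[of 0] q_nonneg[of 0] g_nonneg[of 1]
    by (metis One_nat_def mult_nonneg_nonneg order.trans)
  \<comment> \<open>On layer \<open>i\<close> the truncations from \<open>Suc i\<close> onwards all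
    agree, so the glued element dominates every \<open>g m\<close> there.\<close>
  have q_h: "q i * g m \<le> q i * h" for i m
  proof -
    have "q i * g m \<le> q i * g (Suc i)"
    proof (cases "Suc i \<le> m")
      case True
      have "q i * g m = q i * (p (Suc i) * g m)" using q_p[of i "Suc i"] by (simp add: mult.assoc[symmetric])
      also have "\<dots> = q i * g (Suc i)"
        unfolding p_g[OF True] using q_p[of i "Suc i"] by (simp add: mult.assoc[symmetric])
      finally show ?thesis by simp
    qed (use q_nonneg g_mono in \<open>auto intro!: mult_left_mono\<close>)
    also have "\<dots> = q i * (q i * g (Suc i))" using q_idem by (simp add: mult.assoc[symmetric])
    also have "\<dots> \<le> q i * h" using q_nonneg h_upper by (intro mult_left_mono)
    finally show ?thesis .
  qed
  have p_h: "p N * g m \<le> p N * h" for N m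
  proof (induction N)
    case (Suc N)
    have "p (Suc N) = p N + q N" by (simp add: q_def)
    then show ?case using Suc q_h[of N m] by (simp add: distrib_right add_mono)
  qed (simp add: p0)
  have p_exhausts: "lub (range p) e"
  proof -
    obtain r where r: "lub (range p) r" using lub_exists[of "range p" e] p(2) by blast
    have re: "0 \<le> e - r" using lub_least[OF r] p(2) by auto
    have r0: "0 \<le> r" using lub_upper[OF r] p(1) by (meson order.trans rangeI)
    have erE: "e - r \<in> E" by (rule bounded_in_E[of _ 1]) (use re r0 in auto)
    \<comment> \<open>Off \<open>p n\<close> the value of \<open>g n\<close> is exactly
      \<open>n\<close>. Hence \<open>real n *\<^sub>R (e - r)\<close> is below \<open>g n\<close>,
      whose expectation is bounded by \<open>u\<close> independently of \<open>n\<close>.\<close>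
    have "real n *\<^sub>R Te (e - r) \<le> u" for n
    proof -
      have "p n \<le> r" by (rule lub_upper[OF r]) blast
      then have "real n *\<^sub>R (e - r) \<le> real n *\<^sub>R (e - p n)" by (intro scaleR_left_mono) simp_all
      also have "\<dots> = (e - p n) * g n"
      proof -
        have "(e - p n) * (real n *\<^sub>R e - g n) = 0"
          by (simp only: left_diff_distrib unit_left p(3) diff_self)
        then show ?thesis by (simp only: right_diff_distrib right_minus_eq mult_scaleR_right unit_right)
      qed
      also have "\<dots> \<le> e * g n" using p g_nonneg by (intro mult_right_mono) simp_all
      finally have "real n *\<^sub>R (e - r) \<le> g n" by simp
      then have "Te (real n *\<^sub>R (e - r)) \<le> Te (g n)"
        using erE gE by (intro Te_mono dom_scaleR E_dom)
      then show ?thesis using Tg[of n] erE by (simp add: Te_scaleR E_dom order.trans)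
    qed
    then have "Te (e - r) \<le> 0" by (rule arch_nat)
    then have "e - r = 0" using erE re by (intro Te_strict E_dom)
    then show ?thesis using r by simp
  qed
  have g_h: "g m \<le> h" for m
  proof -
    have "up_directed (UNIV :: nat set)"
      unfolding up_directed_def by (metis UNIV_I empty_iff max.cobounded1 max.cobounded2)
    then have "up_directed (range p)" using p_mono by (rule up_directed_image)
    then have "lub ((\<lambda>d. g m * d) ` range p) (g m * e)"
      using p_exhausts g_nonneg by (rule lub_mult)
    then have "g m * e \<le> h"
    proof (rule lub_least)
      fix x assume "x \<in> (*) (g m) ` range p"
      then obtain n where "x = g m * p n" by blast
      then have "x \<le> p n * h" using p_h by (simp add: commute)
      also have "\<dots> \<le> e * h" using p h_nonneg by (intro mult_right_mono)
      finally show "x \<le> h" by simp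
    qed
    then show ?thesis by simp
  qed
  have "d \<le> h" if d: "d \<in> D" for d
  proof (rule lub_least[OF lub_truncations[of d]])
    fix x assume "x \<in> range (\<lambda>n::nat. inf d (real n *\<^sub>R e))"
    then obtain n :: nat where "x = inf (real n *\<^sub>R e) d" by (auto simp: inf_commute)
    then have "x \<le> g n" using lub_upper[OF g] d by blast
    then show "x \<le> h" using g_h by (rule order.trans)
  qed
  then show ?thesis using lub_exists[OF Dne, of h] that by blast
qed

section \<open>Idempotence of the extension and closure properties of its range\<close>

lemma Te_cone_idem:
  assumes f: "f \<in> cone"
  shows "Te f \<in> dom" and "Te (Te f) = Te f"
proof -
  have l: "lub (T ` below f) (Te f)" using Tcone_lub[OF f] Te_cone[OF f] by simp
  have dir: "up_directed (T ` below f)"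
  proof (rule up_directed_image)
    show "up_directed (below f)"
      using net_below f unfolding cone_iff approximating_net_def by blast
  qed (auto simp: below_def intro: T_mono)
  have TT: "Te (T x) = T x" if "x \<in> below f" for x
    using that by (simp add: below_def Te_E T_in_E T_idem)
  have sub: "T ` below f \<subseteq> dom" by (auto simp: below_def intro!: E_dom T_in_E)
  have nonneg: "0 \<le> y" if "y \<in> T ` below f" for y
    using that by (auto simp: below_def intro!: T_nonneg)
  have bound: "Te y \<le> Te f" if "y \<in> T ` below f" for y
    using that lub_upper[OF l that] TT by auto
  note 1 = Te_order_continuous[OF dir l sub nonneg bound]
  have "Te f \<le> Te (Te f)"
  proof (rule lub_least[OF l])
    fix y assume y: "y \<in> T ` below f"
    have "Te y \<le> Te (Te f)"
      using y 1(1) lub_upper[OF l y] by (intro Te_mono) (auto simp: below_def intro!: E_dom T_in_E)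
    then show "y \<le> Te (Te f)" using y TT by auto
  qed
  then show "Te f \<in> dom" "Te (Te f) = Te f" using 1 by (simp_all add: order.antisym)
qed

lemma Te_dom: "f \<in> dom \<Longrightarrow> Te f \<in> dom" and Te_idem: "f \<in> dom \<Longrightarrow> Te (Te f) = Te f"
proof -
  assume fd: "f \<in> dom"
  then obtain f1 f2 where f: "f1 \<in> cone" "f2 \<in> cone" "f = f1 - f2" unfolding L1_def by blast
  note 1 = Te_cone_idem[OF f(1)] and 2 = Te_cone_idem[OF f(2)]
  have eq: "Te f = Te f1 - Te f2" unfolding f(3) by (rule Te_diff[OF cone_dom[OF f(1)] cone_dom[OF f(2)]])
  show "Te f \<in> dom" unfolding eq by (rule dom_diff[OF 1(1) 2(1)])
  show "Te (Te f) = Te f" unfolding eq Te_diff[OF 1(1) 2(1)] 1(2) 2(2) ..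
qed

lemma A_iff: "a \<in> A \<longleftrightarrow> a \<in> dom \<and> Te a = a"
proof
  assume "a \<in> A"
  then show "a \<in> dom \<and> Te a = a" by (auto simp: range_alg_def Te_dom Te_idem)
next
  assume "a \<in> dom \<and> Te a = a"
  then show "a \<in> A" unfolding range_alg_def by (intro image_eqI[of _ _ a]) simp_all
qed

lemma A_dom: "a \<in> A \<Longrightarrow> a \<in> dom"
  by (simp add: A_iff)

lemma Te_A: "f \<in> dom \<Longrightarrow> Te f \<in> A"
  by (simp add: range_alg_def)

lemma Te_fixes_A: "a \<in> A \<Longrightarrow> Te a = a"
  by (simp add: A_iff)

lemma unit_A: "e \<in> A"
  using unit_in_E by (simp add: A_iff E_dom Te_E T_unit)

text \<open>\<open>Te s - s\<close> is nonnegative with expectation zero. Suprema and moduli of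
  fixed points satisfy the premise by monotonicity, and this gives the closure properties of
  \<open>A\<close>.\<close>

lemma A_if_le_Te: "s \<in> dom \<Longrightarrow> s \<le> Te s \<Longrightarrow> s \<in> A"
  using Te_strict[of "Te s - s"] by (simp add: A_iff Te_dom Te_idem dom_diff Te_diff)

lemma A_lub:
  assumes "F \<subseteq> A" "lub F s" "s \<in> dom"
  shows "s \<in> A"
proof (rule A_if_le_Te[OF assms(3)], rule lub_least[OF assms(2)])
  fix f assume f: "f \<in> F"
  have "Te f \<le> Te s" using f assms A_dom lub_upper[OF assms(2) f] by (intro Te_mono) auto
  then show "f \<le> Te s" using f assms(1) Te_fixes_A by auto
qed

lemma A_add: "a \<in> A \<Longrightarrow> b \<in> A \<Longrightarrow> a + b \<in> A"
  and A_diff: "a \<in> A \<Longrightarrow> b \<in> A \<Longrightarrow> a - b \<in> A"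
  and A_scaleR: "a \<in> A \<Longrightarrow> r *\<^sub>R a \<in> A"
  by (simp_all add: A_iff dom_add Te_add dom_diff Te_diff dom_scaleR Te_scaleR)

lemma A_0: "0 \<in> A"
  using A_scaleR[OF unit_A, of 0] by simp

lemma A_abs: "a \<in> A \<Longrightarrow> \<bar>a\<bar> \<in> A"
  using abs_Te_le[of a] by (intro A_if_le_Te) (auto simp: A_iff dom_abs)

lemma A_pprt: "a \<in> A \<Longrightarrow> pprt a \<in> A"
proof -
  assume a: "a \<in> A"
  have "a + \<bar>a\<bar> = (pprt a - pprt (- a)) + (pprt a + pprt (- a))"
    by (simp only: abs_pprts diff_pprts[symmetric])
  then have "a + \<bar>a\<bar> = 2 *\<^sub>R pprt a" by (simp add: scaleR_2)
  then have "pprt a = (1 / 2) *\<^sub>R (a + \<bar>a\<bar>)" by simp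
  then show ?thesis using a by (simp only: A_add A_abs A_scaleR)
qed

lemma A_inf: "a \<in> A \<Longrightarrow> b \<in> A \<Longrightarrow> inf a b \<in> A"
  unfolding inf_eq_diff_pprt by (intro A_diff A_pprt)

lemma A_sup: "a \<in> A \<Longrightarrow> b \<in> A \<Longrightarrow> sup a b \<in> A"
  unfolding sup_eq_add_pprt by (intro A_add A_diff A_pprt)

lemma A_riesz: "riesz_subspace A"
  by (simp add: riesz_subspace_def real_vector.subspace_def A_0 A_add A_scaleR A_inf A_sup)

section \<open>The averaging property\<close>

lemma averaging_bounded:
  assumes a: "a \<in> A" and f: "0 \<le> f" "f \<le> C *\<^sub>R e" "0 < C"
  shows "a * f \<in> dom" and "Te (a * f) = a * Te f"
proof -
  have le: "\<bar>b * f\<bar> \<le> C *\<^sub>R \<bar>b\<bar>" for b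
  proof -
    have "\<bar>b * f\<bar> \<le> \<bar>b\<bar> * \<bar>f\<bar>" by (rule abs_le_mult)
    also have "\<dots> \<le> \<bar>b\<bar> * (C *\<^sub>R e)" using f by (intro mult_left_mono) simp_all
    finally show ?thesis by simp
  qed
  have dm: "b * f \<in> dom" if "b \<in> A" for b
  proof (rule dom_ideal)
    show "C *\<^sub>R \<bar>b\<bar> \<in> dom" using that by (intro dom_scaleR dom_abs A_dom)
  qed (rule le)
  then show "a * f \<in> dom" using a .
  have fd: "f \<in> dom" using bounded_in_E[OF f(1,2)] by (rule E_dom)
  have Tf: "0 \<le> Te f" "Te f \<le> C *\<^sub>R e"
    using Te_nonneg[OF fd f(1)] Te_mono[OF fd _ f(2)] A_scaleR[OF unit_A, of C]
    by (auto simp: A_iff)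
  have "Te (a * f) - a * Te f = 0"
  proof (rule zero_if_dominated[OF A_riesz unit_A, where C = "2 * C" and \<rho> = "\<lambda>b. Te (b * f) - b * Te f"])
    fix b assume b: "b \<in> A"
    have "\<bar>Te (b * f)\<bar> \<le> Te \<bar>b * f\<bar>" using dm[OF b] by (rule abs_Te_le)
    also have "\<dots> \<le> Te (C *\<^sub>R \<bar>b\<bar>)"
      using b by (intro Te_mono le dom_abs dom_scaleR dm A_dom)
    also have "\<dots> = C *\<^sub>R \<bar>b\<bar>" using b by (intro Te_fixes_A A_scaleR A_abs)
    finally have 1: "\<bar>Te (b * f)\<bar> \<le> C *\<^sub>R \<bar>b\<bar>" .
    have "\<bar>b * Te f\<bar> \<le> \<bar>b\<bar> * \<bar>Te f\<bar>" by (rule abs_le_mult)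
    also have "\<dots> \<le> \<bar>b\<bar> * (C *\<^sub>R e)" using Tf by (intro mult_left_mono) auto
    finally have 2: "\<bar>b * Te f\<bar> \<le> C *\<^sub>R \<bar>b\<bar>" by simp
    have "\<bar>Te (b * f) - b * Te f\<bar> \<le> \<bar>Te (b * f)\<bar> + \<bar>b * Te f\<bar>" by (rule abs_triangle_ineq4)
    also have "\<dots> \<le> C *\<^sub>R \<bar>b\<bar> + C *\<^sub>R \<bar>b\<bar>" using 1 2 by (rule add_mono)
    also have "\<dots> = (2 * C) *\<^sub>R \<bar>b\<bar>" by (simp add: scaleR_2[symmetric])
    finally show "\<bar>Te (b * f) - b * Te f\<bar> \<le> (2 * C) *\<^sub>R \<bar>b\<bar>" .
  qed (use a f(3) dm in \<open>simp_all add: distrib_right Te_add Te_scaleR scaleR_diff_right\<close>)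
  then show "Te (a * f) = a * Te f" by simp
qed

text \<open>Passes from the bounded truncations of \<open>f\<close> to \<open>f\<close>, since
  multiplication by \<open>a\<close> and \<open>Te\<close> both preserve their supremum.\<close>

lemma averaging_nonneg:
  assumes a: "a \<in> A" "0 \<le> a" and f: "f \<in> dom" "0 \<le> f"
  shows "a * f \<in> dom" and "Te (a * f) = a * Te f"
proof -
  let ?D = "range (\<lambda>n::nat. inf f (real n *\<^sub>R e))"
  let ?aD = "(\<lambda>d. a * d) ` ?D"
  have l: "lub ?aD (a * f)"
    by (rule lub_mult[OF up_directed_truncations lub_truncations a(2)])
  have dir: "up_directed ?aD"
    by (rule up_directed_image[OF up_directed_truncations]) (rule mult_left_mono[OF _ a(2)])
  have d: "0 \<le> d \<and> a * d \<in> dom \<and> Te (a * d) = a * Te d \<and> d \<le> f \<and> d \<in> dom" if dD: "d \<in> ?D" for d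
  proof -
    obtain n :: nat where n: "d = inf f (real n *\<^sub>R e)" using dD by blast
    have d0: "0 \<le> d" using f(2) by (simp add: n)
    have "d \<le> real n *\<^sub>R e" by (simp add: n)
    also have "\<dots> \<le> (real n + 1) *\<^sub>R e" by (intro scaleR_right_mono) auto
    finally have "d \<le> (real n + 1) *\<^sub>R e" .
    from averaging_bounded[OF a(1) d0 this] bounded_in_E[OF d0 this] d0 show ?thesis
      by (simp add: n E_dom)
  qed
  note d_nonneg = d[THEN conjunct1]
    and ad_dom = d[THEN conjunct2, THEN conjunct1]
    and ad_eq = d[THEN conjunct2, THEN conjunct2, THEN conjunct1]
    and d_le = d[THEN conjunct2, THEN conjunct2, THEN conjunct2, THEN conjunct1]
    and d_dom = d[THEN conjunct2, THEN conjunct2, THEN conjunct2, THEN conjunct2]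
  have D_dom: "?D \<subseteq> dom" by (rule subsetI) (rule d_dom)
  have Td_le: "Te c \<le> Te f" if "c \<in> ?D" for c
    by (rule Te_mono[OF d_dom f(1) d_le]) (rule that)+
  have le: "Te x \<le> a * Te f" "0 \<le> x" "x \<in> dom" if xD: "x \<in> ?aD" for x
  proof -
    obtain c where c: "c \<in> ?D" "x = a * c" using xD by (rule imageE)
    show "Te x \<le> a * Te f" unfolding c(2) ad_eq[OF c(1)] by (rule mult_left_mono[OF Td_le[OF c(1)] a(2)])
    show "0 \<le> x" unfolding c(2) by (rule mult_nonneg_nonneg[OF a(2) d_nonneg[OF c(1)]])
    show "x \<in> dom" unfolding c(2) by (rule ad_dom[OF c(1)])
  qed
  have aD_dom: "?aD \<subseteq> dom" by (rule subsetI) (rule le(3))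
  note 1 = Te_order_continuous[OF dir l aD_dom le(2) le(1)]
  show "a * f \<in> dom" by (rule 1)
  have "lub (Te ` ?D) (Te f)"
  proof (rule lubI)
    fix y assume "y \<in> Te ` ?D"
    then obtain c where c: "c \<in> ?D" "y = Te c" by (rule imageE)
    then show "y \<le> Te f" by (simp only: Td_le)
  next
    fix u assume u: "\<And>y. y \<in> Te ` ?D \<Longrightarrow> y \<le> u"
    show "Te f \<le> u"
      by (rule Te_order_continuous(2)[OF up_directed_truncations lub_truncations D_dom d_nonneg u])
        (assumption | rule imageI)+
  qed
  moreover have "up_directed (Te ` ?D)"
    by (rule up_directed_image[OF up_directed_truncations]) (rule Te_mono[OF d_dom d_dom])
  ultimately have la: "lub ((\<lambda>y. a * y) ` Te ` ?D) (a * Te f)" using a(2) by (intro lub_mult)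
  have "a * Te f \<le> Te (a * f)"
  proof (rule lub_least[OF la])
    fix y assume "y \<in> (*) a ` Te ` ?D"
    then obtain t where t: "t \<in> Te ` ?D" "y = a * t" by (rule imageE)
    obtain c where c: "c \<in> ?D" "t = Te c" using t(1) by (rule imageE)
    have "Te (a * c) \<le> Te (a * f)"
      by (rule Te_mono[OF ad_dom[OF c(1)] 1(1) mult_left_mono[OF d_le[OF c(1)] a(2)]])
    then show "y \<le> Te (a * f)" by (simp only: t(2) c(2) ad_eq[OF c(1)])
  qed
  then show "Te (a * f) = a * Te f" using 1(2) by simp
qed

lemma dom_mult_A: "a \<in> A \<Longrightarrow> f \<in> dom \<Longrightarrow> a * f \<in> dom"
  and averaging: "a \<in> A \<Longrightarrow> f \<in> dom \<Longrightarrow> Te (a * f) = a * Te f"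
proof -
  assume a: "a \<in> A" and f: "f \<in> dom"
  have *: "b * f \<in> dom \<and> Te (b * f) = b * Te f" if b: "b \<in> A" "0 \<le> b" for b
  proof -
    have p: "pprt f \<in> dom" "pprt (- f) \<in> dom" using f by (auto intro: dom_pprt dom_minus)
    have "b * (pprt f - pprt (- f)) \<in> dom \<and> Te (b * (pprt f - pprt (- f))) = b * Te (pprt f - pprt (- f))"
      using averaging_nonneg[OF b p(1)] averaging_nonneg[OF b p(2)] p
      by (simp add: right_diff_distrib dom_diff Te_diff)
    then show ?thesis using diff_pprts[of f] by simp
  qed
  have p: "pprt a \<in> A" "pprt (- a) \<in> A"
    using a A_pprt A_scaleR[of a "-1"] by auto
  have "(pprt a - pprt (- a)) * f \<in> dom \<and> Te ((pprt a - pprt (- a)) * f) = (pprt a - pprt (- a)) * Te f"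
    using *[OF p(1)] *[OF p(2)] by (simp add: left_diff_distrib dom_diff Te_diff)
  then show "a * f \<in> dom" "Te (a * f) = a * Te f" using diff_pprts[of a] by auto
qed

lemma A_mult: "a \<in> A \<Longrightarrow> b \<in> A \<Longrightarrow> a * b \<in> A"
  using dom_mult_A[of a b] averaging[of a b] by (simp add: A_iff)

text \<open>The square root of \<open>b\<close> is the largest \<open>r\<close> with \<open>r * r \<le> b\<close>: where the supremum \<open>s\<close> is below
  \<open>N * e\<close>, it could otherwise be increased by a multiple of the gap.\<close>

lemma A_sqrt:
  assumes b: "b \<in> A" "0 \<le> b"
  obtains s where "s \<in> A" "0 \<le> s" "s * s = b"
proof -
  let ?D = "{r \<in> A. 0 \<le> r \<and> r * r \<le> b}"
  \<comment> \<open>The square of \<open>e + b\<close> contains the term \<open>b\<close>, so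
    \<open>e + b\<close> bounds all candidates for the root.\<close>
  have le: "r \<le> e + b" if "r \<in> ?D" for r
  proof (rule square_le_imp_le)
    have "r * r \<le> b" using that by simp
    also have "b \<le> (e + b) * (e + b)" using b(2) by (simp add: algebra_simps)
    finally show "r * r \<le> (e + b) * (e + b)" .
  qed (use b in simp)
  have zero: "0 \<in> ?D" using b A_0 by simp
  then obtain s where s: "lub ?D s" using lub_exists[of ?D "e + b"] le by blast
  have s0: "0 \<le> s" by (rule lub_upper[OF s zero])
  have s_le: "s \<le> e + b" using le by (rule lub_least[OF s])
  have s_dom: "s \<in> dom" by (rule dom_ideal[of "e + b"]) (use s0 s_le b unit_A in \<open>auto intro: A_dom A_add\<close>)
  have sA: "s \<in> A" by (rule A_lub[OF _ s s_dom]) blast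
  have dir: "up_directed ?D"
    unfolding up_directed_def
  proof (intro conjI ballI)
    show "?D \<noteq> {}" using zero by blast
    fix x y assume x: "x \<in> ?D" and y: "y \<in> ?D"
    \<comment> \<open>Shows that the square of \<open>sup x y\<close> is the supremum of the
      squares. In \<open>(x + y) * pprt (x - y)\<close> the sum is rewritten as \<open>x - y\<close>
      plus twice \<open>y\<close>, and the negative part of \<open>x - y\<close> is
      annihilated.\<close>
    have z: "pprt (x - y) * pprt (x - y) + 2 *\<^sub>R (y * pprt (x - y)) = pprt (x * x - y * y)"
    proof -
      have "pprt (x * x - y * y) = pprt ((x + y) * (x - y))"
        by (simp add: algebra_simps commute[of y x])
      also have "\<dots> = (x + y) * pprt (x - y)" using x y by (simp add: mult_pprt)
      also have "x + y = pprt (x - y) - pprt (- (x - y)) + 2 *\<^sub>R y"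
        unfolding diff_pprts[of "x - y", symmetric] by (simp add: scaleR_2)
      also have "\<dots> * pprt (x - y) = pprt (x - y) * pprt (x - y) + 2 *\<^sub>R (y * pprt (x - y))"
        by (simp only: distrib_right left_diff_distrib pprt_neg_mult_pprt mult_scaleR_left diff_zero)
      finally show ?thesis by simp
    qed
    have "sup x y * sup x y = y * y + pprt (x * x - y * y)"
      unfolding sup_eq_add_pprt z[symmetric] by (simp add: algebra_simps scaleR_2 commute[of "pprt (x - y)" y])
    also have "\<dots> = sup (x * x) (y * y)" by (simp add: sup_eq_add_pprt)
    also have "\<dots> \<le> b" using x y by simp
    finally have "sup x y \<in> ?D" using x y by (auto intro: A_sup le_supI1)
    then show "\<exists>z\<in>?D. x \<le> z \<and> y \<le> z" by (intro bexI[of _ "sup x y"]) auto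
  qed
  have ssb: "s * s \<le> b" by (rule lub_least[OF lub_squares[OF dir s]]) auto
  \<comment> \<open>Capping the gap at \<open>e\<close> keeps the increment \<open>t\<close>
    bounded; the gap itself vanishes if \<open>c\<close> does, because \<open>e\<close> is a
    unit.\<close>
  define c where "c = inf (b - s * s) e"
  have c: "0 \<le> c" "c \<le> b - s * s" "c \<le> e" using ssb by (simp_all add: c_def)
  have cA: "c \<in> A" unfolding c_def using b sA unit_A by (intro A_inf A_diff A_mult)
  have "c = 0"
  proof (rule zero_if_mult_truncations[of _ s])
    fix n :: nat
    define N where "N = real n + 1"
    have N: "1 \<le> N" by (simp add: N_def)
    define p where "p = pprt (real n *\<^sub>R e - s)"
    have p0: "0 \<le> p" by (simp add: p_def)
    have p_le: "p \<le> N *\<^sub>R e"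
    proof -
      have "real n *\<^sub>R e - s \<le> real n *\<^sub>R e" using s0 by simp
      also have "\<dots> \<le> N *\<^sub>R e" unfolding N_def by (intro scaleR_right_mono) auto
      finally show ?thesis unfolding p_def using N by (intro pprt_le) simp_all
    qed
    have sp: "s * p \<le> N *\<^sub>R p"
    proof -
      have "0 \<le> pprt (real n *\<^sub>R e - s) * pprt (real n *\<^sub>R e - s)" by simp
      also have "\<dots> = (real n *\<^sub>R e - s) * pprt (real n *\<^sub>R e - s)"
        using diff_pprts[of "real n *\<^sub>R e - s"] pprt_neg_mult_pprt[of "real n *\<^sub>R e - s"]
        by (metis diff_zero left_diff_distrib)
      finally have "s * p \<le> real n *\<^sub>R p" by (simp add: p_def left_diff_distrib)
      also have "\<dots> \<le> N *\<^sub>R p" unfolding N_def by (intro scaleR_right_mono p0) simp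
      finally show ?thesis .
    qed
    \<comment> \<open>Chosen so that the two copies of \<open>s * t\<close> and the term
      \<open>t * t\<close> are each at most a third of \<open>c\<close>; then the square of
      \<open>s + t\<close> exceeds that of \<open>s\<close> by at most \<open>c\<close>.\<close>
    define k where "k = 1 / (3 * N * N)"
    have k: "0 < k" using N by (simp add: k_def)
    define t where "t = k *\<^sub>R (c * p)"
    have t0: "0 \<le> t" using c p0 k by (simp add: t_def)
    have st: "s * t \<le> (1 / 3) *\<^sub>R c"
    proof -
      have "s * t = k *\<^sub>R (c * (s * p))" by (simp add: t_def left_commute)
      also have "\<dots> \<le> k *\<^sub>R (c * (N *\<^sub>R N *\<^sub>R e))"
        using k c N sp scaleR_left_mono[OF p_le, of N]
        by (intro scaleR_left_mono mult_left_mono) (auto intro: order.trans)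
      also have "\<dots> = (1 / 3) *\<^sub>R c" using N by (simp add: k_def)
      finally show ?thesis .
    qed
    have tt: "t * t \<le> (1 / 3) *\<^sub>R c"
    proof -
      have kN: "k * N \<le> 1 / 3" using N by (simp add: k_def field_simps)
      have "c * p \<le> e * (N *\<^sub>R e)" using c p_le p0 by (intro mult_mono) simp_all
      then have "t \<le> (k * N) *\<^sub>R e" unfolding t_def using scaleR_left_mono[of "c * p" "N *\<^sub>R e" k] k by simp
      also have "\<dots> \<le> 1 *\<^sub>R e" using kN by (intro scaleR_right_mono) simp_all
      finally have te: "t \<le> e" by simp
      have "c * p \<le> c * (N *\<^sub>R e)" using c p_le by (intro mult_left_mono)
      then have "t \<le> (k * N) *\<^sub>R c" unfolding t_def using scaleR_left_mono[of "c * p" "N *\<^sub>R c" k] k by simp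
      also have "\<dots> \<le> (1 / 3) *\<^sub>R c" using kN c by (intro scaleR_right_mono)
      finally have tc: "t \<le> (1 / 3) *\<^sub>R c" .
      have "t * t \<le> e * t" using te t0 by (rule mult_right_mono)
      then show ?thesis using tc by simp
    qed
    have "s * t + s * t + t * t \<le> (1 / 3) *\<^sub>R c + (1 / 3) *\<^sub>R c + (1 / 3) *\<^sub>R c"
      by (intro add_mono st tt)
    also have "\<dots> = c" by (simp add: scaleR_add_left[symmetric])
    also have "c \<le> b - s * s" by (rule c)
    finally have "s * s + (s * t + s * t + t * t) \<le> b" by (simp only: le_diff_eq add.commute)
    then have "(s + t) * (s + t) \<le> b" by (simp add: algebra_simps commute[of t s])
    moreover have "s + t \<in> A" unfolding t_def p_def
      by (intro A_add sA A_scaleR A_mult cA A_pprt A_diff unit_A)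
    ultimately have "s + t \<in> ?D" using s0 t0 by simp
    then have "s + t \<le> s" by (rule lub_upper[OF s])
    then have "t = 0" using t0 by (simp add: order.antisym)
    then show "c * pprt (real n *\<^sub>R e - s) = 0" using k by (simp add: t_def p_def)
  qed (rule c)
  then have "(b - s * s) * e = 0" unfolding c_def by (rule mult_eq_0_of_inf)
  then show ?thesis using that sA s0 by simp
qed

subsection \<open>The module \<open>L\<^sup>2(T)\<close>\<close>

abbreviation H :: "'u set" where "H \<equiv> L2 E T"
abbreviation nrm :: "'u \<Rightarrow> 'u" where "nrm \<equiv> T_norm E T"

text \<open>Controls an element by its square: an integrable square implies integrability, and
  bounds on squares give bounds on expectations.\<close>

lemma abs_le_unit_add_square: "\<bar>x\<bar> \<le> e + x * x" for x :: 'u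
proof -
  have "0 \<le> (\<bar>x\<bar> - e) * (\<bar>x\<bar> - e)" by simp
  also have "\<dots> = x * x + e - (\<bar>x\<bar> + \<bar>x\<bar>)" by (simp add: algebra_simps abs_square)
  finally have "\<bar>x\<bar> + \<bar>x\<bar> \<le> e + x * x" by (simp add: algebra_simps)
  moreover have "\<bar>x\<bar> \<le> \<bar>x\<bar> + \<bar>x\<bar>" by simp
  ultimately show ?thesis by (rule order.trans[rotated])
qed

lemma H_iff: "x \<in> H \<longleftrightarrow> x * x \<in> dom"
proof
  assume "x * x \<in> dom"
  moreover have "x \<in> dom"
    by (rule dom_ideal[OF _ abs_le_unit_add_square]) (intro dom_add A_dom unit_A \<open>x * x \<in> dom\<close>)
  ultimately show "x \<in> H" by (simp add: L2_def)
qed (simp add: L2_def)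

lemma H_dom: "x \<in> H \<Longrightarrow> x \<in> dom"
  by (simp add: L2_def)

lemma H_square_dom: "x \<in> H \<Longrightarrow> x * x \<in> dom"
  by (simp add: H_iff)

lemma H_mult_dom:
  assumes "x \<in> H" "y \<in> H"
  shows "x * y \<in> dom"
proof (rule dom_ideal)
  show "x * x + y * y \<in> dom" using assms by (intro dom_add H_square_dom)
  have "0 \<le> (\<bar>x\<bar> - \<bar>y\<bar>) * (\<bar>x\<bar> - \<bar>y\<bar>)" by simp
  also have "\<dots> = x * x + y * y - (\<bar>x\<bar> * \<bar>y\<bar> + \<bar>x\<bar> * \<bar>y\<bar>)"
    by (simp add: algebra_simps abs_square commute[of "\<bar>y\<bar>" "\<bar>x\<bar>"])
  finally have 1: "\<bar>x\<bar> * \<bar>y\<bar> + \<bar>x\<bar> * \<bar>y\<bar> \<le> x * x + y * y" by simp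
  have "\<bar>x * y\<bar> \<le> \<bar>x\<bar> * \<bar>y\<bar>" by (rule abs_le_mult)
  also have "\<dots> \<le> \<bar>x\<bar> * \<bar>y\<bar> + \<bar>x\<bar> * \<bar>y\<bar>" by simp
  also note 1
  finally show "\<bar>x * y\<bar> \<le> x * x + y * y" .
qed

lemma H_add: "x \<in> H \<Longrightarrow> y \<in> H \<Longrightarrow> x + y \<in> H"
  by (subst H_iff) (simp add: distrib_left distrib_right dom_add H_mult_dom)

lemma H_mult_A:
  assumes a: "a \<in> A" and x: "x \<in> H"
  shows "a * x \<in> H"
proof -
  have "(a * x) * (a * x) = (a * a) * (x * x)" by (simp add: mult_acs)
  also have "\<dots> \<in> dom" using a x by (intro dom_mult_A A_mult H_square_dom)
  finally show ?thesis by (simp only: H_iff)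
qed

lemma H_scaleR: "x \<in> H \<Longrightarrow> r *\<^sub>R x \<in> H"
  using H_mult_A[OF A_scaleR[OF unit_A]] by simp

lemma H_minus: "x \<in> H \<Longrightarrow> - x \<in> H"
  by (simp add: H_iff)

lemma H_diff: "x \<in> H \<Longrightarrow> y \<in> H \<Longrightarrow> x - y \<in> H"
  using H_add[of x "- y"] by (simp add: H_minus)

lemma H_ideal: "y \<in> H \<Longrightarrow> 0 \<le> x \<Longrightarrow> x \<le> y \<Longrightarrow> x \<in> H"
proof -
  assume y: "y \<in> H" and x: "0 \<le> x" "x \<le> y"
  have "x * x \<le> y * y" using x by (intro mult_mono) (simp_all add: order.trans[OF x])
  then show "x \<in> H" unfolding H_iff by (intro dom_ideal[OF H_square_dom[OF y]]) simp
qed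

lemma H_abs: "x \<in> H \<Longrightarrow> \<bar>x\<bar> \<in> H"
  by (simp add: H_iff abs_square)

lemma H_pprt: "x \<in> H \<Longrightarrow> pprt x \<in> H"
  by (rule H_ideal[OF H_abs _ pprt_le_abs]) simp_all

lemma H_0: "0 \<in> H"
  by (simp add: H_iff dom_0)

lemma H_bounded: "0 \<le> x \<Longrightarrow> x \<le> e \<Longrightarrow> x \<in> H"
  by (rule H_ideal[of e]) (simp_all add: H_iff A_dom unit_A)

section \<open>The norm with values in \<open>A\<close> and the Cauchy-Schwarz inequality\<close>

lemma nrm:
  assumes x: "x \<in> H"
  shows "nrm x \<in> A" "0 \<le> nrm x" "nrm x * nrm x = Te (x * x)"
proof -
  obtain s where s: "s \<in> A" "0 \<le> s" "s * s = Te (x * x)"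
    by (rule A_sqrt[OF Te_A[OF H_square_dom[OF x]] Te_nonneg[OF H_square_dom[OF x] square_nonneg]])
  have "nrm x = s"
    unfolding T_norm_def
  proof (rule the_equality)
    show "s \<in> A \<and> 0 \<le> s \<and> s * s = Te (x * x)" using s by simp
    fix r assume r: "r \<in> A \<and> 0 \<le> r \<and> r * r = Te (x * x)"
    show "r = s"
    proof (rule order.antisym)
      show "r \<le> s" by (rule square_le_imp_le) (use r s in simp_all)
      show "s \<le> r" by (rule square_le_imp_le) (use r s in simp_all)
    qed
  qed
  then show "nrm x \<in> A" "0 \<le> nrm x" "nrm x * nrm x = Te (x * x)" using s by simp_all
qed

text \<open>By averaging, the norm of \<open>c * x\<close> has the same square as
  \<open>c * nrm x\<close>. This treats the region where a norm vanishes and cannot be divided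
  by.\<close>

lemma mult_eq_0_if_nrm:
  assumes c: "c \<in> A" and x: "x \<in> H" and 0: "c * nrm x = 0"
  shows "c * x = 0"
proof -
  have "(c * x) * (c * x) = (c * c) * (x * x)" by (simp add: mult_acs)
  then have "Te ((c * x) * (c * x)) = (c * c) * (nrm x * nrm x)"
    using c x by (simp only: averaging A_mult H_square_dom nrm)
  also have "\<dots> = (c * nrm x) * (c * nrm x)" by (simp add: mult_acs)
  finally have "Te ((c * x) * (c * x)) \<le> 0" by (simp add: 0)
  then have "(c * x) * (c * x) = 0"
    using H_square_dom[OF H_mult_A[OF c x]] by (intro Te_strict square_nonneg)
  then show ?thesis by (rule square_eq_0)
qed

text \<open>Expanding the square of \<open>Y * x - X * y\<close> only gives
  \<open>B * P \<le> B * B\<close>. The excess \<open>w\<close> of \<open>P\<close> over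
  \<open>B\<close> is annihilated by \<open>B\<close>, a product of norms;
  \<open>mult_eq_0_if_nrm\<close> carries this over first to \<open>y\<close> and then to
  \<open>x\<close>, until \<open>w * P\<close> and finally \<open>w * w\<close> vanish.\<close>

lemma inner_le: 
  assumes x: "x \<in> H" and y: "y \<in> H"
  shows "Te (x * y) \<le> nrm x * nrm y"
proof -
  define X Y P where "X = nrm x" and "Y = nrm y" and "P = Te (x * y)"
  note X = nrm[OF x, folded X_def] and Y = nrm[OF y, folded Y_def]
  have PA: "P \<in> A" unfolding P_def by (rule Te_A[OF H_mult_dom[OF x y]])
  define B where "B = X * Y"
  have B: "B \<in> A" "0 \<le> B" unfolding B_def using X Y by (simp_all add: A_mult)
  define z where "z = Y * x - X * y"
  have zH: "z \<in> H" unfolding z_def using x y X Y by (intro H_diff H_mult_A)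
  have "z * z = (Y * Y) * (x * x) - 2 *\<^sub>R (B * (x * y)) + (X * X) * (y * y)"
    unfolding z_def B_def by (simp add: left_diff_distrib right_diff_distrib mult_acs scaleR_2)
  moreover have YY: "Y * Y \<in> A" and XX: "X * X \<in> A" by (rule A_mult; rule X Y)+
  note xx = H_mult_dom[OF x x] and yy = H_mult_dom[OF y y] and xy = H_mult_dom[OF x y]
  note d = dom_mult_A[OF YY xx] dom_scaleR[OF dom_mult_A[OF B(1) xy], of 2] dom_mult_A[OF XX yy]
  ultimately have "Te (z * z) = (Y * Y) * Te (x * x) - 2 *\<^sub>R (B * P) + (X * X) * Te (y * y)"
    by (simp only: P_def Te_add[OF dom_diff[OF d(1,2)] d(3)] Te_diff[OF d(1,2)]
        Te_scaleR[OF dom_mult_A[OF B(1) xy]] averaging[OF YY xx] averaging[OF B(1) xy] averaging[OF XX yy])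
  also have "\<dots> = 2 *\<^sub>R (B * B - B * P)"
    unfolding X(3)[symmetric] Y(3)[symmetric] B_def by (simp add: scaleR_2 mult_acs algebra_simps)
  finally have "2 *\<^sub>R (B * B - B * P) = Te (z * z)" ..
  also have "0 \<le> Te (z * z)" by (intro Te_nonneg H_square_dom zH square_nonneg)
  finally have BP: "B * P \<le> B * B" using scaleR_le_scaleR_iff[of 2 0 "B * B - B * P"] by simp
  define w where "w = pprt (P - B)"
  have wA: "w \<in> A" unfolding w_def by (intro A_pprt A_diff PA B)
  have w0: "0 \<le> w" by (simp add: w_def)
  have "B * w = pprt (B * P - B * B)" unfolding w_def using B by (simp add: mult_pprt right_diff_distrib)
  then have Bw: "B * w = 0" using BP by simp
  have "(w * X) * Y = B * w" unfolding B_def by (simp only: mult_acs)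
  then have "(w * X) * nrm y = 0" by (simp only: Bw Y_def)
  then have "(w * X) * y = 0" by (rule mult_eq_0_if_nrm[OF A_mult[OF wA X(1)] y])
  moreover have "(w * X) * (x * y) = x * ((w * X) * y)" by (rule left_commute)
  ultimately have "Te ((w * X) * (x * y)) = 0" by (simp only: mult_zero_right Te_0)
  then have wXP: "w * X * P = 0" by (simp only: averaging[OF A_mult[OF wA X(1)] xy] P_def)
  have "(w * P) * X = w * X * P" by (simp only: mult_acs)
  then have "(w * P) * nrm x = 0" by (simp only: wXP X_def[symmetric])
  then have "(w * P) * x = 0" by (rule mult_eq_0_if_nrm[OF A_mult[OF wA PA] x])
  moreover have "(w * P) * (x * y) = ((w * P) * x) * y" by (simp only: mult.assoc)
  ultimately have "Te ((w * P) * (x * y)) = 0" by (simp only: mult_zero_left Te_0)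
  then have "(w * P) * P = 0" by (simp only: averaging[OF A_mult[OF wA PA] xy] P_def[symmetric])
  moreover have "(w * P) * (w * P) = w * ((w * P) * P)" by (rule left_commute)
  ultimately have "(w * P) * (w * P) = 0" by (simp only: mult_zero_right)
  then have wP: "w * P = 0" by (rule square_eq_0)
  have "w * w = pprt (w * P - B * w)"
    using mult_pprt[OF w0, of "P - B"] by (simp add: w_def[symmetric] right_diff_distrib commute[of B])
  then have "w * w = 0" by (simp add: wP Bw)
  then have "w = 0" by (rule square_eq_0)
  then show ?thesis
    unfolding w_def P_def B_def X_def Y_def by (simp add: le_zero_iff_zero_pprt[symmetric])
qed

lemma cauchy_schwarz:
  assumes "x \<in> H" "y \<in> H"
  shows "\<bar>Te (x * y)\<bar> \<le> nrm x * nrm y"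
proof -
  have "nrm (- x) = nrm x" by (simp add: T_norm_def)
  then have "- Te (x * y) \<le> nrm x * nrm y"
    using inner_le[of "- x" y] assms by (simp add: H_minus Te_minus H_mult_dom)
  then show ?thesis using inner_le[OF assms] by (simp add: abs_lattice)
qed

lemma inner_eq_imp_eq:
  assumes z: "z \<in> H" "z' \<in> H" and eq: "\<And>x. x \<in> H \<Longrightarrow> Te (x * z) = Te (x * z')"
  shows "z = z'"
proof -
  have d: "z - z' \<in> H" using z by (rule H_diff)
  have "Te ((z - z') * (z - z')) = 0"
    using eq[OF d] d z by (simp add: right_diff_distrib[of "z - z'"] Te_diff H_mult_dom)
  then have "(z - z') * (z - z') = 0" using H_square_dom[OF d] by (intro Te_strict) simp_all
  then have "z - z' = 0" by (rule square_eq_0)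
  then show ?thesis by simp
qed

subsection \<open>Representation of functionals\<close>

text \<open>A positive additive functional on the positive cone of \<open>H\<close> with a norm
  bound. The bound is squared, so \<open>K\<close> stands for the square of the operator bound and
  no root of it is taken.\<close>

definition dominated :: "'u \<Rightarrow> ('u \<Rightarrow> 'u) \<Rightarrow> bool" where
  "dominated K \<psi> \<longleftrightarrow> K \<in> A \<and> 0 \<le> K \<and>
     (\<forall>x\<in>H. 0 \<le> x \<longrightarrow> \<psi> x \<in> A \<and> 0 \<le> \<psi> x \<and> \<psi> x * \<psi> x \<le> K * Te (x * x)) \<and>
     (\<forall>x\<in>H. \<forall>y\<in>H. 0 \<le> x \<longrightarrow> 0 \<le> y \<longrightarrow> \<psi> (x + y) = \<psi> x + \<psi> y)"

lemma dominatedD: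
  assumes "dominated K \<psi>"
  shows "K \<in> A" "0 \<le> K"
    and "x \<in> H \<Longrightarrow> 0 \<le> x \<Longrightarrow> \<psi> x \<in> A"
    and "x \<in> H \<Longrightarrow> 0 \<le> x \<Longrightarrow> 0 \<le> \<psi> x"
    and "x \<in> H \<Longrightarrow> 0 \<le> x \<Longrightarrow> \<psi> x * \<psi> x \<le> K * Te (x * x)"
    and "x \<in> H \<Longrightarrow> y \<in> H \<Longrightarrow> 0 \<le> x \<Longrightarrow> 0 \<le> y \<Longrightarrow> \<psi> (x + y) = \<psi> x + \<psi> y"
  using assms unfolding dominated_def by auto

lemma dominated_diff:
  assumes \<psi>: "dominated K \<psi>" and xy: "x \<in> H" "y \<in> H" "0 \<le> x" "x \<le> y"
  shows "\<psi> y = \<psi> x + \<psi> (y - x)"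
  using dominatedD(6)[OF \<psi> xy(1) H_diff[OF xy(2,1)] xy(3)] xy(4) by simp

lemma dominated_mono:
  assumes \<psi>: "dominated K \<psi>" and xy: "x \<in> H" "y \<in> H" "0 \<le> x" "x \<le> y"
  shows "\<psi> x \<le> \<psi> y"
  using dominated_diff[OF assms] dominatedD(4)[OF \<psi> H_diff[OF xy(2,1)]] xy(4) by simp

lemma dominated_0: "dominated K \<psi> \<Longrightarrow> \<psi> 0 = 0"
  using dominated_diff[of K \<psi> 0 0] H_0 by simp

text \<open>The quadratic bound transfers order continuity from \<open>Te\<close>. For
  \<open>t = s - d\<close> the square of \<open>\<psi> t\<close> is at most
  \<open>K * Te (t * t)\<close>; replacing one factor \<open>t\<close> by \<open>s\<close> makes
  this bound affine in \<open>d\<close>, with the fixed multiplier \<open>K * s\<close>.\<close>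

lemma dominated_order_continuous:
  assumes \<psi>: "dominated K \<psi>" and D: "up_directed D" "lub D s" "D \<subseteq> H" "\<And>d. d \<in> D \<Longrightarrow> 0 \<le> d"
    and s: "s \<in> H" and u: "\<And>d. d \<in> D \<Longrightarrow> \<psi> d \<le> u"
  shows "\<psi> s \<le> u"
proof -
  obtain d0 where d0: "d0 \<in> D" using D(1) by (auto simp: up_directed_def)
  have s0: "0 \<le> s" using D(4)[OF d0] lub_upper[OF D(2) d0] by (rule order.trans)
  note K = dominatedD(1,2)[OF \<psi>]
  define m where "m = K * s"
  have m: "m \<in> H" "0 \<le> m" unfolding m_def using K s s0 by (simp_all add: H_mult_A)
  define c where "c = pprt (\<psi> s - u)"
  have c0: "0 \<le> c" by (simp add: c_def)
  have bound: "Te (m * d) \<le> Te (m * s) - c * c" if d: "d \<in> D" for d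
  proof -
    have dH: "d \<in> H" "0 \<le> d" "d \<le> s" using d D(3,4) lub_upper[OF D(2) d] by auto
    define t where "t = s - d"
    have t: "t \<in> H" "0 \<le> t" "t \<le> s" unfolding t_def using dH s by (simp_all add: H_diff)
    have "\<psi> s = \<psi> d + \<psi> t" unfolding t_def by (rule dominated_diff[OF \<psi> dH(1) s dH(2,3)])
    then have "\<psi> s - u \<le> \<psi> t" using u[OF d] by (simp add: algebra_simps)
    then have ct: "c \<le> \<psi> t" unfolding c_def using dominatedD(4)[OF \<psi> t(1,2)] by (rule pprt_le)
    have "c * c \<le> \<psi> t * \<psi> t" using ct c0 by (intro mult_mono) (simp_all add: order.trans[OF c0])
    also have "\<dots> \<le> K * Te (t * t)" by (rule dominatedD(5)[OF \<psi> t(1,2)])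
    also have "\<dots> \<le> K * Te (s * t)"
      using K t s by (intro mult_left_mono Te_mono H_mult_dom mult_right_mono)
    also have "\<dots> = Te (m * t)"
      unfolding m_def mult.assoc using K s t by (simp only: averaging H_mult_dom)
    also have "\<dots> = Te (m * s) - Te (m * d)"
      unfolding t_def right_diff_distrib using m s dH by (intro Te_diff H_mult_dom)
    finally show ?thesis by (simp add: algebra_simps)
  qed
  have "Te (m * s) \<le> Te (m * s) - c * c"
  proof (rule Te_order_continuous(2)[OF _ lub_mult[OF D(1,2) m(2)]])
    show "up_directed ((*) m ` D)" by (rule up_directed_image[OF D(1)]) (rule mult_left_mono[OF _ m(2)])
    show "(*) m ` D \<subseteq> dom" using D(3) m by (auto intro!: H_mult_dom)
    show "0 \<le> x" if "x \<in> (*) m ` D" for x using that D(4) m by auto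
    show "Te x \<le> Te (m * s) - c * c" if "x \<in> (*) m ` D" for x using that bound by auto
  qed
  then have "c * c \<le> 0" by simp
  then have "c * c = 0" by (rule order.antisym) simp
  then have "c = 0" by (rule square_eq_0)
  then show ?thesis unfolding c_def by (simp add: le_zero_iff_zero_pprt[symmetric])
qed

text \<open>Locality comes from the bound: by averaging, the bound on the square of
  \<open>b * \<psi> (a * x)\<close> contains the factor \<open>b * a\<close>.\<close>

lemma dominated_component_disjoint:
  assumes \<psi>: "dominated K \<psi>" and a: "a \<in> A" "0 \<le> a" and b: "b \<in> A" "b * a = 0" and x: "x \<in> H" "0 \<le> x"
  shows "b * \<psi> (a * x) = 0"
proof -
  have ax: "a * x \<in> H" "0 \<le> a * x" using a x by (simp_all add: H_mult_A)
  have "(b * \<psi> (a * x)) * (b * \<psi> (a * x)) = (b * b) * (\<psi> (a * x) * \<psi> (a * x))"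
    by (simp add: mult_acs)
  also have "\<dots> \<le> (b * b) * (K * Te ((a * x) * (a * x)))"
    by (intro mult_left_mono dominatedD(5)[OF \<psi> ax] square_nonneg)
  also have "(a * x) * (a * x) = (a * a) * (x * x)" by (simp add: mult_acs)
  also have "Te \<dots> = (a * a) * Te (x * x)" using a x by (intro averaging A_mult H_mult_dom)
  also have "(b * b) * (K * ((a * a) * Te (x * x))) = (b * a) * (b * (K * (a * Te (x * x))))"
    by (simp add: mult_acs)
  finally have "(b * \<psi> (a * x)) * (b * \<psi> (a * x)) = 0"
    unfolding b(2) by (intro order.antisym square_nonneg) simp
  then show ?thesis by (rule square_eq_0)
qed

lemma dominated_component:
  assumes \<psi>: "dominated K \<psi>" and a: "a \<in> A" "0 \<le> a" "a \<le> e" "a * a = a" and x: "x \<in> H" "0 \<le> x"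
  shows "\<psi> (a * x) = a * \<psi> x"
proof -
  have b: "e - a \<in> A" "0 \<le> e - a" "(e - a) * a = 0" "a * (e - a) = 0"
    using a unit_A by (simp_all add: A_diff left_diff_distrib right_diff_distrib)
  have "x = a * x + (e - a) * x" by (simp add: left_diff_distrib)
  then have "\<psi> x = \<psi> (a * x) + \<psi> ((e - a) * x)"
    using dominatedD(6)[OF \<psi>, of "a * x" "(e - a) * x"] a b x by (simp add: H_mult_A)
  then have "a * \<psi> x = a * \<psi> (a * x) + a * \<psi> ((e - a) * x)" by (simp add: distrib_left)
  also have "a * \<psi> ((e - a) * x) = 0" by (rule dominated_component_disjoint[OF \<psi> b(1,2) a(1) b(4) x])
  also have "a * \<psi> (a * x) = \<psi> (a * x)"
    using dominated_component_disjoint[OF \<psi> a(1,2) b(1,3) x] by (simp add: left_diff_distrib)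
  finally show ?thesis by simp
qed

text \<open>If \<open>r Te \<le> \<psi>\<close> held on all of \<open>[0, v]\<close>, then multiplication by \<open>r (v \<and> e)\<close> would give a
  functional below \<open>\<psi>\<close>; otherwise a component of the unit in \<open>A\<close> isolates the failure.\<close>

lemma exists_small:
  assumes \<psi>: "dominated K \<psi>"
    and Z: "\<And>w. w \<in> H \<Longrightarrow> 0 \<le> w \<Longrightarrow> (\<And>x. x \<in> H \<Longrightarrow> 0 \<le> x \<Longrightarrow> Te (x * w) \<le> \<psi> x) \<Longrightarrow> w = 0"
    and v: "v \<in> H" "0 \<le> v" "v \<noteq> 0" and r: "0 < r"
  shows "\<exists>x\<in>H. 0 \<le> x \<and> x \<le> v \<and> x \<noteq> 0 \<and> \<psi> x \<le> r *\<^sub>R Te x"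
proof (rule ccontr)
  assume none: "\<not> ?thesis"
  have 1: "r *\<^sub>R Te x \<le> \<psi> x" if x: "x \<in> H" "0 \<le> x" "x \<le> v" for x
  proof -
    define t where "t = r *\<^sub>R Te x - \<psi> x"
    have tA: "t \<in> A" unfolding t_def
      using x by (intro A_diff A_scaleR Te_A H_dom dominatedD(3)[OF \<psi>])
    obtain a where a: "lub (range (\<lambda>n::nat. inf (real n *\<^sub>R pprt t) e)) a" "0 \<le> a" "a \<le> e"
      "a * pprt t = pprt t" "a * a = a" "\<And>v. 0 \<le> v \<Longrightarrow> pprt t * v = 0 \<Longrightarrow> a * v = 0"
      by (rule support_exists[of "pprt t", OF zero_le_pprt]) blast
    have aA: "a \<in> A"
    proof (rule A_lub[OF _ a(1)])
      show "range (\<lambda>n::nat. inf (real n *\<^sub>R pprt t) e) \<subseteq> A"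
        using tA unit_A by (auto intro!: A_inf A_scaleR A_pprt)
      show "a \<in> dom" by (rule H_dom[OF H_bounded[OF a(2,3)]])
    qed
    have "a * pprt (- t) = 0" by (rule a(6)) (simp_all add: pprt_mult_pprt_neg)
    then have at: "a * t = pprt t"
      using a(4) diff_pprts[of t] by (metis diff_zero right_diff_distrib)
    have ax: "a * x \<in> H" "0 \<le> a * x" using aA x a by (simp_all add: H_mult_A)
    have axv: "a * x \<le> v" using mult_right_mono[OF a(3) x(2)] x(3) by simp
    have eq: "a * t = r *\<^sub>R Te (a * x) - \<psi> (a * x)"
      unfolding t_def using aA x a(2,3,5)
      by (simp add: right_diff_distrib averaging H_dom dominated_component[OF \<psi>])
    then have "\<psi> (a * x) \<le> r *\<^sub>R Te (a * x)" using at zero_le_pprt[of t] by simp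
    then have "a * x = 0" using none ax axv by blast
    then have "pprt t = 0" using eq at by (simp add: Te_0 dominated_0[OF \<psi>])
    then show ?thesis unfolding t_def by (simp add: le_zero_iff_zero_pprt[symmetric])
  qed
  \<comment> \<open>Extends the inequality from \<open>[0, v]\<close> to \<open>[0, n v]\<close> by
    splitting off \<open>inf x v\<close>.\<close>
  have 2: "x \<in> H \<Longrightarrow> 0 \<le> x \<Longrightarrow> x \<le> real n *\<^sub>R v \<Longrightarrow> r *\<^sub>R Te x \<le> \<psi> x" for n :: nat and x
  proof (induction n arbitrary: x)
    case 0
    then have "x = 0" by (simp add: order.antisym)
    then show ?case by (simp add: Te_0 dominated_0[OF \<psi>])
  next
    case (Suc n)
    define y z where "y = inf x v" and "z = pprt (x - v)"
    have x_eq: "x = y + z" unfolding y_def z_def inf_eq_diff_pprt by simp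
    have y: "0 \<le> y" "y \<le> x" "y \<le> v" using Suc.prems v by (simp_all add: y_def)
    have "z \<le> y + z" using y(1) by simp
    then have "z \<le> x" by (simp only: x_eq[symmetric])
    moreover have "0 \<le> z" by (simp add: z_def)
    ultimately have z: "0 \<le> z" "z \<le> x" by blast+
    have "x - v \<le> real n *\<^sub>R v" using Suc.prems(3) by (simp add: algebra_simps)
    then have zn: "z \<le> real n *\<^sub>R v" unfolding z_def using v by (intro pprt_le) simp_all
    have yH: "y \<in> H" and zH: "z \<in> H" using H_ideal[OF Suc.prems(1)] y z by blast+
    have "r *\<^sub>R Te x = r *\<^sub>R Te y + r *\<^sub>R Te z"
      unfolding x_eq by (simp add: Te_add[OF H_dom[OF yH] H_dom[OF zH]] scaleR_add_right)
    also have "\<dots> \<le> \<psi> y + \<psi> z"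
      using 1[OF yH y(1,3)] Suc.IH[OF zH z(1) zn] by (rule add_mono)
    also have "\<dots> = \<psi> x" unfolding x_eq by (rule dominatedD(6)[OF \<psi> yH zH y(1) z(1), symmetric])
    finally show ?case .
  qed
  \<comment> \<open>For a truncation \<open>d\<close> of \<open>x\<close> at \<open>n\<close>, being
    below \<open>v\<close> puts \<open>w * d\<close> under the \<open>n\<close>-th multiple of
    \<open>v\<close>, and being below \<open>e\<close> puts it under \<open>x\<close>.\<close>
  define w where "w = inf v e"
  have w: "0 \<le> w" "w \<le> v" "w \<le> e" "w \<in> H" using v by (auto simp: w_def intro: H_bounded)
  have "r *\<^sub>R w = 0"
  proof (rule Z)
    fix x assume x: "x \<in> H" "0 \<le> x"
    let ?D = "range (\<lambda>n::nat. inf x (real n *\<^sub>R e))"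
    have *: "0 \<le> y \<and> y \<in> dom \<and> Te y \<le> (1 / r) *\<^sub>R \<psi> x" if y: "y \<in> (*) w ` ?D" for y
    proof -
      obtain d where d: "d \<in> ?D" "y = w * d" using y by (rule imageE)
      obtain n :: nat where n: "d = inf x (real n *\<^sub>R e)" using d(1) by (rule imageE)
      have d0: "0 \<le> d" and dx: "d \<le> x" and dn: "d \<le> real n *\<^sub>R e" using x by (simp_all add: n)
      have y0: "0 \<le> y" using w d0 by (simp add: d)
      have "y \<le> v * (real n *\<^sub>R e)" unfolding d using w v d0 dn by (intro mult_mono)
      then have yv: "y \<le> real n *\<^sub>R v" by simp
      have "y \<le> e * x" unfolding d using w x d0 dx by (intro mult_mono) simp_all
      then have yx: "y \<le> x" by simp
      have yH: "y \<in> H" by (rule H_ideal[OF x(1) y0 yx])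
      have "r *\<^sub>R Te y \<le> \<psi> y" by (rule 2[OF yH y0 yv])
      also have "\<dots> \<le> \<psi> x" by (rule dominated_mono[OF \<psi> yH x(1) y0 yx])
      finally have "(1 / r) *\<^sub>R r *\<^sub>R Te y \<le> (1 / r) *\<^sub>R \<psi> x" using r by (intro scaleR_left_mono) simp_all
      then show ?thesis using y0 H_dom[OF yH] r by simp
    qed
    have "Te (w * x) \<le> (1 / r) *\<^sub>R \<psi> x"
    proof (rule Te_order_continuous(2)[OF _ lub_mult[OF up_directed_truncations lub_truncations w(1)]])
      show "up_directed ((*) w ` ?D)"
        by (rule up_directed_image[OF up_directed_truncations]) (rule mult_left_mono[OF _ w(1)])
      show "(*) w ` ?D \<subseteq> dom" by (rule subsetI) (rule *[THEN conjunct2, THEN conjunct1])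
    qed (simp_all only: *)
    then have "r *\<^sub>R Te (w * x) \<le> r *\<^sub>R (1 / r) *\<^sub>R \<psi> x" using r by (intro scaleR_left_mono) simp_all
    then have "r *\<^sub>R Te (x * w) \<le> \<psi> x" using r by (simp add: commute[of x w])
    then show "Te (x * r *\<^sub>R w) \<le> \<psi> x" using H_mult_dom[OF x(1) w(4)] by (simp add: Te_scaleR)
  qed (use w r in \<open>simp_all add: H_scaleR\<close>)
  then have "inf v e = 0" using r by (simp add: w_def)
  then have "v * e = 0" by (rule mult_eq_0_of_inf)
  then show False using v by simp
qed

text \<open>For fixed \<open>r\<close>, order continuity lets Zorn's lemma give a maximal
  \<open>m\<close> below \<open>y\<close> with \<open>\<psi> m \<le> r *\<^sub>R Te m\<close>.
  Unless \<open>m\<close> is \<open>y\<close>, \<open>exists_small\<close> adds a piece of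
  \<open>y - m\<close>. As \<open>r\<close> is arbitrary, the Archimedean property finishes.\<close>

lemma dominated_eq_0:
  assumes \<psi>: "dominated K \<psi>"
    and Z: "\<And>w. w \<in> H \<Longrightarrow> 0 \<le> w \<Longrightarrow> (\<And>x. x \<in> H \<Longrightarrow> 0 \<le> x \<Longrightarrow> Te (x * w) \<le> \<psi> x) \<Longrightarrow> w = 0"
    and y: "y \<in> H" "0 \<le> y"
  shows "\<psi> y = 0"
proof -
  have "\<psi> y \<le> r *\<^sub>R Te y" if r: "0 < r" for r :: real
  proof -
    let ?X = "{x \<in> H. 0 \<le> x \<and> x \<le> y \<and> \<psi> x \<le> r *\<^sub>R Te x}"
    have po: "partial_order_on ?X (relation_of (\<le>) ?X)"
      by (rule partial_order_on_relation_ofI) auto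
    have "\<exists>u\<in>?X. \<forall>a\<in>C. a \<le> u" if C: "C \<in> Chains (relation_of (\<le>) ?X)" for C
    proof (cases "C = {}")
      case True
      then show ?thesis using y H_0 by (auto intro!: bexI[of _ 0] simp: Te_0 dominated_0[OF \<psi>])
    next
      case False
      have CX: "C \<subseteq> ?X" and chain: "\<And>a b. a \<in> C \<Longrightarrow> b \<in> C \<Longrightarrow> a \<le> b \<or> b \<le> a"
        using C unfolding Chains_def relation_of_def by blast+
      have dir: "up_directed C"
        unfolding up_directed_def
      proof (intro conjI ballI)
        fix a b assume ab: "a \<in> C" "b \<in> C"
        show "\<exists>z\<in>C. a \<le> z \<and> b \<le> z" using chain[OF ab] ab by (meson order.refl)
      qed fact
      have C_le: "c \<le> y" "0 \<le> c" "c \<in> H" "\<psi> c \<le> r *\<^sub>R Te c" if "c \<in> C" for c using that CX by auto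
      obtain s where s: "lub C s" by (rule lub_exists[OF False, of y]) (rule C_le)
      obtain c0 where c0: "c0 \<in> C" using False by blast
      have s0: "0 \<le> s" using C_le(2)[OF c0] lub_upper[OF s c0] by (rule order.trans)
      have sy: "s \<le> y" by (rule lub_least[OF s]) (rule C_le)
      have sH: "s \<in> H" by (rule H_ideal[OF y(1) s0 sy])
      have "\<psi> s \<le> r *\<^sub>R Te s"
      proof (rule dominated_order_continuous[OF \<psi> dir s _ _ sH])
        fix c assume c: "c \<in> C"
        show "0 \<le> c" by (rule C_le[OF c])
        have "Te c \<le> Te s" by (intro Te_mono H_dom C_le[OF c] sH lub_upper[OF s c])
        then have "r *\<^sub>R Te c \<le> r *\<^sub>R Te s" using r by (intro scaleR_left_mono) simp_all
        with C_le(4)[OF c] show "\<psi> c \<le> r *\<^sub>R Te s" by (rule order.trans)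
      qed (use C_le in blast)
      then have "s \<in> ?X" using sH s0 sy by simp
      then show ?thesis using lub_upper[OF s] by blast
    qed
    from predicate_Zorn[OF po this]
    obtain m where m: "m \<in> ?X" and max: "\<And>a. a \<in> ?X \<Longrightarrow> m \<le> a \<Longrightarrow> a = m" by blast
    have mH: "m \<in> H" "0 \<le> m" "m \<le> y" "\<psi> m \<le> r *\<^sub>R Te m" using m by simp_all
    have "y - m = 0"
    proof (rule ccontr)
      assume ne: "y - m \<noteq> 0"
      have ym: "y - m \<in> H" "0 \<le> y - m" using mH y by (simp_all add: H_diff)
      obtain x where x: "x \<in> H" "0 \<le> x" "x \<le> y - m" "x \<noteq> 0" "\<psi> x \<le> r *\<^sub>R Te x"
        using exists_small[OF \<psi> Z ym ne r] by blast
      have "\<psi> (m + x) = \<psi> m + \<psi> x" by (rule dominatedD(6)[OF \<psi> mH(1) x(1) mH(2) x(2)])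
      also have "\<dots> \<le> r *\<^sub>R Te m + r *\<^sub>R Te x" using mH(4) x(5) by (rule add_mono)
      also have "\<dots> = r *\<^sub>R Te (m + x)"
        by (simp add: Te_add[OF H_dom[OF mH(1)] H_dom[OF x(1)]] scaleR_add_right)
      finally have "m + x \<in> ?X" using mH x by (simp add: H_add le_diff_eq add.commute)
      moreover have "m \<le> m + x" using x(2) by simp
      ultimately have "m + x = m" by (rule max)
      then show False using x(4) by simp
    qed
    then have "y = m" by simp
    then show ?thesis using mH(4) by simp
  qed
  then have "\<psi> y \<le> 0" by (rule arch)
  then show ?thesis using dominatedD(4)[OF \<psi> y] by (simp add: order.antisym)
qed

text \<open>The supremum is glued from \<open>x\<close> along the region where it exceeds
  \<open>y\<close> and from \<open>y\<close> elsewhere. It is used to split a test element between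
  two candidates, by additivity of the functional.\<close>

lemma mult_sup_component:
  fixes x y :: 'u
  obtains p where "0 \<le> p" "p \<le> e" "sup x y = p * x + (e - p) * y"
proof -
  obtain p where p: "0 \<le> p" "p \<le> e" "p * pprt (x - y) = pprt (x - y)"
    "\<And>v. 0 \<le> v \<Longrightarrow> pprt (x - y) * v = 0 \<Longrightarrow> p * v = 0"
    by (rule support_exists[of "pprt (x - y)", OF zero_le_pprt]) blast
  have "p * pprt (- (x - y)) = 0" by (rule p(4)[OF zero_le_pprt pprt_mult_pprt_neg])
  then have "p * (pprt (x - y) - pprt (- (x - y))) = pprt (x - y)"
    by (simp only: right_diff_distrib p(3) diff_zero)
  then have "p * (x - y) = pprt (x - y)" by (simp only: diff_pprts[symmetric])
  then have "sup x y = y + p * (x - y)" by (simp only: sup_eq_add_pprt)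
  then have "sup x y = p * x + (e - p) * y" by (simp add: algebra_simps)
  then show ?thesis using that p by blast
qed

lemma dominated_representation:
  assumes \<psi>: "dominated K \<psi>"
  obtains z where "z \<in> H" "\<And>x. x \<in> H \<Longrightarrow> 0 \<le> x \<Longrightarrow> \<psi> x = Te (x * z)"
proof -
  note K = dominatedD(1,2)[OF \<psi>]
  let ?Z = "{z \<in> H. 0 \<le> z \<and> (\<forall>x\<in>H. 0 \<le> x \<longrightarrow> Te (x * z) \<le> \<psi> x)}"
  have Z: "z \<in> H" "0 \<le> z" "\<And>x. x \<in> H \<Longrightarrow> 0 \<le> x \<Longrightarrow> Te (x * z) \<le> \<psi> x" if "z \<in> ?Z" for z
    using that by auto
  have zero: "0 \<in> ?Z" using H_0 dominatedD(4)[OF \<psi>] by (auto simp: Te_0)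
  have dir: "up_directed ?Z"
    unfolding up_directed_def
  proof (intro conjI ballI)
    show "?Z \<noteq> {}" using zero by blast
    fix z1 z2 assume z1: "z1 \<in> ?Z" and z2: "z2 \<in> ?Z"
    obtain p where p: "0 \<le> p" "p \<le> e" "sup z1 z2 = p * z1 + (e - p) * z2"
      by (rule mult_sup_component)
    have "sup z1 z2 \<le> z1 + z2" using Z(2)[OF z1] Z(2)[OF z2] by simp
    moreover have s0: "0 \<le> sup z1 z2" using Z(2)[OF z1] by (rule le_supI1)
    ultimately have sH: "sup z1 z2 \<in> H" by (intro H_ideal[OF H_add[OF Z(1)[OF z1] Z(1)[OF z2]]])
    have "Te (x * sup z1 z2) \<le> \<psi> x" if x: "x \<in> H" "0 \<le> x" for x
    proof -
      define u v where "u = p * x" and "v = (e - p) * x"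
      have uv: "x = u + v" by (simp add: u_def v_def left_diff_distrib)
      have u0: "0 \<le> u" and v0: "0 \<le> v" using p x(2) by (simp_all add: u_def v_def)
      then have "u \<le> x" "v \<le> x" by (simp_all add: uv)
      then have uH: "u \<in> H" and vH: "v \<in> H" using H_ideal[OF x(1)] u0 v0 by blast+
      have "x * sup z1 z2 = u * z1 + v * z2"
        unfolding p(3) u_def v_def distrib_left by (simp only: mult_acs)
      then have "Te (x * sup z1 z2) = Te (u * z1) + Te (v * z2)"
        by (simp only: Te_add[OF H_mult_dom[OF uH Z(1)[OF z1]] H_mult_dom[OF vH Z(1)[OF z2]]])
      also have "\<dots> \<le> \<psi> u + \<psi> v"
        using Z(3)[OF z1 uH u0] Z(3)[OF z2 vH v0] by (rule add_mono)
      also have "\<dots> = \<psi> x" unfolding uv by (rule dominatedD(6)[OF \<psi> uH vH u0 v0, symmetric])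
      finally show ?thesis .
    qed
    then have "sup z1 z2 \<in> ?Z" using sH s0 by blast
    then show "\<exists>z\<in>?Z. z1 \<le> z \<and> z2 \<le> z" by (intro bexI[of _ "sup z1 z2"]) simp_all
  qed
  \<comment> \<open>Testing the candidate \<open>z\<close> against itself bounds
    \<open>Te (z * z)\<close> by \<open>\<psi> z\<close>; the quadratic bound and cancellation then
    give \<open>K\<close>.\<close>
  have TK: "Te (z * z) \<le> K" if z: "z \<in> ?Z" for z
  proof (rule le_if_square_le[OF _ K(2)])
    show q0: "0 \<le> Te (z * z)" by (intro Te_nonneg H_square_dom Z(1)[OF z] square_nonneg)
    have le: "Te (z * z) \<le> \<psi> z" by (rule Z(3)[OF z Z(1,2)[OF z]])
    have "Te (z * z) * Te (z * z) \<le> \<psi> z * \<psi> z"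
      by (rule mult_mono[OF le le dominatedD(4)[OF \<psi> Z(1,2)[OF z]] q0])
    also have "\<dots> \<le> K * Te (z * z)" by (rule dominatedD(5)[OF \<psi> Z(1,2)[OF z]])
    finally show "Te (z * z) * Te (z * z) \<le> K * Te (z * z)" .
  qed
  have Zdom: "?Z \<subseteq> dom" using H_dom by blast
  \<comment> \<open>Turns the norm bound into the bound on expectations that \<open>levi\<close>
    asks for.\<close>
  have Tz: "Te z \<le> e + K" if z: "z \<in> ?Z" for z
  proof -
    have "z \<le> e + z * z" using abs_le_unit_add_square[of z] Z(2)[OF z] by simp
    then have "Te z \<le> Te (e + z * z)"
      by (rule Te_mono[OF H_dom[OF Z(1)[OF z]] dom_add[OF A_dom[OF unit_A] H_square_dom[OF Z(1)[OF z]]]])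
    also have "\<dots> = e + Te (z * z)"
      by (simp only: Te_add[OF A_dom[OF unit_A] H_square_dom[OF Z(1)[OF z]]] Te_fixes_A[OF unit_A])
    also have "\<dots> \<le> e + K" using TK[OF z] by (rule add_left_mono)
    finally show ?thesis .
  qed
  obtain s where s: "lub ?Z s" by (rule levi[OF dir Zdom Z(2) Tz])
  have s0: "0 \<le> s" by (rule lub_upper[OF s zero])
  have sH: "s \<in> H"
    unfolding H_iff
  proof (rule Te_order_continuous(1)[OF _ lub_squares[OF dir s Z(2)]])
    show "up_directed ((\<lambda>z. z * z) ` ?Z)" by (rule up_directed_image[OF dir]) (intro mult_mono; simp)
    show "(\<lambda>z. z * z) ` ?Z \<subseteq> dom" using H_square_dom by blast
    show "0 \<le> x" if "x \<in> (\<lambda>z. z * z) ` ?Z" for x using that by auto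
    show "Te x \<le> K" if "x \<in> (\<lambda>z. z * z) ` ?Z" for x using that TK by blast
  qed
  have s_le: "Te (x * s) \<le> \<psi> x" if x: "x \<in> H" "0 \<le> x" for x
  proof (rule Te_order_continuous(2)[OF _ lub_mult[OF dir s x(2)]])
    show "up_directed ((*) x ` ?Z)" by (rule up_directed_image[OF dir]) (rule mult_left_mono[OF _ x(2)])
    show "(*) x ` ?Z \<subseteq> dom" using H_mult_dom[OF x(1)] by blast
    show "0 \<le> y" if "y \<in> (*) x ` ?Z" for y using that x by auto
    show "Te y \<le> \<psi> x" if "y \<in> (*) x ` ?Z" for y using that Z(3) x by blast
  qed
  \<comment> \<open>The remainder is nonnegative and below \<open>\<psi>\<close>, so it inherits the
    bound \<open>K\<close>; any further representing element below it could be added to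
    \<open>s\<close>.\<close>
  define \<psi>' where "\<psi>' x = \<psi> x - Te (x * s)" for x
  have \<psi>': "dominated K \<psi>'"
    unfolding dominated_def
  proof (intro conjI ballI impI K)
    fix x assume x: "x \<in> H" "0 \<le> x"
    have xs: "x * s \<in> dom" by (rule H_mult_dom[OF x(1) sH])
    show "\<psi>' x \<in> A" unfolding \<psi>'_def by (rule A_diff[OF dominatedD(3)[OF \<psi> x] Te_A[OF xs]])
    show p: "0 \<le> \<psi>' x" unfolding \<psi>'_def using s_le[OF x] by simp
    have "0 \<le> Te (x * s)" by (rule Te_nonneg[OF xs mult_nonneg_nonneg[OF x(2) s0]])
    then have le: "\<psi>' x \<le> \<psi> x" unfolding \<psi>'_def by simp
    have "\<psi>' x * \<psi>' x \<le> \<psi> x * \<psi> x" by (rule mult_mono[OF le le dominatedD(4)[OF \<psi> x] p])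
    also have "\<dots> \<le> K * Te (x * x)" by (rule dominatedD(5)[OF \<psi> x])
    finally show "\<psi>' x * \<psi>' x \<le> K * Te (x * x)" .
  next
    fix x y assume x: "x \<in> H" "0 \<le> x" and y: "y \<in> H" "0 \<le> y"
    show "\<psi>' (x + y) = \<psi>' x + \<psi>' y"
      unfolding \<psi>'_def dominatedD(6)[OF \<psi> x(1) y(1) x(2) y(2)] distrib_right
        Te_add[OF H_mult_dom[OF x(1) sH] H_mult_dom[OF y(1) sH]] by simp
  qed
  have max: "w = 0" if w: "w \<in> H" "0 \<le> w" "\<And>x. x \<in> H \<Longrightarrow> 0 \<le> x \<Longrightarrow> Te (x * w) \<le> \<psi>' x" for w
  proof -
    have "Te (x * (s + w)) \<le> \<psi> x" if x: "x \<in> H" "0 \<le> x" for x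
      using w(3)[OF x] by (simp add: \<psi>'_def distrib_left Te_add[OF H_mult_dom[OF x(1) sH] H_mult_dom[OF x(1) w(1)]] le_diff_eq add.commute)
    then have "s + w \<in> ?Z" using sH s0 w by (simp add: H_add)
    then have "s + w \<le> s" by (rule lub_upper[OF s])
    then have "w \<le> 0" by simp
    then show ?thesis using w(2) by (rule order.antisym)
  qed
  have "\<psi> x = Te (x * s)" if x: "x \<in> H" "0 \<le> x" for x
    using dominated_eq_0[OF \<psi>' max x] by (simp add: \<psi>'_def)
  then show ?thesis using that sH by blast
qed

lemma riesz_representation:
  assumes \<phi>A: "\<And>x. x \<in> H \<Longrightarrow> \<phi> x \<in> A"
    and add: "\<And>x y. x \<in> H \<Longrightarrow> y \<in> H \<Longrightarrow> \<phi> (x + y) = \<phi> x + \<phi> y"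
    and K: "K \<in> A" "0 \<le> K" "\<And>x. x \<in> H \<Longrightarrow> \<phi> x * \<phi> x \<le> K * Te (x * x)"
  obtains z where "z \<in> H" "\<And>x. x \<in> H \<Longrightarrow> \<phi> x = Te (x * z)"
proof -
  \<comment> \<open>\<open>N x\<close> is the norm bound of \<open>\<phi>\<close> at
    \<open>x\<close>, needed in unsquared form to bound a supremum of values.\<close>
  have "\<exists>N. N \<in> A \<and> 0 \<le> N \<and> N * N = K * Te (x * x)" if x: "x \<in> H" for x
  proof -
    have "K * Te (x * x) \<in> A" by (intro A_mult K Te_A H_square_dom x)
    moreover have "0 \<le> K * Te (x * x)" by (intro mult_nonneg_nonneg K Te_nonneg H_square_dom x square_nonneg)
    ultimately show ?thesis by (rule A_sqrt) blast
  qed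
  then obtain N where N: "\<And>x. x \<in> H \<Longrightarrow> N x \<in> A" "\<And>x. x \<in> H \<Longrightarrow> 0 \<le> N x"
      "\<And>x. x \<in> H \<Longrightarrow> N x * N x = K * Te (x * x)" by metis
  have \<phi>_le: "\<phi> z \<le> N x" if x: "x \<in> H" and z: "0 \<le> z" "z \<le> x" for x z
  proof (rule square_le_imp_le[OF N(2)[OF x]])
    have zH: "z \<in> H" by (rule H_ideal[OF x z])
    have "\<phi> z * \<phi> z \<le> K * Te (z * z)" by (rule K(3)[OF zH])
    also have "\<dots> \<le> K * Te (x * x)"
      using z K(2) by (intro mult_left_mono Te_mono H_square_dom zH x mult_mono) (simp_all add: order.trans[OF z])
    finally show "\<phi> z * \<phi> z \<le> N x * N x" by (simp only: N(3)[OF x])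
  qed
  have \<phi>_0: "\<phi> 0 = 0" using add[OF H_0 H_0] by simp
  \<comment> \<open>The supremum \<open>\<alpha> x\<close> of these values is the Riesz-Kantorovich
    positive part of \<open>\<phi>\<close>.\<close>
  let ?F = "\<lambda>x. \<phi> ` {z \<in> H. 0 \<le> z \<and> z \<le> x}"
  have "\<exists>s. lub (?F x) s" if x: "x \<in> H" "0 \<le> x" for x
  proof -
    have "\<phi> 0 \<in> ?F x" using x H_0 by (intro imageI) simp
    then have "?F x \<noteq> {}" by blast
    then obtain s where "lub (?F x) s" by (rule lub_exists[of _ "N x"]) (use \<phi>_le x in blast)
    then show ?thesis by blast
  qed
  then obtain \<alpha> where \<alpha>: "\<And>x. x \<in> H \<Longrightarrow> 0 \<le> x \<Longrightarrow> lub (?F x) (\<alpha> x)" by metis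
  have \<alpha>_upper: "\<phi> z \<le> \<alpha> x" if "x \<in> H" "0 \<le> z" "z \<le> x" for x z
    using that by (intro lub_upper[OF \<alpha>] imageI) (auto intro: H_ideal order.trans)
  have \<alpha>_nonneg: "0 \<le> \<alpha> x" if "x \<in> H" "0 \<le> x" for x
    using \<alpha>_upper[of x 0] that by (simp add: \<phi>_0)
  have \<alpha>_N: "\<alpha> x \<le> N x" if x: "x \<in> H" "0 \<le> x" for x
    by (rule lub_least[OF \<alpha>[OF x]]) (use \<phi>_le x in blast)
  have \<alpha>_A: "\<alpha> x \<in> A" if x: "x \<in> H" "0 \<le> x" for x
  proof (rule A_lub[OF _ \<alpha>[OF x]])
    show "?F x \<subseteq> A" using \<phi>A by blast
    show "\<alpha> x \<in> dom"
      by (rule dom_ideal[OF A_dom[OF N(1)[OF x(1)]]]) (simp add: \<alpha>_nonneg[OF x] \<alpha>_N[OF x])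
  qed
  have \<alpha>_add: "\<alpha> (x + y) = \<alpha> x + \<alpha> y" if x: "x \<in> H" "0 \<le> x" and y: "y \<in> H" "0 \<le> y" for x y
  proof (rule order.antisym)
    have xy: "x + y \<in> H" "0 \<le> x + y" using x y by (simp_all add: H_add)
    show "\<alpha> (x + y) \<le> \<alpha> x + \<alpha> y"
    proof (rule lub_least[OF \<alpha>[OF xy]])
      fix t assume "t \<in> ?F (x + y)"
      then obtain z where z: "z \<in> H" "0 \<le> z" "z \<le> x + y" "t = \<phi> z" by blast
      define z1 z2 where "z1 = inf z x" and "z2 = pprt (z - x)"
      have z_eq: "z = z1 + z2" unfolding z1_def z2_def inf_eq_diff_pprt by simp
      have z1: "0 \<le> z1" "z1 \<le> x" using z x by (simp_all add: z1_def)
      have "z - x \<le> y" using z(3) by (simp add: algebra_simps)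
      then have z2: "0 \<le> z2" "z2 \<le> y" using y by (simp_all only: z2_def zero_le_pprt pprt_le)
      have "t = \<phi> z1 + \<phi> z2"
        unfolding z(4) z_eq by (rule add[OF H_ideal[OF x(1) z1] H_ideal[OF y(1) z2]])
      also have "\<dots> \<le> \<alpha> x + \<alpha> y" by (intro add_mono \<alpha>_upper x y z1 z2)
      finally show "t \<le> \<alpha> x + \<alpha> y" .
    qed
    have "\<alpha> x \<le> \<alpha> (x + y) - \<alpha> y"
    proof (rule lub_least[OF \<alpha>[OF x]])
      fix t assume "t \<in> ?F x"
      then obtain z1 where z1: "z1 \<in> H" "0 \<le> z1" "z1 \<le> x" "t = \<phi> z1" by blast
      have "\<alpha> y \<le> \<alpha> (x + y) - t"
      proof (rule lub_least[OF \<alpha>[OF y]])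
        fix r assume "r \<in> ?F y"
        then obtain z2 where z2: "z2 \<in> H" "0 \<le> z2" "z2 \<le> y" "r = \<phi> z2" by blast
        have "\<phi> (z1 + z2) \<le> \<alpha> (x + y)" using z1 z2 by (intro \<alpha>_upper xy) (simp_all add: add_mono)
        then show "r \<le> \<alpha> (x + y) - t"
          unfolding z1(4) z2(4) by (simp add: add[OF z1(1) z2(1)] le_diff_eq add.commute)
      qed
      then show "t \<le> \<alpha> (x + y) - \<alpha> y" by (simp add: le_diff_eq add.commute)
    qed
    then show "\<alpha> x + \<alpha> y \<le> \<alpha> (x + y)" by (simp add: le_diff_eq)
  qed
  \<comment> \<open>Both functionals are at most \<open>N x + N x\<close>, whose square is four
    times \<open>K * Te (x * x)\<close>.\<close>
  have d1: "dominated (4 *\<^sub>R K) \<alpha>" and d2: "dominated (4 *\<^sub>R K) (\<lambda>x. \<alpha> x - \<phi> x)"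
  proof -
    have le_4: "t * t \<le> (4 *\<^sub>R K) * Te (x * x)" if t: "0 \<le> t" "t \<le> N x + N x" and x: "x \<in> H" for t x
    proof -
      have "t * t \<le> (N x + N x) * (N x + N x)"
        using t N(2)[OF x] by (intro mult_mono) simp_all
      also have "\<dots> = (2 *\<^sub>R N x) * (2 *\<^sub>R N x)" by (simp only: scaleR_2)
      also have "\<dots> = (4 *\<^sub>R K) * Te (x * x)" by (simp add: N(3)[OF x])
      finally show ?thesis .
    qed
    have neg: "- \<phi> x \<le> N x" if x: "x \<in> H" for x
      by (rule square_le_imp_le[OF N(2)[OF x]]) (use K(3)[OF x] N(3)[OF x] in simp)
    show "dominated (4 *\<^sub>R K) \<alpha>"
      unfolding dominated_def
    proof (intro conjI ballI impI A_scaleR K \<alpha>_A \<alpha>_nonneg \<alpha>_add le_4)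
      fix x assume x: "x \<in> H" "0 \<le> x"
      have "\<alpha> x + 0 \<le> N x + N x" by (intro add_mono \<alpha>_N N x)
      then show "\<alpha> x \<le> N x + N x" by simp
    qed (use K in simp)
    show "dominated (4 *\<^sub>R K) (\<lambda>x. \<alpha> x - \<phi> x)"
      unfolding dominated_def
    proof (intro conjI ballI impI A_scaleR K A_diff \<alpha>_A \<phi>A le_4)
      fix x assume x: "x \<in> H" "0 \<le> x"
      show "0 \<le> \<alpha> x - \<phi> x" using \<alpha>_upper[OF x(1,2)] by simp
      then show "0 \<le> \<alpha> x - \<phi> x" .
      have "\<alpha> x + - \<phi> x \<le> N x + N x" by (intro add_mono \<alpha>_N neg x)
      then show "\<alpha> x - \<phi> x \<le> N x + N x" by simp
    next
      fix x y assume x: "x \<in> H" "0 \<le> x" and y: "y \<in> H" "0 \<le> y"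
      show "\<alpha> (x + y) - \<phi> (x + y) = \<alpha> x - \<phi> x + (\<alpha> y - \<phi> y)"
        using \<alpha>_add[OF x y] add[OF x(1) y(1)] by simp
    qed (use K in simp)
  qed
  obtain z1 where z1: "z1 \<in> H" "\<And>x. x \<in> H \<Longrightarrow> 0 \<le> x \<Longrightarrow> \<alpha> x = Te (x * z1)"
    by (rule dominated_representation[OF d1]) blast
  obtain z2 where z2: "z2 \<in> H" "\<And>x. x \<in> H \<Longrightarrow> 0 \<le> x \<Longrightarrow> \<alpha> x - \<phi> x = Te (x * z2)"
    by (rule dominated_representation[OF d2]) blast
  have pos: "\<phi> x = Te (x * (z1 - z2))" if x: "x \<in> H" "0 \<le> x" for x
  proof -
    have "Te (x * (z1 - z2)) = \<alpha> x - (\<alpha> x - \<phi> x)"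
      unfolding right_diff_distrib Te_diff[OF H_mult_dom[OF x(1) z1(1)] H_mult_dom[OF x(1) z2(1)]]
      using z1(2)[OF x] z2(2)[OF x] by simp
    then show ?thesis by simp
  qed
  have zH: "z1 - z2 \<in> H" by (rule H_diff[OF z1(1) z2(1)])
  have "\<phi> x = Te (x * (z1 - z2))" if x: "x \<in> H" for x
  proof -
    define p q where "p = pprt x" and "q = pprt (- x)"
    have pq: "p \<in> H" "q \<in> H" "0 \<le> p" "0 \<le> q" using x by (simp_all add: p_def q_def H_pprt H_minus)
    have xpq: "x + q = p" unfolding p_def q_def using diff_pprts[of x] by (simp add: eq_diff_eq)
    then have "\<phi> x + \<phi> q = \<phi> p" using add[OF x pq(2)] by simp
    moreover have "Te (x * (z1 - z2)) + Te (q * (z1 - z2)) = Te (p * (z1 - z2))"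
      unfolding xpq[symmetric] distrib_right using H_mult_dom[OF x zH] H_mult_dom[OF pq(2) zH] by (simp only: Te_add)
    ultimately have "\<phi> x + \<phi> q = Te (x * (z1 - z2)) + \<phi> q"
      using pos[OF pq(1,3)] pos[OF pq(2,4)] by simp
    then show ?thesis by simp
  qed
  then show ?thesis using that zH by blast
qed

subsection \<open>The adjoint\<close>

lemma BT_D:
  assumes "S \<in> BT E T"
  shows "x \<in> H \<Longrightarrow> S x \<in> H"
    and "x \<in> H \<Longrightarrow> y \<in> H \<Longrightarrow> S (x + y) = S x + S y"
    and "a \<in> A \<Longrightarrow> x \<in> H \<Longrightarrow> S (a * x) = a * S x"
  using assms by (auto simp: BT_def)

text \<open>Taking \<open>x = S' y\<close> in the adjoint identity bounds the square of
  \<open>nrm (S' y)\<close> by \<open>k * nrm y\<close> times itself, and the factor cancels. Only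
  that \<open>S'\<close> maps \<open>H\<close> to itself is assumed, so the existence proof can use
  this to obtain boundedness.\<close>

lemma T_strong_bound_adjoint:
  assumes S: "S \<in> BT E T" and S': "\<And>y. y \<in> H \<Longrightarrow> S' y \<in> H" and adj: "is_T_adjoint E T S S'"
    and k: "T_strong_bound E T S k"
  shows "T_strong_bound E T S' k"
  unfolding T_strong_bound_def
proof (intro conjI ballI)
  show kA: "k \<in> A" and k0: "0 \<le> k" using k by (simp_all add: T_strong_bound_def)
  fix y assume y: "y \<in> H"
  note z = S'[OF y]
  note N = nrm[OF z] and M = nrm[OF y]
  show "nrm (S' y) \<le> k * nrm y"
  proof (rule le_if_square_le[OF N(2)])
    show "0 \<le> k * nrm y" by (rule mult_nonneg_nonneg[OF k0 M(2)])
    have "nrm (S' y) * nrm (S' y) = Te (S (S' y) * y)"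
      using adj z y unfolding N(3) is_T_adjoint_def T_inner_def by simp
    also have "\<dots> \<le> nrm (S (S' y)) * nrm y" by (rule inner_le[OF BT_D(1)[OF S z] y])
    also have "\<dots> \<le> (k * nrm (S' y)) * nrm y"
      using k z by (intro mult_right_mono M(2)) (simp add: T_strong_bound_def)
    also have "\<dots> = (k * nrm y) * nrm (S' y)" by (simp only: mult_acs)
    finally show "nrm (S' y) * nrm (S' y) \<le> (k * nrm y) * nrm (S' y)" .
  qed
qed

lemma adjoint_exists:
  assumes S: "S \<in> BT E T"
  obtains S' where "S' \<in> BT E T" "is_T_adjoint E T S S'"
proof -
  obtain k where k: "T_strong_bound E T S k" using S by (auto simp: BT_def)
  have kA: "k \<in> A" "0 \<le> k" using k by (simp_all add: T_strong_bound_def)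
  have "\<exists>z\<in>H. \<forall>x\<in>H. Te (S x * y) = Te (x * z)" if y: "y \<in> H" for y
  proof -
    have "\<exists>z. z \<in> H \<and> (\<forall>x\<in>H. Te (S x * y) = Te (x * z))"
    \<comment> \<open>Cauchy-Schwarz bounds the functional by \<open>k * nrm y\<close> times
      \<open>nrm x\<close>; the constant is the square of that factor.\<close>
    proof (rule riesz_representation[of "\<lambda>x. Te (S x * y)" "(k * nrm y) * (k * nrm y)"])
      fix x assume x: "x \<in> H"
      note Sx = BT_D(1)[OF S x]
      show "Te (S x * y) \<in> A" by (rule Te_A[OF H_mult_dom[OF Sx y]])
      have "\<bar>Te (S x * y)\<bar> \<le> nrm (S x) * nrm y" by (rule cauchy_schwarz[OF Sx y])
      also have "\<dots> \<le> (k * nrm x) * nrm y"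
        using k x by (intro mult_right_mono nrm(2)[OF y]) (simp add: T_strong_bound_def)
      finally have le: "\<bar>Te (S x * y)\<bar> \<le> (k * nrm x) * nrm y" .
      have "0 \<le> (k * nrm x) * nrm y" by (intro mult_nonneg_nonneg kA nrm(2) x y)
      then have "Te (S x * y) * Te (S x * y) \<le> ((k * nrm x) * nrm y) * ((k * nrm x) * nrm y)"
        using le by (intro square_mono_abs) simp
      also have "\<dots> = ((k * nrm y) * (k * nrm y)) * (nrm x * nrm x)" by (simp only: mult_acs)
      finally show "Te (S x * y) * Te (S x * y) \<le> ((k * nrm y) * (k * nrm y)) * Te (x * x)"
        by (simp only: nrm(3)[OF x])
    next
      fix x x' assume x: "x \<in> H" "x' \<in> H"
      show "Te (S (x + x') * y) = Te (S x * y) + Te (S x' * y)"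
        unfolding BT_D(2)[OF S x] distrib_right
        by (rule Te_add[OF H_mult_dom[OF BT_D(1)[OF S x(1)] y] H_mult_dom[OF BT_D(1)[OF S x(2)] y]])
    next
      show "(k * nrm y) * (k * nrm y) \<in> A" by (intro A_mult kA nrm(1)[OF y])
    qed auto
    then show ?thesis by blast
  qed
  then obtain R where R: "\<And>y. y \<in> H \<Longrightarrow> R y \<in> H" "\<And>x y. x \<in> H \<Longrightarrow> y \<in> H \<Longrightarrow> Te (S x * y) = Te (x * R y)"
    by metis
  define S' where "S' = restrict R H"
  have S'_eq: "S' y = R y" if "y \<in> H" for y using that by (simp add: S'_def)
  have S'_H: "S' y \<in> H" if "y \<in> H" for y using that by (simp add: S'_eq R(1))
  have inner: "Te (x * S' y) = Te (S x * y)" if "x \<in> H" "y \<in> H" for x y using R(2)[OF that] S'_eq[OF that(2)] by simp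
  have adj: "is_T_adjoint E T S S'" by (simp add: is_T_adjoint_def T_inner_def inner)
  have "S' \<in> BT E T"
    unfolding BT_def
  proof (intro CollectI conjI ballI)
    show "S' \<in> H \<rightarrow>\<^sub>E H" by (simp add: S'_def R(1))
    show "\<exists>k. T_strong_bound E T S' k" using T_strong_bound_adjoint[OF S S'_H adj k] by blast
  next
    \<comment> \<open>Additivity, and homogeneity after it, hold because both sides have the same
      inner products with every element of \<open>H\<close>.\<close>
    fix y y' assume y: "y \<in> H" "y' \<in> H"
    show "S' (y + y') = S' y + S' y'"
    proof (rule inner_eq_imp_eq[OF S'_H[OF H_add[OF y]] H_add[OF S'_H[OF y(1)] S'_H[OF y(2)]]])
      fix x assume x: "x \<in> H"
      note Sx = BT_D(1)[OF S x]
      show "Te (x * S' (y + y')) = Te (x * (S' y + S' y'))"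
        unfolding inner[OF x H_add[OF y]] distrib_left
          Te_add[OF H_mult_dom[OF x S'_H[OF y(1)]] H_mult_dom[OF x S'_H[OF y(2)]]] inner[OF x y(1)] inner[OF x y(2)]
        by (rule Te_add[OF H_mult_dom[OF Sx y(1)] H_mult_dom[OF Sx y(2)]])
    qed
  next
    fix a y assume a: "a \<in> A" and y: "y \<in> H"
    show "S' (a * y) = a * S' y"
    proof (rule inner_eq_imp_eq[OF S'_H[OF H_mult_A[OF a y]] H_mult_A[OF a S'_H[OF y]]])
      fix x assume x: "x \<in> H"
      have "Te (x * S' (a * y)) = Te (S x * (a * y))" by (rule inner[OF x H_mult_A[OF a y]])
      also have "S x * (a * y) = a * (S x * y)" by (rule left_commute)
      also have "Te \<dots> = a * Te (S x * y)" by (rule averaging[OF a H_mult_dom[OF BT_D(1)[OF S x] y]])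
      also have "\<dots> = a * Te (x * S' y)" by (simp only: inner[OF x y])
      also have "\<dots> = Te (a * (x * S' y))" by (rule averaging[OF a H_mult_dom[OF x S'_H[OF y]], symmetric])
      also have "a * (x * S' y) = x * (a * S' y)" by (rule left_commute)
      finally show "Te (x * S' (a * y)) = Te (x * (a * S' y))" .
    qed
  qed
  then show ?thesis using that adj by blast
qed

lemma adjoint_unique:
  assumes "S1 \<in> BT E T" "is_T_adjoint E T S S1" "S2 \<in> BT E T" "is_T_adjoint E T S S2"
  shows "S1 = S2"
proof (rule PiE_ext)
  show "S1 \<in> H \<rightarrow>\<^sub>E H" "S2 \<in> H \<rightarrow>\<^sub>E H" using assms by (auto simp: BT_def)
  fix y assume y: "y \<in> H"
  show "S1 y = S2 y"
  proof (rule inner_eq_imp_eq[OF BT_D(1)[OF assms(1) y] BT_D(1)[OF assms(3) y]])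
    fix x assume x: "x \<in> H"
    show "Te (x * S1 y) = Te (x * S2 y)"
      using assms(2,4) x y unfolding is_T_adjoint_def T_inner_def by metis
  qed
qed

end

theorem theorem6p1:
  fixes E :: "'u::f_algebra set" and e :: 'u and T S :: "'u \<Rightarrow> 'u"
  assumes "riesz_subspace E" and "dedekind_complete E" and "weak_order_unit E e"
    and "universal_completion E (UNIV :: 'u set)"
    and "\<forall>x. e * x = x \<and> x * e = x"
    and "conditional_expectation E T" and "T e = e" and "strictly_positive_on E T"
    and "S \<in> BT E T"
  shows "(\<exists>!S'. S' \<in> BT E T \<and> is_T_adjoint E T S S') \<and>
    (\<forall>S' k. S' \<in> BT E T \<and> is_T_adjoint E T S S' \<and> T_strong_bound E T S k
       \<longrightarrow> T_strong_bound E T S' k)"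
proof -
  interpret conditional_expectation_space e E T
    by unfold_locales (use assms in \<open>auto simp: universal_completion_def weak_order_unit_def\<close>)
  obtain S' where S': "S' \<in> BT E T" "is_T_adjoint E T S S'" by (rule adjoint_exists[OF assms(9)])
  show ?thesis
  proof (intro conjI allI impI)
    show "\<exists>!S'. S' \<in> BT E T \<and> is_T_adjoint E T S S'"
    proof (rule ex1I)
      show "S' \<in> BT E T \<and> is_T_adjoint E T S S'" using S' by (rule conjI)
      fix R assume R: "R \<in> BT E T \<and> is_T_adjoint E T S R"
      show "R = S'" by (rule adjoint_unique[OF R[THEN conjunct1] R[THEN conjunct2] S'])
    qed
    fix R k assume *: "R \<in> BT E T \<and> is_T_adjoint E T S R \<and> T_strong_bound E T S k"
    then have R: "R \<in> BT E T" "is_T_adjoint E T S R" "T_strong_bound E T S k" by simp_all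
    show "T_strong_bound E T R k"
      by (rule T_strong_bound_adjoint[OF assms(9) BT_D(1)[OF R(1)] R(2,3)])
  qed
qed

end
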